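(* (a) Let $0<p\le 1$. If $\mathcal{H}$ is a $p$-normed (resp. $p$-Banach) multilinear hyper-ideal such that $\mathcal{L}\circ\mathcal{H}\subseteq\mathcal{H}$ and $\|A\|_{\mathcal H}\le\|A\|_{\mathcal{L}\circ\mathcal{H}}$ for every $A\in\mathcal{L}\circ\mathcal{H}$, then $\mathcal{P}^{\mathcal H}$ is a $p$-normed (resp. $p$-Banach) polynomial $\left(\frac{n^n}{n!},\frac{n^n}{n!}\right)_{n=1}^\infty$-two-sided ideal. (b) If $\mathcal{H}$ is a normed (resp. Banach) strongly symmetric multilinear hyper-ideal such that $\mathcal{L}\circ\mathcal{H}\subseteq\mathcal{H}$ and $\|A\|_{\mathcal H}\le\|A\|_{\mathcal{L}\circ\mathcal{H}}$ for every $A\in\mathcal{L}\circ\mathcal{H}$, then $\mathcal{P}_{\mathcal H}$ is a normed (resp. Banach) polynomial $\left(\frac{n^n}{n!},\frac{n^n}{n!}\right)_{n=1}^\infty$-two-sided ideal.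
   Context: All Banach spaces are over $\mathbb{K}=\mathbb{R}$ or $\mathbb{C}$. $\mathcal{P}(^nE;F)$ ($n\ge 1$) is the Banach space of continuous $n$-homogeneous polynomials from $E$ to $F$ with the sup norm $\|\cdot\|$; $\mathcal{L}(E_1,\dots,E_n;F)$ is the Banach space of continuous $n$-linear operators with the sup norm, $\mathcal{L}(^nE;F)$ if $E_1=\cdots=E_n=E$, and $\mathcal{L}_s(^nE;F)$ is its subspace of symmetric operators. For $A\in\mathcal{L}(^nE;F)$, $\widehat{A}(x)=A(x,\dots,x)$; for $P\in\mathcal{P}(^nE;F)$, $\check P$ is the unique symmetric operator in $\mathcal{L}(^nE;F)$ with $(\check P)^\wedge=P$. An $n$-linear operator of finite type is a finite sum of operators $(x_1,\dots,x_n)\mapsto\varphi_1(x_1)\cdots\varphi_n(x_n)y$ with $\varphi_i\in E_i'$, $y\in F$; a polynomial of finite type is a finite sum of polynomials $x\mapsto\varphi(x)^ny$, $\varphi\in E'$, $y\in F$. A $p$-normed multilinear hyper-ideal is a subclass $\mathcal{H}$ of the class of all continuous multilinear operators between Banach spaces with a function $\|\cdot\|_{\mathcal H}\colon\mathcal{H}\to[0,\infty)$ such that, with $\mathcal{H}(E_1,\dots,E_n;F)=\mathcal{L}(E_1,\dots,E_n;F)\cap\mathcal{H}$: (1) each $\mathcal{H}(E_1,\dots,E_n;F)$ is a linear subspace of $\mathcal{L}(E_1,\dots,E_n;F)$ containing the $n$-linear operators of finite type, on which $\|\cdot\|_{\mathcal H}$ is a $p$-norm; (2) $\|I_n\|_{\mathcal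 H}=1$ for all $n$, where $I_n\colon\mathbb{K}^n\to\mathbb{K}$, $I_n(\lambda_1,\dots,\lambda_n)=\lambda_1\cdots\lambda_n$; (3) for all $n$, $1\le m_1<\cdots<m_n$ and Banach spaces $G_1,\dots,G_{m_n},E_1,\dots,E_n,F,H$, if $B_1\in\mathcal{L}(G_1,\dots,G_{m_1};E_1),\dots,B_n\in\mathcal{L}(G_{m_{n-1}+1},\dots,G_{m_n};E_n)$, $t\in\mathcal{L}(F;H)$ and $A\in\mathcal{H}(E_1,\dots,E_n;F)$, then $t\circ A\circ(B_1,\dots,B_n)\in\mathcal{H}(G_1,\dots,G_{m_n};H)$ and $\|t\circ A\circ(B_1,\dots,B_n)\|_{\mathcal H}\le\|t\|\,\|A\|_{\mathcal H}\|B_1\|\cdots\|B_n\|$. It is $p$-Banach if all components are complete for $\|\cdot\|_{\mathcal H}$; "normed"/"Banach" means $p=1$. $\mathcal{H}$ is strongly symmetric if for all $A\in\mathcal{H}(^nE;F)$ and permutations $\sigma\in S_n$, $A_\sigma(x_1,\dots,x_n):=A(x_{\sigma(1)},\dots,x_{\sigma(n)})$ satisfies $A_\sigma\in\mathcal{H}$ and $\|A_\sigma\|_{\mathcal H}=\|A\|_{\mathcal H}$. $A\in\mathcal{L}(E_1,\dots,E_n;F)$ belongs to $\mathcal{L}\circ\mathcal{H}$ if there are natural numbers $m,r$ with $mr=n$, a Banach space $G$, operators $B_1\in\mathcal{H}(E_1,\dots,E_m;G),\dots,B_r\in\mathcal{H}(E_{(r-1)m+1},\dots,E_n;G)$ and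 $C\in\mathcal{L}_s(^rG;F)$ such that $A=C\circ(B_1,\dots,B_r)$; $\|A\|_{\mathcal{L}\circ\mathcal{H}}=\inf\|C\|\,\|B_1\|_{\mathcal H}\cdots\|B_r\|_{\mathcal H}$ over all such factorizations. $\mathcal{P}^{\mathcal H}=\{P: P=\widehat{A}\text{ for some }A\in\mathcal{H}\}$ with $\|P\|_{\mathcal{P}^{\mathcal H}}=\inf\{\|A\|_{\mathcal H}:A\in\mathcal{H},\ P=\widehat{A}\}$; $\mathcal{P}_{\mathcal H}=\{P:\check P\in\mathcal{H}\}$ with $\|P\|_{\mathcal{P}_{\mathcal H}}=\|\check P\|_{\mathcal H}$ ($P$ ranging over continuous homogeneous polynomials between Banach spaces). For sequences $(C_n)_n,(K_n)_n$ of reals $\ge1$ with $C_1=K_1=1$, a $p$-normed polynomial $(C_n,K_n)_n$-two-sided ideal is a class $\mathcal{Q}$ of continuous homogeneous polynomials between Banach spaces with a function $\|\cdot\|_{\mathcal Q}\colon\mathcal{Q}\to[0,\infty)$ such that, with $\mathcal{Q}(^nE;F)=\mathcal{P}(^nE;F)\cap\mathcal{Q}$: (i) each $\mathcal{Q}(^nE;F)$ is a linear subspace of $\mathcal{P}(^nE;F)$ containing the $n$-homogeneous polynomials of finite type; (ii) $\|\cdot\|_{\mathcal Q}$ is a $p$-norm on each $\mathcal{Q}(^nE;F)$; (iii) $\|\widehat{I_n}\|_{\mathcal Q}=1$ for all $n$, where $\widehat{I_n}(\lambda)=\lambda^n$ on $\mathbb{K}$; (iv) if $P\in\mathcal{Q}(^nE;F)$,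 $Q\in\mathcal{P}(^mG;E)$, $R\in\mathcal{P}(^rF;H)$, then $R\circ P\circ Q\in\mathcal{Q}(^{rmn}G;H)$ and $\|R\circ P\circ Q\|_{\mathcal Q}\le K_rC_m^{rn}\|R\|\,\|P\|_{\mathcal Q}^r\|Q\|^{rn}$. It is $p$-Banach if all components are complete for $\|\cdot\|_{\mathcal Q}$; normed/Banach means $p=1$. *)

theory Defs
  imports
    "HOL-Analysis.Analysis"
    "HOL-Combinatorics.Permutations"
    "HOL-Algebra.Module"
    "HOL-Algebra.Algebraic_Closure_Type"
begin

text \<open>
  The classes in the statement range over all Banach spaces, so a Banach space has to be a value
  rather than a type: it is a record extending the modules of HOL-Algebra by a norm. The scalars
  form a type of sort \<open>{banach, real_normed_field}\<close>, which covers exactly the real and the complex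
  field (up to isometric isomorphism, by Gelfand--Mazur). The inherited ring fields
  \<open>mult\<close> and \<open>one\<close> of the record carry no meaning.

  The carriers are subsets of a universe \<open>('k, 'u) point\<close>, which contains a copy of
  the scalar field next to an arbitrary type \<open>'u\<close>.
\<close>

record ('k, 'v) nspace = "('k, 'v) module" +
  vnorm :: "'v \<Rightarrow> real"

datatype ('k, 'u) point = Scalar (scalar_of: 'k) | Vec 'u


section \<open>Spaces\<close>

text \<open>\<open>N\<close> is a \<open>p\<close>-norm on the linear subspace \<open>S\<close> of \<open>V\<close>.\<close>

definition p_norm_on ::
  "real \<Rightarrow> ('k::real_normed_field, 'v, 'm) module_scheme \<Rightarrow> 'v set \<Rightarrow> ('v \<Rightarrow> real) \<Rightarrow> bool" where
  "p_norm_on p V S N \<longleftrightarrow>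
     (\<forall>x\<in>S. 0 \<le> N x \<and> (N x = 0 \<longleftrightarrow> x = \<zero>\<^bsub>V\<^esub>)) \<and>
     (\<forall>a. \<forall>x\<in>S. N (a \<odot>\<^bsub>V\<^esub> x) = norm a * N x) \<and>
     (\<forall>x\<in>S. \<forall>y\<in>S. N (x \<oplus>\<^bsub>V\<^esub> y) powr p \<le> N x powr p + N y powr p)"

text \<open>A \<open>p\<close>-norm need not satisfy the triangle inequality, but its \<open>p\<close>-th power does;
  it induces the metric \<open>(x, y) \<mapsto> N (x - y)\<^sup>p\<close>. The locale \<^locale>\<open>Metric_space\<close> requires distances to be
  nonnegative and symmetric on the whole type, whence the value \<open>0\<close> outside the space.\<close>

definition p_dist ::
  "real \<Rightarrow> ('k::real_normed_field, 'v, 'm) module_scheme \<Rightarrow> 'v set \<Rightarrow> ('v \<Rightarrow> real) \<Rightarrow> 'v \<Rightarrow> 'v \<Rightarrow> real"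
where
  "p_dist p V S N x y = (if x \<in> S \<and> y \<in> S then N (x \<ominus>\<^bsub>V\<^esub> y) powr p else 0)"

definition p_complete_on ::
  "real \<Rightarrow> ('k::real_normed_field, 'v, 'm) module_scheme \<Rightarrow> 'v set \<Rightarrow> ('v \<Rightarrow> real) \<Rightarrow> bool" where
  "p_complete_on p V S N \<longleftrightarrow> Metric_space.mcomplete S (p_dist p V S N)"

definition ndist :: "('k, 'v) nspace \<Rightarrow> 'v \<Rightarrow> 'v \<Rightarrow> real" where
  "ndist E x y = (if x \<in> carrier E \<and> y \<in> carrier E then vnorm E (x \<ominus>\<^bsub>E\<^esub> y) else 0)"

definition ntopology :: "('k, 'v) nspace \<Rightarrow> 'v topology" where
  "ntopology E = Metric_space.mtopology (carrier E) (ndist E)"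

definition banach_space :: "('k::{banach,real_normed_field}, 'v) nspace \<Rightarrow> bool" where
  "banach_space E \<longleftrightarrow>
     Module.module (ring_of_type_algebra :: 'k ring) E \<and>
     p_norm_on 1 E (carrier E) (vnorm E) \<and>
     Metric_space.mcomplete (carrier E) (ndist E)"

text \<open>The scalar field as a Banach space.\<close>

definition scalar_space :: "('k::{banach,real_normed_field}, ('k, 'u) point) nspace" where
  "scalar_space =
     \<lparr>carrier = range Scalar, mult = undefined, one = undefined, zero = Scalar 0,
      add = (\<lambda>x y. Scalar (scalar_of x + scalar_of y)),
      smult = (\<lambda>a x. Scalar (a * scalar_of x)), vnorm = (\<lambda>x. norm (scalar_of x))\<rparr>"

text \<open>The continuous linear functionals, as scalar-valued functions.\<close>

definition dual :: "('k::{banach,real_normed_field}, 'v) nspace \<Rightarrow> ('v \<Rightarrow> 'k) set" where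
  "dual E = {\<phi>.
     (\<forall>x\<in>carrier E. \<forall>y\<in>carrier E. \<phi> (x \<oplus>\<^bsub>E\<^esub> y) = \<phi> x + \<phi> y) \<and>
     (\<forall>a. \<forall>x\<in>carrier E. \<phi> (a \<odot>\<^bsub>E\<^esub> x) = a * \<phi> x) \<and>
     continuous_map (ntopology E) euclidean \<phi>}"


section \<open>Multilinear operators\<close>

text \<open>
  An \<open>n\<close>-linear operator takes a list of \<open>n\<close> arguments; indices start at \<open>0\<close>. Operators and
  polynomials are extensional, i.e. \<open>undefined\<close> outside their domain, so that equality of
  functions is equality of operators.
\<close>

definition tuples :: "('k, 'v) nspace list \<Rightarrow> 'v list set" where
  "tuples Es = {xs. list_all2 (\<lambda>x E. x \<in> carrier E) xs Es}"

definition multilinear ::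
  "('k, 'v) nspace list \<Rightarrow> ('k, 'v) nspace \<Rightarrow> ('v list \<Rightarrow> 'v) \<Rightarrow> bool" where
  "multilinear Es F A \<longleftrightarrow>
     A \<in> tuples Es \<rightarrow>\<^sub>E carrier F \<and>
     (\<forall>xs\<in>tuples Es. \<forall>i<length Es.
        (\<forall>x\<in>carrier (Es ! i). \<forall>y\<in>carrier (Es ! i).
           A (xs[i := x \<oplus>\<^bsub>Es ! i\<^esub> y]) = A (xs[i := x]) \<oplus>\<^bsub>F\<^esub> A (xs[i := y])) \<and>
        (\<forall>a. \<forall>x\<in>carrier (Es ! i).
           A (xs[i := a \<odot>\<^bsub>Es ! i\<^esub> x]) = a \<odot>\<^bsub>F\<^esub> A (xs[i := x])))"

text \<open>Continuity refers to the product topology.\<close>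

definition multilinear_continuous ::
  "('k, 'v) nspace list \<Rightarrow> ('k, 'v) nspace \<Rightarrow> ('v list \<Rightarrow> 'v) \<Rightarrow> bool" where
  "multilinear_continuous Es F A \<longleftrightarrow>
     continuous_map (product_topology (\<lambda>i. ntopology (Es ! i)) {..<length Es}) (ntopology F)
       (\<lambda>x. A (map x [0..<length Es]))"

text \<open>The space \<open>L(E\<^sub>1, ..., E\<^sub>n; F)\<close> with pointwise operations and the sup norm.\<close>

definition multi_space ::
  "('k, 'v) nspace list \<Rightarrow> ('k, 'v) nspace \<Rightarrow> ('k, 'v list \<Rightarrow> 'v) nspace" where
  "multi_space Es F =
     \<lparr>carrier = {A. multilinear Es F A \<and> multilinear_continuous Es F A},
      mult = undefined, one = undefined,
      zero = (\<lambda>xs\<in>tuples Es. \<zero>\<^bsub>F\<^esub>),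
      add = (\<lambda>A B. \<lambda>xs\<in>tuples Es. A xs \<oplus>\<^bsub>F\<^esub> B xs),
      smult = (\<lambda>a A. \<lambda>xs\<in>tuples Es. a \<odot>\<^bsub>F\<^esub> A xs),
      vnorm = (\<lambda>A. SUP xs\<in>{xs \<in> tuples Es. \<forall>i<length Es. vnorm (Es ! i) (xs ! i) \<le> 1}.
                 vnorm F (A xs))\<rparr>"

abbreviation multi_ops ::
  "('k, 'v) nspace list \<Rightarrow> ('k, 'v) nspace \<Rightarrow> ('v list \<Rightarrow> 'v) set" where
  "multi_ops Es F \<equiv> carrier (multi_space Es F)"

definition permuted ::
  "('k, 'v) nspace list \<Rightarrow> (nat \<Rightarrow> nat) \<Rightarrow> ('v list \<Rightarrow> 'v) \<Rightarrow> ('v list \<Rightarrow> 'v)" where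
  "permuted Es \<sigma> A = (\<lambda>xs\<in>tuples Es. A (permute_list \<sigma> xs))"

definition sym_ops ::
  "nat \<Rightarrow> ('k, 'v) nspace \<Rightarrow> ('k, 'v) nspace \<Rightarrow> ('v list \<Rightarrow> 'v) set" where
  "sym_ops n E F = {A \<in> multi_ops (replicate n E) F.
     \<forall>\<sigma>. \<sigma> permutes {..<n} \<longrightarrow> permuted (replicate n E) \<sigma> A = A}"

definition finite_type_op ::
  "('k::{banach,real_normed_field}, 'v) nspace list \<Rightarrow> ('k, 'v) nspace \<Rightarrow> ('v list \<Rightarrow> 'v) \<Rightarrow> bool"
where
  "finite_type_op Es F A \<longleftrightarrow>
     (\<exists>(N::nat) \<phi> y.
        (\<forall>j<N. (\<forall>i<length Es. \<phi> j i \<in> dual (Es ! i)) \<and> y j \<in> carrier F) \<and>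
        A = (\<lambda>xs\<in>tuples Es. \<Oplus>\<^bsub>F\<^esub>j\<in>{..<N}. (\<Prod>i<length Es. \<phi> j i (xs ! i)) \<odot>\<^bsub>F\<^esub> y j))"

text \<open>The \<open>i\<close>-th block, from position \<open>m i\<close> up to but excluding \<open>m (i + 1)\<close>, of a list.\<close>

definition block :: "(nat \<Rightarrow> nat) \<Rightarrow> nat \<Rightarrow> 'a list \<Rightarrow> 'a list" where
  "block m i xs = drop (m i) (take (m (Suc i)) xs)"

text \<open>\<open>A \<circ> (B\<^sub>1, ..., B\<^sub>n)\<close>, where the blocks of \<open>Gs\<close> are the domains of the \<open>B i\<close>.\<close>

definition block_comp ::
  "(nat \<Rightarrow> nat) \<Rightarrow> nat \<Rightarrow> ('k, 'v) nspace list \<Rightarrow> ('v list \<Rightarrow> 'v) \<Rightarrow> (nat \<Rightarrow> 'v list \<Rightarrow> 'v)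
     \<Rightarrow> ('v list \<Rightarrow> 'v)" where
  "block_comp m n Gs A B = (\<lambda>xs\<in>tuples Gs. A (map (\<lambda>i. B i (block m i xs)) [0..<n]))"

definition post_comp ::
  "('k, 'v) nspace list \<Rightarrow> ('v list \<Rightarrow> 'v) \<Rightarrow> ('v list \<Rightarrow> 'v) \<Rightarrow> ('v list \<Rightarrow> 'v)" where
  "post_comp Gs t A = (\<lambda>xs\<in>tuples Gs. t [A xs])"

definition scalar_product_op ::
  "nat \<Rightarrow> ('k::{banach,real_normed_field}, 'u) point list \<Rightarrow> ('k, 'u) point" where
  "scalar_product_op n =
     (\<lambda>xs\<in>tuples (replicate n scalar_space). Scalar (\<Prod>i<n. scalar_of (xs ! i)))"


section \<open>Homogeneous polynomials\<close>

definition hat ::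
  "nat \<Rightarrow> ('k, 'v) nspace \<Rightarrow> ('v list \<Rightarrow> 'v) \<Rightarrow> ('v \<Rightarrow> 'v)" where
  "hat n E A = (\<lambda>x\<in>carrier E. A (replicate n x))"

definition homogeneous_poly ::
  "nat \<Rightarrow> ('k, 'v) nspace \<Rightarrow> ('k, 'v) nspace \<Rightarrow> ('v \<Rightarrow> 'v) \<Rightarrow> bool" where
  "homogeneous_poly n E F P \<longleftrightarrow> (\<exists>A. multilinear (replicate n E) F A \<and> P = hat n E A)"

text \<open>The space \<open>P(\<^sup>nE; F)\<close> with pointwise operations and the sup norm.\<close>

definition poly_space ::
  "nat \<Rightarrow> ('k, 'v) nspace \<Rightarrow> ('k, 'v) nspace \<Rightarrow> ('k, 'v \<Rightarrow> 'v) nspace" where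
  "poly_space n E F =
     \<lparr>carrier = {P. homogeneous_poly n E F P \<and> continuous_map (ntopology E) (ntopology F) P},
      mult = undefined, one = undefined,
      zero = (\<lambda>x\<in>carrier E. \<zero>\<^bsub>F\<^esub>),
      add = (\<lambda>P Q. \<lambda>x\<in>carrier E. P x \<oplus>\<^bsub>F\<^esub> Q x),
      smult = (\<lambda>a P. \<lambda>x\<in>carrier E. a \<odot>\<^bsub>F\<^esub> P x),
      vnorm = (\<lambda>P. SUP x\<in>{x \<in> carrier E. vnorm E x \<le> 1}. vnorm F (P x))\<rparr>"

abbreviation polys ::
  "nat \<Rightarrow> ('k, 'v) nspace \<Rightarrow> ('k, 'v) nspace \<Rightarrow> ('v \<Rightarrow> 'v) set" where
  "polys n E F \<equiv> carrier (poly_space n E F)"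

definition sym_op_of ::
  "nat \<Rightarrow> ('k, 'v) nspace \<Rightarrow> ('k, 'v) nspace \<Rightarrow> ('v \<Rightarrow> 'v) \<Rightarrow> ('v list \<Rightarrow> 'v)" where
  "sym_op_of n E F P = (THE A. A \<in> sym_ops n E F \<and> hat n E A = P)"

definition finite_type_poly ::
  "nat \<Rightarrow> ('k::{banach,real_normed_field}, 'v) nspace \<Rightarrow> ('k, 'v) nspace \<Rightarrow> ('v \<Rightarrow> 'v) \<Rightarrow> bool"
where
  "finite_type_poly n E F P \<longleftrightarrow>
     (\<exists>(N::nat) \<phi> y.
        (\<forall>j<N. \<phi> j \<in> dual E \<and> y j \<in> carrier F) \<and>
        P = (\<lambda>x\<in>carrier E. \<Oplus>\<^bsub>F\<^esub>j\<in>{..<N}. (\<phi> j x ^ n) \<odot>\<^bsub>F\<^esub> y j))"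


section \<open>Hyper-ideals and two-sided ideals\<close>

text \<open>
  A class \<open>\<H>\<close> of multilinear operators is given by its components
  \<open>\<H>(E\<^sub>1, ..., E\<^sub>n; F)\<close>, and its norm by the norms of the components; only nonempty lists of
  Banach spaces and Banach spaces \<open>F\<close> matter. Classes of polynomials are given in the same way by
  their components of each degree.
\<close>

type_synonym ('k, 'u) space = "('k, ('k, 'u) point) nspace"
type_synonym ('k, 'u) mop = "('k, 'u) point list \<Rightarrow> ('k, 'u) point"
type_synonym ('k, 'u) poly_map = "('k, 'u) point \<Rightarrow> ('k, 'u) point"
type_synonym ('k, 'u) op_class = "('k, 'u) space list \<Rightarrow> ('k, 'u) space \<Rightarrow> ('k, 'u) mop set"
type_synonym ('k, 'u) op_norm =
  "('k, 'u) space list \<Rightarrow> ('k, 'u) space \<Rightarrow> ('k, 'u) mop \<Rightarrow> real"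
type_synonym ('k, 'u) poly_class =
  "nat \<Rightarrow> ('k, 'u) space \<Rightarrow> ('k, 'u) space \<Rightarrow> ('k, 'u) poly_map set"
type_synonym ('k, 'u) poly_norm =
  "nat \<Rightarrow> ('k, 'u) space \<Rightarrow> ('k, 'u) space \<Rightarrow> ('k, 'u) poly_map \<Rightarrow> real"

definition admissible ::
  "('k::{banach,real_normed_field}, 'u) space list \<Rightarrow> ('k, 'u) space \<Rightarrow> bool" where
  "admissible Es F \<longleftrightarrow> Es \<noteq> [] \<and> (\<forall>E\<in>set Es. banach_space E) \<and> banach_space F"

definition p_normed_hyper_ideal ::
  "real \<Rightarrow> ('k::{banach,real_normed_field}, 'u) op_class \<Rightarrow> ('k, 'u) op_norm \<Rightarrow> bool" where
  "p_normed_hyper_ideal p \<H> \<nu> \<longleftrightarrow>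
     (\<forall>Es F. admissible Es F \<longrightarrow>
        \<H> Es F \<subseteq> multi_ops Es F \<and>
        submodule (\<H> Es F) (ring_of_type_algebra :: 'k ring) (multi_space Es F) \<and>
        {A. finite_type_op Es F A} \<subseteq> \<H> Es F \<and>
        p_norm_on p (multi_space Es F) (\<H> Es F) (\<nu> Es F)) \<and>
     (\<forall>n\<ge>1. \<nu> (replicate n scalar_space) scalar_space (scalar_product_op n) = 1) \<and>
     (\<forall>n\<ge>1. \<forall>m Gs Es F H B t A.
        m 0 = 0 \<and> (\<forall>i<n. m i < m (Suc i)) \<and> length Gs = m n \<and> length Es = n \<and>
        admissible Gs F \<and> admissible Es H \<and>
        (\<forall>i<n. B i \<in> multi_ops (block m i Gs) (Es ! i)) \<and>
        t \<in> multi_ops [F] H \<and> A \<in> \<H> Es F \<longrightarrow>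
        post_comp Gs t (block_comp m n Gs A B) \<in> \<H> Gs H \<and>
        \<nu> Gs H (post_comp Gs t (block_comp m n Gs A B)) \<le>
          vnorm (multi_space [F] H) t * \<nu> Es F A *
          (\<Prod>i<n. vnorm (multi_space (block m i Gs) (Es ! i)) (B i)))"

definition p_Banach_hyper_ideal ::
  "real \<Rightarrow> ('k::{banach,real_normed_field}, 'u) op_class \<Rightarrow> ('k, 'u) op_norm \<Rightarrow> bool" where
  "p_Banach_hyper_ideal p \<H> \<nu> \<longleftrightarrow>
     p_normed_hyper_ideal p \<H> \<nu> \<and>
     (\<forall>Es F. admissible Es F \<longrightarrow> p_complete_on p (multi_space Es F) (\<H> Es F) (\<nu> Es F))"

definition strongly_symmetric ::
  "('k::{banach,real_normed_field}, 'u) op_class \<Rightarrow> ('k, 'u) op_norm \<Rightarrow> bool" where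
  "strongly_symmetric \<H> \<nu> \<longleftrightarrow>
     (\<forall>n\<ge>1. \<forall>E F \<sigma>. banach_space E \<and> banach_space F \<and> \<sigma> permutes {..<n} \<longrightarrow>
        (\<forall>A\<in>\<H> (replicate n E) F.
           permuted (replicate n E) \<sigma> A \<in> \<H> (replicate n E) F \<and>
           \<nu> (replicate n E) F (permuted (replicate n E) \<sigma> A) = \<nu> (replicate n E) F A))"

text \<open>\<open>(m, r, G, B, C)\<close> is a factorization of \<open>A\<close> as required for membership in \<open>L \<circ> \<H>\<close>;
  all blocks have length \<open>m\<close>.\<close>

definition L_factorization ::
  "('k::{banach,real_normed_field}, 'u) op_class \<Rightarrow> ('k, 'u) space list \<Rightarrow> ('k, 'u) space \<Rightarrow>
   ('k, 'u) mop \<Rightarrow> nat \<Rightarrow> nat \<Rightarrow> ('k, 'u) space \<Rightarrow> (nat \<Rightarrow> ('k, 'u) mop) \<Rightarrow> ('k, 'u) mop \<Rightarrow> bool"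
where
  "L_factorization \<H> Es F A m r G B C \<longleftrightarrow>
     m * r = length Es \<and> banach_space G \<and>
     (\<forall>j<r. B j \<in> \<H> (block (\<lambda>i. i * m) j Es) G) \<and>
     C \<in> sym_ops r G F \<and>
     A = block_comp (\<lambda>i. i * m) r Es C B"

definition L_comp :: "('k::{banach,real_normed_field}, 'u) op_class \<Rightarrow> ('k, 'u) op_class" where
  "L_comp \<H> Es F = {A \<in> multi_ops Es F. \<exists>m r G B C. L_factorization \<H> Es F A m r G B C}"

definition L_comp_norm ::
  "('k::{banach,real_normed_field}, 'u) op_class \<Rightarrow> ('k, 'u) op_norm \<Rightarrow> ('k, 'u) op_norm" where
  "L_comp_norm \<H> \<nu> Es F A =
     Inf {vnorm (multi_space (replicate r G) F) C *
            (\<Prod>j<r. \<nu> (block (\<lambda>i. i * m) j Es) G (B j)) | m r G B C.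
          L_factorization \<H> Es F A m r G B C}"

definition two_sided_ideal_constants :: "(nat \<Rightarrow> real) \<Rightarrow> bool" where
  "two_sided_ideal_constants C \<longleftrightarrow> C 1 = 1 \<and> (\<forall>n\<ge>1. 1 \<le> C n)"

definition p_normed_two_sided_ideal ::
  "real \<Rightarrow> (nat \<Rightarrow> real) \<Rightarrow> (nat \<Rightarrow> real) \<Rightarrow>
   ('k::{banach,real_normed_field}, 'u) poly_class \<Rightarrow> ('k, 'u) poly_norm \<Rightarrow> bool" where
  "p_normed_two_sided_ideal p C K \<Q> \<nu> \<longleftrightarrow>
     two_sided_ideal_constants C \<and> two_sided_ideal_constants K \<and>
     (\<forall>n\<ge>1. \<forall>E F. banach_space E \<and> banach_space F \<longrightarrow>
        \<Q> n E F \<subseteq> polys n E F \<and>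
        submodule (\<Q> n E F) (ring_of_type_algebra :: 'k ring) (poly_space n E F) \<and>
        {P. finite_type_poly n E F P} \<subseteq> \<Q> n E F \<and>
        p_norm_on p (poly_space n E F) (\<Q> n E F) (\<nu> n E F)) \<and>
     (\<forall>n\<ge>1. \<nu> n scalar_space scalar_space (hat n scalar_space (scalar_product_op n)) = 1) \<and>
     (\<forall>m n r G E F H P Q R.
        m \<ge> 1 \<and> n \<ge> 1 \<and> r \<ge> 1 \<and>
        banach_space G \<and> banach_space E \<and> banach_space F \<and> banach_space H \<and>
        P \<in> \<Q> n E F \<and> Q \<in> polys m G E \<and> R \<in> polys r F H \<longrightarrow>
        (\<lambda>x\<in>carrier G. R (P (Q x))) \<in> \<Q> (r * m * n) G H \<and>
        \<nu> (r * m * n) G H (\<lambda>x\<in>carrier G. R (P (Q x))) \<le>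
          K r * C m ^ (r * n) * vnorm (poly_space r F H) R * \<nu> n E F P ^ r *
          vnorm (poly_space m G E) Q ^ (r * n))"

definition p_Banach_two_sided_ideal ::
  "real \<Rightarrow> (nat \<Rightarrow> real) \<Rightarrow> (nat \<Rightarrow> real) \<Rightarrow>
   ('k::{banach,real_normed_field}, 'u) poly_class \<Rightarrow> ('k, 'u) poly_norm \<Rightarrow> bool" where
  "p_Banach_two_sided_ideal p C K \<Q> \<nu> \<longleftrightarrow>
     p_normed_two_sided_ideal p C K \<Q> \<nu> \<and>
     (\<forall>n\<ge>1. \<forall>E F. banach_space E \<and> banach_space F \<longrightarrow>
        p_complete_on p (poly_space n E F) (\<Q> n E F) (\<nu> n E F))"


section \<open>The polynomial classes \<open>P\<^sup>\<H>\<close> and \<open>P\<^sub>\<H>\<close>\<close>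

definition poly_upper :: "('k::{banach,real_normed_field}, 'u) op_class \<Rightarrow> ('k, 'u) poly_class" where
  "poly_upper \<H> n E F = {P \<in> polys n E F. \<exists>A\<in>\<H> (replicate n E) F. P = hat n E A}"

definition poly_upper_norm ::
  "('k::{banach,real_normed_field}, 'u) op_class \<Rightarrow> ('k, 'u) op_norm \<Rightarrow> ('k, 'u) poly_norm" where
  "poly_upper_norm \<H> \<nu> n E F P =
     Inf {\<nu> (replicate n E) F A | A. A \<in> \<H> (replicate n E) F \<and> P = hat n E A}"

definition poly_lower :: "('k::{banach,real_normed_field}, 'u) op_class \<Rightarrow> ('k, 'u) poly_class" where
  "poly_lower \<H> n E F = {P \<in> polys n E F. sym_op_of n E F P \<in> \<H> (replicate n E) F}"

definition poly_lower_norm ::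
  "('k::{banach,real_normed_field}, 'u) op_norm \<Rightarrow> ('k, 'u) poly_norm" where
  "poly_lower_norm \<nu> n E F P = \<nu> (replicate n E) F (sym_op_of n E F P)"

end

theory Submission
  imports Defs
begin

text \<open>
  The class \<open>P\<^sup>\<H>\<close> is the image of \<open>\<H>\<close> under the linear map that sends an operator to its diagonal,
  and its norm is the quotient norm. The image of a \<open>p\<close>-normed space is \<open>p\<close>-normed as soon as the
  quotient norm separates points, and it inherits completeness (locale \<open>quotient_norm\<close>).
  Points are separated because \<open>\<H>\<close> can be tested on lines: if \<open>P\<close> is the diagonal of \<open>A\<close>,
  then restricting every variable of \<open>A\<close> to the line through \<open>x\<close> gives the operator
  \<open>(\<lambda>\<^sub>1, \<dots>, \<lambda>\<^sub>n) \<mapsto> \<lambda>\<^sub>1 \<cdots> \<lambda>\<^sub>n P(x)\<close>. It depends on \<open>P\<close> alone, and its norm is at most \<open>\<nu>(A) \<parallel>x\<parallel>^n\<close>.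
  If \<open>\<nu>(A)\<close> can be made arbitrarily small, this operator is zero, and so is \<open>P(x)\<close>
  (\<open>restrict_to_line\<close>, \<open>quotient_norm_poly_upper\<close>).

  For the composition \<open>R \<circ> P \<circ> Q\<close> let \<open>P\<close> be the diagonal of \<open>A \<in> \<H>\<close>, and let \<open>Q'\<close> and \<open>R'\<close> be the
  symmetric operators of \<open>Q\<close> and \<open>R\<close>. Then \<open>R \<circ> P \<circ> Q\<close> is the diagonal of
  \<open>R' \<circ> (B, \<dots>, B)\<close> with \<open>B = A \<circ> (Q', \<dots>, Q')\<close>. The operator \<open>B\<close> lies in \<open>\<H>\<close> by the
  hyper-ideal property, and \<open>R' \<circ> (B, \<dots>, B)\<close> lies in \<open>L \<circ> \<H>\<close>, hence in \<open>\<H>\<close>, with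
  the corresponding estimates of the norms (\<open>composition_estimate\<close>). The
  constants \<open>n ^ n / fact n\<close> compare the norm of a polynomial with that of its symmetric
  operator. They come from the polarization formula \<open>polar_hat\<close>, which expresses the symmetrization of
  an operator by signed values of its diagonal (\<open>polar_bound\<close>).

  The statement on \<open>P\<^sub>\<H>\<close> is a special case of the one on \<open>P\<^sup>\<H>\<close>: if \<open>p = 1\<close> and \<open>\<H>\<close> is strongly
  symmetric, symmetrization is an average of isometric copies of an operator and does not increase
  the norm. The symmetric operator of a polynomial therefore attains the infimum over all
  representatives, and the two classes coincide isometrically (\<open>poly_lower_eq_poly_upper\<close>).
\<close>

section \<open>Vector spaces and Banach spaces as records\<close>

text \<open>
  Scalar multiplication obeys laws stated with the record operations of \<open>ring_of_type_algebra\<close>.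
  The locale restates them with the operations of the type \<open>'k\<close>, so that arithmetic with
  scalars is arithmetic in a type class.
\<close>

locale kspace =
  fixes V :: "('k::real_normed_field, 'v, 'm) module_scheme" (structure)
  assumes kspace: "Module.module (ring_of_type_algebra :: 'k ring) V"

sublocale kspace \<subseteq> abelian_group V
  using kspace by (rule Module.module.axioms)

context kspace
begin

lemma smult_closed [simp, intro]: "x \<in> carrier V \<Longrightarrow> a \<odot> x \<in> carrier V"
  using Module.module.smult_closed[OF kspace] by (simp add: ring_of_type_algebra_def)

lemma smult_add_left: "x \<in> carrier V \<Longrightarrow> (a + b) \<odot> x = a \<odot> x \<oplus> b \<odot> x"
  using Module.module.smult_l_distr[OF kspace] by (simp add: ring_of_type_algebra_def)

lemma smult_add_right: "x \<in> carrier V \<Longrightarrow> y \<in> carrier V \<Longrightarrow> a \<odot> (x \<oplus> y) = a \<odot> x \<oplus> a \<odot> y"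
  using Module.module.smult_r_distr[OF kspace] by (simp add: ring_of_type_algebra_def)

lemma smult_smult: "x \<in> carrier V \<Longrightarrow> a \<odot> (b \<odot> x) = (a * b) \<odot> x"
  using Module.module.smult_assoc1[OF kspace] by (simp add: ring_of_type_algebra_def)

lemma smult_one [simp]: "x \<in> carrier V \<Longrightarrow> 1 \<odot> x = x"
  using Module.module.smult_one[OF kspace] by (simp add: ring_of_type_algebra_def)

lemma smult_zero_left [simp]: "x \<in> carrier V \<Longrightarrow> 0 \<odot> x = \<zero>"
  using Module.module.smult_l_null[OF kspace] by (simp add: ring_of_type_algebra_def)

lemma smult_zero_right [simp]: "a \<odot> \<zero> = \<zero>"
  using Module.module.smult_r_null[OF kspace] by (simp add: ring_of_type_algebra_def)

lemma a_inv_eq_smult: "x \<in> carrier V \<Longrightarrow> \<ominus> x = (-1) \<odot> x"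
proof -
  assume x: "x \<in> carrier V"
  have "(-1) \<odot> x \<oplus> x = (-1) \<odot> x \<oplus> 1 \<odot> x" using x by simp
  also have "\<dots> = \<zero>" using x smult_add_left[of x "-1" 1] by simp
  finally show ?thesis using x by (intro minus_equality) auto
qed

lemma a_minus_eq: "x \<in> carrier V \<Longrightarrow> y \<in> carrier V \<Longrightarrow> x \<ominus> y = x \<oplus> (-1) \<odot> y"
  by (simp add: a_minus_def a_inv_eq_smult)

lemma smult_finsum:
  "finite I \<Longrightarrow> f \<in> I \<rightarrow> carrier V \<Longrightarrow> a \<odot> (\<Oplus>i\<in>I. f i) = (\<Oplus>i\<in>I. a \<odot> f i)"
  by (induction I rule: finite_induct) (auto simp: smult_add_right Pi_iff)

lemma finsum_constant: "finite I \<Longrightarrow> x \<in> carrier V \<Longrightarrow> (\<Oplus>i\<in>I. x) = of_nat (card I) \<odot> x"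
  by (induction I rule: finite_induct) (auto simp: smult_add_left)

text \<open>
  Exchanges the two summations in the polarization formula: once the signs are summed first, all
  that is left of them is a scalar coefficient.
\<close>

lemma finsum_smult_finsum:
  assumes "finite S" "finite T" "g \<in> T \<rightarrow> carrier V"
  shows "(\<Oplus>e\<in>S. c e \<odot> (\<Oplus>f\<in>T. d e f \<odot> g f)) = (\<Oplus>f\<in>T. (\<Sum>e\<in>S. c e * d e f) \<odot> g f)"
  using assms(1)
proof (induction S rule: finite_induct)
  case empty
  have "(\<Oplus>f\<in>T. 0 \<odot> g f) = (\<Oplus>f\<in>T. \<zero>)"
    using Pi_mem[OF assms(3)] by (intro finsum_cong') auto
  then show ?case by simp
next
  case (insert e S)
  note [simp] = Pi_mem[OF assms(3)]
  have "(\<Oplus>e\<in>insert e S. c e \<odot> (\<Oplus>f\<in>T. d e f \<odot> g f))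
      = c e \<odot> (\<Oplus>f\<in>T. d e f \<odot> g f) \<oplus> (\<Oplus>e\<in>S. c e \<odot> (\<Oplus>f\<in>T. d e f \<odot> g f))"
    using insert by (subst finsum_insert) (auto intro!: smult_closed finsum_closed)
  also have "\<dots> = (\<Oplus>f\<in>T. (c e * d e f) \<odot> g f) \<oplus> (\<Oplus>f\<in>T. (\<Sum>e\<in>S. c e * d e f) \<odot> g f)"
    unfolding insert.IH using assms
    by (subst smult_finsum) (auto simp: smult_smult intro!: arg_cong2[where f="(\<oplus>)"] finsum_cong')
  also have "\<dots> = (\<Oplus>f\<in>T. (c e * d e f) \<odot> g f \<oplus> (\<Sum>e\<in>S. c e * d e f) \<odot> g f)"
    by (subst finsum_addf) auto
  also have "\<dots> = (\<Oplus>f\<in>T. (\<Sum>e\<in>insert e S. c e * d e f) \<odot> g f)"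
    using insert by (intro finsum_cong') (auto simp: smult_add_left)
  finally show ?case .
qed

text \<open>
  Functions on \<open>{..<Suc k}\<close> are functions on \<open>{..<k}\<close> together with a last value. This turns the
  expansion of one further argument of a multilinear operator into a sum over index functions.
\<close>

lemma finsum_PiE_Suc:
  assumes "finite I" "\<And>g. g \<in> PiE {..<Suc k} (\<lambda>_. I) \<Longrightarrow> h g \<in> carrier V"
  shows "(\<Oplus>g\<in>PiE {..<Suc k} (\<lambda>_. I). h g) = (\<Oplus>f\<in>PiE {..<k} (\<lambda>_. I). \<Oplus>i\<in>I. h (f(k := i)))"
proof -
  let ?A = "\<lambda>f. (\<lambda>i. f(k := i)) ` I"
  have upd: "f(k := i) \<in> PiE {..<Suc k} (\<lambda>_. I)" if "f \<in> PiE {..<k} (\<lambda>_. I)" "i \<in> I" for f i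
    using that by (auto simp: PiE_iff extensional_def less_Suc_eq)
  have eq: "PiE {..<Suc k} (\<lambda>_. I) = (\<Union>f\<in>PiE {..<k} (\<lambda>_. I). ?A f)"
  proof (intro equalityI subsetI)
    fix g assume g: "g \<in> PiE {..<Suc k} (\<lambda>_. I)"
    have "g(k := undefined) \<in> PiE {..<k} (\<lambda>_. I)"
      using g by (auto simp: PiE_iff extensional_def)
    moreover have "g = (g(k := undefined))(k := g k)" by simp
    ultimately show "g \<in> (\<Union>f\<in>PiE {..<k} (\<lambda>_. I). ?A f)" using g by blast
  qed (use upd in auto)
  have disj: "disjnt (?A f) (?A f')"
    if "f \<in> PiE {..<k} (\<lambda>_. I)" "f' \<in> PiE {..<k} (\<lambda>_. I)" "f \<noteq> f'" for f f'
  proof -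
    from that(3) obtain j where j: "f j \<noteq> f' j" by (auto simp: fun_eq_iff)
    then have "j \<noteq> k" using that by (auto simp: PiE_iff extensional_def)
    with j show ?thesis unfolding disjnt_def by (auto dest: fun_cong[where x = j])
  qed
  have "(\<Oplus>g\<in>PiE {..<Suc k} (\<lambda>_. I). h g) = (\<Oplus>f\<in>PiE {..<k} (\<lambda>_. I). \<Oplus>g\<in>?A f. h g)"
    unfolding eq
    by (rule add.finprod_UN_disjoint)
      (use assms upd disj in \<open>auto simp: finite_PiE pairwise_def\<close>)
  also have "\<dots> = (\<Oplus>f\<in>PiE {..<k} (\<lambda>_. I). \<Oplus>i\<in>I. h (f(k := i)))"
  proof (intro finsum_cong' refl)
    fix f assume f: "f \<in> PiE {..<k} (\<lambda>_. I)"
    have "inj_on (\<lambda>i. f(k := i)) I" by (auto intro!: inj_onI dest: fun_cong[where x = k])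
    then show "(\<Oplus>g\<in>?A f. h g) = (\<Oplus>i\<in>I. h (f(k := i)))"
      using assms upd[OF f] by (intro finsum_reindex) auto
  qed (use assms upd in \<open>auto intro!: finsum_closed\<close>)
  finally show ?thesis .
qed

text \<open>
  Operators and polynomials both form spaces of extensional functions with pointwise operations.
  The negative of \<open>f\<close> is \<open>(-1) \<odot> f\<close>, so closure under the two operations and under zero suffices.
\<close>

lemma kspace_pointwise:
  fixes M :: "('k, 'a \<Rightarrow> 'v, 'n) module_scheme"
  assumes "carrier M \<subseteq> D \<rightarrow>\<^sub>E carrier V"
    and "\<zero>\<^bsub>M\<^esub> = (\<lambda>x\<in>D. \<zero>)" "\<zero>\<^bsub>M\<^esub> \<in> carrier M"
    and "\<And>f g. f \<oplus>\<^bsub>M\<^esub> g = (\<lambda>x\<in>D. f x \<oplus> g x)"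
    and "\<And>f g. f \<in> carrier M \<Longrightarrow> g \<in> carrier M \<Longrightarrow> f \<oplus>\<^bsub>M\<^esub> g \<in> carrier M"
    and "\<And>a f. a \<odot>\<^bsub>M\<^esub> f = (\<lambda>x\<in>D. a \<odot> f x)"
    and "\<And>a f. f \<in> carrier M \<Longrightarrow> a \<odot>\<^bsub>M\<^esub> f \<in> carrier M"
  shows "kspace M"
proof (rule kspace.intro)
  have cl: "f x \<in> carrier V" if "f \<in> carrier M" "x \<in> D" for f x
    using that assms(1) by auto
  have ext: "f = g" if "f \<in> carrier M" "g \<in> carrier M" "\<And>x. x \<in> D \<Longrightarrow> f x = g x" for f g
    using that assms(1) by (meson PiE_ext subsetD)
  note clM [simp] = assms(3,5,7)
  have [simp]: "(f \<oplus>\<^bsub>M\<^esub> g) x = f x \<oplus> g x" "(a \<odot>\<^bsub>M\<^esub> f) x = a \<odot> f x" "\<zero>\<^bsub>M\<^esub> x = \<zero>"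
    if "x \<in> D" for f g a x
    using that by (simp_all add: assms(2,4,6))
  have "\<exists>g\<in>carrier M. g \<oplus>\<^bsub>M\<^esub> f = \<zero>\<^bsub>M\<^esub>" if "f \<in> carrier M" for f
    using that by (intro bexI[of _ "(-1) \<odot>\<^bsub>M\<^esub> f"] ext) (auto simp: cl a_inv_eq_smult[symmetric] l_neg)
  then have "abelian_group M"
    by (intro abelian_groupI) (auto intro!: ext simp: cl a_ac)
  then show "Module.module (ring_of_type_algebra :: 'k ring) M"
    by (intro moduleI cring_from_type_algebra)
      (auto intro!: ext simp: cl ring_of_type_algebra_def smult_add_left smult_add_right smult_smult)
qed

lemma submodule_iff:
  "submodule S (ring_of_type_algebra :: 'k ring) V \<longleftrightarrow>
     S \<subseteq> carrier V \<and> \<zero> \<in> S \<and> (\<forall>x\<in>S. \<forall>y\<in>S. x \<oplus> y \<in> S) \<and> (\<forall>a. \<forall>x\<in>S. a \<odot> x \<in> S)"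
  (is "?L \<longleftrightarrow> ?R")
proof
  assume ?L
  then interpret submodule S "ring_of_type_algebra :: 'k ring" V .
  show ?R
    using subset one_closed m_closed submodule.smult_closed[OF \<open>?L\<close>]
    by (auto simp: ring_of_type_algebra_def)
next
  assume R: ?R
  show ?L
  proof (rule Module.module.submoduleI[OF kspace])
    fix a assume "a \<in> S"
    then show "\<ominus> a \<in> S" using R a_inv_eq_smult[of a] by auto
  qed (use R in auto)
qed

lemma Metric_space_p_dist:
  assumes S: "submodule S (ring_of_type_algebra :: 'k ring) V" and N: "p_norm_on p V S N"
  shows "Metric_space S (p_dist p V S N)"
proof
  note S' = S[unfolded submodule_iff]
  have diff: "x \<ominus> y \<in> S" if "x \<in> S" "y \<in> S" for x y
    using that S' by (subst a_minus_eq) auto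
  fix x y z
  show "0 \<le> p_dist p V S N x y" by (simp add: p_dist_def)
  show "p_dist p V S N x y = p_dist p V S N y x"
  proof (cases "x \<in> S \<and> y \<in> S")
    case True
    then have xy: "x \<in> carrier V" "y \<in> carrier V" using S' by auto
    then have "x \<ominus> y = (-1) \<odot> (y \<ominus> x)"
      by (simp add: a_minus_eq smult_add_right smult_smult a_comm)
    then have "N (x \<ominus> y) = N (y \<ominus> x)"
      using N diff[of y x] True by (simp add: p_norm_on_def)
    then show ?thesis using True by (simp add: p_dist_def)
  qed (auto simp: p_dist_def)
  assume x: "x \<in> S" and y: "y \<in> S"
  then have xy: "x \<in> carrier V" "y \<in> carrier V" using S' by auto
  have "x \<ominus> y \<oplus> y = x"
    using xy by (simp add: a_minus_def a_assoc l_neg)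
  then have "x \<ominus> y = \<zero> \<longleftrightarrow> x = y"
    using xy by (auto simp: a_minus_def r_neg)
  then show "p_dist p V S N x y = 0 \<longleftrightarrow> x = y"
    using x y diff[OF x y] N by (simp add: p_dist_def p_norm_on_def)
  assume z: "z \<in> S"
  then have "z \<in> carrier V" using S' by auto
  with xy have "x \<ominus> z = (x \<ominus> y) \<oplus> (y \<ominus> z)"
    by (simp add: a_minus_def a_assoc) (simp add: a_assoc[symmetric] l_neg)
  then have "N (x \<ominus> z) powr p \<le> N (x \<ominus> y) powr p + N (y \<ominus> z) powr p"
    using N diff[OF x y] diff[OF y z] by (simp add: p_norm_on_def)
  then show "p_dist p V S N x z \<le> p_dist p V S N x y + p_dist p V S N y z"
    using x y z by (simp add: p_dist_def)
qed

text \<open>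
  The distance evaluates the norm only at differences of elements of \<open>S\<close>, which lie in \<open>S\<close>.
\<close>

lemma p_norm_on_cong:
  assumes "submodule S (ring_of_type_algebra :: 'k ring) V" "\<And>x. x \<in> S \<Longrightarrow> N' x = N x"
  shows "p_norm_on p V S N' \<longleftrightarrow> p_norm_on p V S N"
    and "p_complete_on p V S N' \<longleftrightarrow> p_complete_on p V S N"
proof -
  note S = assms(1)[unfolded submodule_iff]
  then show "p_norm_on p V S N' \<longleftrightarrow> p_norm_on p V S N"
    by (simp add: p_norm_on_def assms(2))
  have "x \<ominus> y \<in> S" if "x \<in> S" "y \<in> S" for x y
    using that S by (subst a_minus_eq) auto
  then have "p_dist p V S N' = p_dist p V S N"
    by (auto simp: p_dist_def fun_eq_iff assms(2))
  then show "p_complete_on p V S N' \<longleftrightarrow> p_complete_on p V S N"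
    by (simp add: p_complete_on_def)
qed

end

locale banach_on =
  fixes E :: "('k::{banach,real_normed_field}, 'v) nspace" (structure)
  assumes banach: "banach_space E"

sublocale banach_on \<subseteq> kspace E
  using banach by (auto simp: banach_space_def intro!: kspace.intro)

context banach_on
begin

lemma norm_nonneg: "x \<in> carrier E \<Longrightarrow> 0 \<le> vnorm E x"
  and norm_eq_0: "x \<in> carrier E \<Longrightarrow> vnorm E x = 0 \<longleftrightarrow> x = \<zero>"
  and norm_smult: "x \<in> carrier E \<Longrightarrow> vnorm E (a \<odot> x) = norm a * vnorm E x"
  and norm_add: "x \<in> carrier E \<Longrightarrow> y \<in> carrier E \<Longrightarrow> vnorm E (x \<oplus> y) \<le> vnorm E x + vnorm E y"
proof -
  have "p_norm_on 1 E (carrier E) (vnorm E)" using banach by (simp add: banach_space_def)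
  note N = this[unfolded p_norm_on_def]
  show 1: "\<And>x. x \<in> carrier E \<Longrightarrow> 0 \<le> vnorm E x" using N by blast
  show "x \<in> carrier E \<Longrightarrow> vnorm E x = 0 \<longleftrightarrow> x = \<zero>" using N by blast
  show "x \<in> carrier E \<Longrightarrow> vnorm E (a \<odot> x) = norm a * vnorm E x" using N by blast
  show "x \<in> carrier E \<Longrightarrow> y \<in> carrier E \<Longrightarrow> vnorm E (x \<oplus> y) \<le> vnorm E x + vnorm E y"
    using N 1 by (metis a_closed powr_one)
qed

lemma norm_zero [simp]: "vnorm E \<zero> = 0"
  by (simp add: norm_eq_0)

lemma norm_a_inv: "x \<in> carrier E \<Longrightarrow> vnorm E (\<ominus> x) = vnorm E x"
  by (simp add: a_inv_eq_smult norm_smult)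

lemma norm_finsum:
  "finite I \<Longrightarrow> f \<in> I \<rightarrow> carrier E \<Longrightarrow> vnorm E (\<Oplus>i\<in>I. f i) \<le> (\<Sum>i\<in>I. vnorm E (f i))"
proof (induction I rule: finite_induct)
  case (insert i I)
  then have "vnorm E (f i \<oplus> (\<Oplus>i\<in>I. f i)) \<le> vnorm E (f i) + vnorm E (\<Oplus>i\<in>I. f i)"
    by (intro norm_add) auto
  with insert show ?case by auto
qed auto

lemma Metric_space: "Metric_space (carrier E) (ndist E)"
proof -
  have "Metric_space (carrier E) (p_dist 1 E (carrier E) (vnorm E))"
    using banach by (intro Metric_space_p_dist) (auto simp: submodule_iff banach_space_def)
  moreover have "p_dist 1 E (carrier E) (vnorm E) = ndist E"
    by (auto simp: p_dist_def ndist_def fun_eq_iff norm_nonneg)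
  ultimately show ?thesis by simp
qed

lemma topspace_ntopology [simp]: "topspace (ntopology E) = carrier E"
  by (simp add: ntopology_def Metric_space.topspace_mtopology[OF Metric_space])

text \<open>
  Phrased with \<open>vnorm\<close> rather than \<open>ndist\<close>, the criterion is free of the case distinction
  in \<open>ndist\<close> and works for any topological domain, in particular for products of Banach spaces.
\<close>

lemma continuous_map_ntopology:
  "continuous_map Y (ntopology E) f \<longleftrightarrow> f \<in> topspace Y \<rightarrow> carrier E \<and>
    (\<forall>x\<in>topspace Y. \<forall>e>0. \<exists>U. openin Y U \<and> x \<in> U \<and> (\<forall>y\<in>U. vnorm E (f x \<ominus> f y) < e))"
  (is "?L \<longleftrightarrow> ?R")
proof
  assume L: ?L
  then have "f \<in> topspace Y \<rightarrow> carrier E" by (metis continuous_map_def topspace_ntopology)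
  moreover have "\<exists>U. openin Y U \<and> x \<in> U \<and> (\<forall>y\<in>U. vnorm E (f x \<ominus> f y) < e)"
    if x: "x \<in> topspace Y" and e: "e > 0" for x e
  proof -
    obtain U where "openin Y U" "x \<in> U"
      "\<forall>y\<in>U. f x \<in> carrier E \<and> f y \<in> carrier E \<and> ndist E (f x) (f y) < e"
      using L x e unfolding ntopology_def Metric_space.continuous_map_to_metric[OF Metric_space]
        Metric_space.in_mball[OF Metric_space] by blast
    then show ?thesis by (intro exI[of _ U]) (auto simp: ndist_def)
  qed
  ultimately show ?R by blast
next
  assume R: ?R
  then have f: "f x \<in> carrier E" if "x \<in> topspace Y" for x using that by blast
  have "\<exists>U. openin Y U \<and> x \<in> U \<and> (\<forall>y\<in>U. f x \<in> carrier E \<and> f y \<in> carrier E \<and> ndist E (f x) (f y) < e)"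
    if x: "x \<in> topspace Y" and e: "e > 0" for x e
  proof -
    obtain U where U: "openin Y U" "x \<in> U" "\<forall>y\<in>U. vnorm E (f x \<ominus> f y) < e" using R x e by blast
    moreover have "f y \<in> carrier E" if "y \<in> U" for y using openin_subset[OF U(1)] f that by blast
    ultimately show ?thesis using f[OF x] by (auto simp: ndist_def)
  qed
  then show ?L
    unfolding ntopology_def Metric_space.continuous_map_to_metric[OF Metric_space]
      Metric_space.in_mball[OF Metric_space] by blast
qed

lemma continuous_map_closed:
  "continuous_map Y (ntopology E) f \<Longrightarrow> x \<in> topspace Y \<Longrightarrow> f x \<in> carrier E"
  by (auto simp: continuous_map_ntopology)

lemma continuous_map_add:
  assumes f: "continuous_map Y (ntopology E) f" and g: "continuous_map Y (ntopology E) g"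
  shows "continuous_map Y (ntopology E) (\<lambda>x. f x \<oplus> g x)"
  unfolding continuous_map_ntopology
proof (intro conjI ballI allI impI funcsetI)
  note cl = continuous_map_closed[OF f] continuous_map_closed[OF g]
  fix x assume x: "x \<in> topspace Y"
  then show "f x \<oplus> g x \<in> carrier E" using cl by simp
  fix e :: real assume "e > 0"
  then have e2: "e / 2 > 0" by simp
  obtain U where U: "openin Y U" "x \<in> U" "\<forall>y\<in>U. vnorm E (f x \<ominus> f y) < e / 2"
    using f x e2 unfolding continuous_map_ntopology by blast
  obtain W where W: "openin Y W" "x \<in> W" "\<forall>y\<in>W. vnorm E (g x \<ominus> g y) < e / 2"
    using g x e2 unfolding continuous_map_ntopology by blast
  have "vnorm E ((f x \<oplus> g x) \<ominus> (f y \<oplus> g y)) < e" if y: "y \<in> U \<inter> W" for y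
  proof -
    have y': "y \<in> topspace Y" using openin_subset[OF U(1)] y by blast
    have "(f x \<oplus> g x) \<ominus> (f y \<oplus> g y) = (f x \<ominus> f y) \<oplus> (g x \<ominus> g y)"
      using cl[OF x] cl[OF y'] by (simp add: a_minus_def minus_add a_ac)
    then have "vnorm E ((f x \<oplus> g x) \<ominus> (f y \<oplus> g y)) \<le> vnorm E (f x \<ominus> f y) + vnorm E (g x \<ominus> g y)"
      using cl[OF x] cl[OF y'] norm_add by simp
    also have "\<dots> < e" using U W y by fastforce
    finally show ?thesis .
  qed
  then show "\<exists>U. openin Y U \<and> x \<in> U \<and> (\<forall>y\<in>U. vnorm E ((f x \<oplus> g x) \<ominus> (f y \<oplus> g y)) < e)"
    using U W by (intro exI[of _ "U \<inter> W"]) auto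
qed

lemma continuous_map_smult:
  assumes f: "continuous_map Y (ntopology E) f"
  shows "continuous_map Y (ntopology E) (\<lambda>x. a \<odot> f x)"
  unfolding continuous_map_ntopology
proof (intro conjI ballI allI impI funcsetI)
  note cl = continuous_map_closed[OF f]
  fix x assume x: "x \<in> topspace Y"
  then show "a \<odot> f x \<in> carrier E" using cl by simp
  fix e :: real assume e: "e > 0"
  then have "e / (norm a + 1) > 0" by (simp add: add_nonneg_pos)
  then obtain U where U: "openin Y U" "x \<in> U" "\<forall>y\<in>U. vnorm E (f x \<ominus> f y) < e / (norm a + 1)"
    using f x unfolding continuous_map_ntopology by blast
  have "vnorm E (a \<odot> f x \<ominus> a \<odot> f y) < e" if y: "y \<in> U" for y
  proof -
    have y': "y \<in> topspace Y" using openin_subset[OF U(1)] y by blast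
    have "a \<odot> f x \<ominus> a \<odot> f y = a \<odot> (f x \<ominus> f y)"
      using cl[OF x] cl[OF y'] by (simp add: a_minus_eq smult_add_right smult_smult)
    then have "vnorm E (a \<odot> f x \<ominus> a \<odot> f y) = norm a * vnorm E (f x \<ominus> f y)"
      using cl[OF x] cl[OF y'] by (simp add: norm_smult)
    also have "\<dots> \<le> (norm a + 1) * vnorm E (f x \<ominus> f y)"
      using cl[OF x] cl[OF y'] norm_nonneg by (intro mult_right_mono) auto
    also have "\<dots> < e"
      using U y by (simp add: pos_less_divide_eq add_nonneg_pos mult.commute)
    finally show ?thesis .
  qed
  then show "\<exists>U. openin Y U \<and> x \<in> U \<and> (\<forall>y\<in>U. vnorm E (a \<odot> f x \<ominus> a \<odot> f y) < e)"
    using U by blast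
qed

lemma continuous_map_zero: "continuous_map Y (ntopology E) (\<lambda>x. \<zero>)"
  by (simp add: continuous_map_const)

lemma continuous_map_finsum:
  assumes "finite I" "\<And>i. i \<in> I \<Longrightarrow> continuous_map Y (ntopology E) (f i)"
  shows "continuous_map Y (ntopology E) (\<lambda>x. \<Oplus>i\<in>I. f i x)"
  using assms
proof (induction I rule: finite_induct)
  case (insert i I)
  then have "continuous_map Y (ntopology E) (\<lambda>x. f i x \<oplus> (\<Oplus>i\<in>I. f i x))"
    by (intro continuous_map_add) auto
  moreover have "f i x \<oplus> (\<Oplus>i\<in>I. f i x) = (\<Oplus>i\<in>insert i I. f i x)" if "x \<in> topspace Y" for x
    using insert that by (subst finsum_insert) (auto intro: continuous_map_closed)
  ultimately show ?case by (metis (no_types, lifting) continuous_map_eq)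
qed (simp add: continuous_map_zero)

end

section \<open>Multilinear operators\<close>

lemma tuples_iff: "xs \<in> tuples Es \<longleftrightarrow> length xs = length Es \<and> (\<forall>i<length Es. xs ! i \<in> carrier (Es ! i))"
  by (auto simp: tuples_def list_all2_conv_all_nth)

lemma tuples_update:
  "xs \<in> tuples Es \<Longrightarrow> x \<in> carrier (Es ! i) \<Longrightarrow> xs[i := x] \<in> tuples Es"
  by (cases "i < length xs") (auto simp: tuples_iff nth_list_update)

lemma map_in_tuples:
  "n = length Es \<Longrightarrow> (\<And>j. j < n \<Longrightarrow> x j \<in> carrier (Es ! j)) \<Longrightarrow> map x [0..<n] \<in> tuples Es"
  by (auto simp: tuples_iff)

lemma replicate_in_tuples [simp]: "x \<in> carrier E \<Longrightarrow> replicate n x \<in> tuples (replicate n E)"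
  by (auto simp: tuples_iff)

lemma tuples_singleton: "tuples [E] = (\<lambda>x. [x]) ` carrier E"
  by (auto simp: tuples_def list_all2_Cons2)

lemma multilinearD:
  assumes "multilinear Es F A"
  shows multilinear_closed: "xs \<in> tuples Es \<Longrightarrow> A xs \<in> carrier F"
    and multilinear_ext: "A \<in> extensional (tuples Es)"
    and multilinear_add: "xs \<in> tuples Es \<Longrightarrow> i < length Es \<Longrightarrow> x \<in> carrier (Es ! i) \<Longrightarrow>
      y \<in> carrier (Es ! i) \<Longrightarrow> A (xs[i := x \<oplus>\<^bsub>Es ! i\<^esub> y]) = A (xs[i := x]) \<oplus>\<^bsub>F\<^esub> A (xs[i := y])"
    and multilinear_smult: "xs \<in> tuples Es \<Longrightarrow> i < length Es \<Longrightarrow> x \<in> carrier (Es ! i) \<Longrightarrow>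
      A (xs[i := a \<odot>\<^bsub>Es ! i\<^esub> x]) = a \<odot>\<^bsub>F\<^esub> A (xs[i := x])"
  using assms by (auto simp: multilinear_def PiE_def)

lemma multilinearI:
  assumes "\<And>xs. xs \<in> tuples Es \<Longrightarrow> A xs \<in> carrier F" "A \<in> extensional (tuples Es)"
    and "\<And>xs i x y. xs \<in> tuples Es \<Longrightarrow> i < length Es \<Longrightarrow> x \<in> carrier (Es ! i) \<Longrightarrow>
      y \<in> carrier (Es ! i) \<Longrightarrow> A (xs[i := x \<oplus>\<^bsub>Es ! i\<^esub> y]) = A (xs[i := x]) \<oplus>\<^bsub>F\<^esub> A (xs[i := y])"
    and "\<And>xs i x a. xs \<in> tuples Es \<Longrightarrow> i < length Es \<Longrightarrow> x \<in> carrier (Es ! i) \<Longrightarrow>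
      A (xs[i := a \<odot>\<^bsub>Es ! i\<^esub> x]) = a \<odot>\<^bsub>F\<^esub> A (xs[i := x])"
  shows "multilinear Es F A"
  using assms by (auto simp: multilinear_def PiE_def)

locale banach_family =
  fixes Es :: "('k::{banach,real_normed_field}, 'v) nspace list" and F :: "('k, 'v) nspace"
  assumes banach_dom: "\<And>E. E \<in> set Es \<Longrightarrow> banach_space E" and banach_cod: "banach_space F"

sublocale banach_family \<subseteq> F: banach_on F
  using banach_cod by unfold_locales

context banach_family
begin

lemma dom_nth: "i < length Es \<Longrightarrow> banach_on (Es ! i)"
  using banach_dom by (auto intro!: banach_on.intro)

lemma multilinear_finsum_slot:
  assumes A: "multilinear Es F A" and xs: "xs \<in> tuples Es" and i: "i < length Es"
    and "finite J" "\<And>j. j \<in> J \<Longrightarrow> y j \<in> carrier (Es ! i)"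
  shows "A (xs[i := \<Oplus>\<^bsub>Es ! i\<^esub>j\<in>J. y j]) = (\<Oplus>\<^bsub>F\<^esub>j\<in>J. A (xs[i := y j]))"
  using assms(4,5)
proof (induction J rule: finite_induct)
  interpret E: banach_on "Es ! i" using i by (rule dom_nth)
  note cl = multilinear_closed[OF A tuples_update[OF xs]]
  {
    case empty
    have "A (xs[i := 0 \<odot>\<^bsub>Es ! i\<^esub> \<zero>\<^bsub>Es ! i\<^esub>]) = 0 \<odot>\<^bsub>F\<^esub> A (xs[i := \<zero>\<^bsub>Es ! i\<^esub>])"
      using A xs i by (intro multilinear_smult) auto
    then show ?case using cl by simp
  next
    case (insert j J)
    then show ?case
      by (subst E.finsum_insert F.finsum_insert; (auto simp: cl multilinear_add[OF A xs i])?)+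
  }
qed

text \<open>
  The arguments are expanded one after the other; the induction hypothesis \<open>s k f\<close> has the first
  \<open>k\<close> arguments already replaced by the summands that \<open>f\<close> selects.
\<close>

lemma multilinear_expand:
  assumes A: "multilinear Es F A" and n: "n = length Es" and I: "finite I"
    and y: "\<And>j i. j < n \<Longrightarrow> i \<in> I \<Longrightarrow> y j i \<in> carrier (Es ! j)"
  shows "A (map (\<lambda>j. \<Oplus>\<^bsub>Es ! j\<^esub>i\<in>I. y j i) [0..<n]) =
    (\<Oplus>\<^bsub>F\<^esub>f\<in>PiE {..<n} (\<lambda>_. I). A (map (\<lambda>j. y j (f j)) [0..<n]))"
proof -
  define s where "s k f j = (if j < k then y j (f j) else \<Oplus>\<^bsub>Es ! j\<^esub>i\<in>I. y j i)" for k f j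
  have s: "map (s k f) [0..<n] \<in> tuples Es" if "f \<in> PiE {..<k} (\<lambda>_. I)" "k \<le> n" for k f
  proof (intro map_in_tuples n)
    fix j assume j: "j < n"
    then interpret E: banach_on "Es ! j" using n by (intro dom_nth) simp
    show "s k f j \<in> carrier (Es ! j)"
      using that j y by (auto simp: s_def PiE_iff)
  qed
  have map_s: "map (s n f) [0..<n] = map (\<lambda>j. y j (f j)) [0..<n]" for f
    by (rule map_cong) (auto simp: s_def)
  have "k \<le> n \<Longrightarrow> A (map (\<lambda>j. \<Oplus>\<^bsub>Es ! j\<^esub>i\<in>I. y j i) [0..<n]) =
    (\<Oplus>\<^bsub>F\<^esub>f\<in>PiE {..<k} (\<lambda>_. I). A (map (s k f) [0..<n]))" for k
  proof (induction k)
    case 0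
    have "A (map (s 0 (\<lambda>_. undefined)) [0..<n]) \<in> carrier F"
      by (intro multilinear_closed[OF A] s) auto
    moreover have "s 0 (\<lambda>_. undefined) = (\<lambda>j. \<Oplus>\<^bsub>Es ! j\<^esub>i\<in>I. y j i)"
      by (simp add: s_def fun_eq_iff)
    ultimately show ?case
      by (simp add: F.finsum_insert[of "{}", simplified])
  next
    case (Suc k)
    then have k: "k < n" by simp
    have "A (map (s k f) [0..<n]) = (\<Oplus>\<^bsub>F\<^esub>i\<in>I. A (map (s (Suc k) (f(k := i))) [0..<n]))"
      if f: "f \<in> PiE {..<k} (\<lambda>_. I)" for f
    proof -
      have "map (s k f) [0..<n] = (map (s k f) [0..<n])[k := \<Oplus>\<^bsub>Es ! k\<^esub>i\<in>I. y k i]"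
        using k by (intro nth_equalityI) (auto simp: nth_list_update s_def)
      moreover have "(map (s k f) [0..<n])[k := y k i] = map (s (Suc k) (f(k := i))) [0..<n]" for i
        using k by (intro nth_equalityI) (auto simp: nth_list_update s_def less_Suc_eq)
      ultimately show ?thesis
        using multilinear_finsum_slot[OF A s[OF f] _ I, of k "y k"] k y n by simp
    qed
    moreover have cl: "A (map (s (Suc k) g) [0..<n]) \<in> carrier F"
      if "g \<in> PiE {..<Suc k} (\<lambda>_. I)" for g
      using that Suc.prems by (intro multilinear_closed[OF A] s)
    moreover have "f(k := i) \<in> PiE {..<Suc k} (\<lambda>_. I)"
      if "f \<in> PiE {..<k} (\<lambda>_. I)" "i \<in> I" for f i
      using that by (auto simp: PiE_iff extensional_def less_Suc_eq)
    ultimately have "(\<Oplus>\<^bsub>F\<^esub>f\<in>PiE {..<k} (\<lambda>_. I). A (map (s k f) [0..<n])) =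
      (\<Oplus>\<^bsub>F\<^esub>f\<in>PiE {..<k} (\<lambda>_. I). \<Oplus>\<^bsub>F\<^esub>i\<in>I. A (map (s (Suc k) (f(k := i))) [0..<n]))"
      by (intro F.finsum_cong') auto
    also have "\<dots> = (\<Oplus>\<^bsub>F\<^esub>f\<in>PiE {..<Suc k} (\<lambda>_. I). A (map (s (Suc k) f) [0..<n]))"
      using cl by (subst F.finsum_PiE_Suc[OF I]) auto
    finally show ?case using Suc by simp
  qed
  from this[of n] show ?thesis
    by (simp only: map_s)
qed

lemma multilinear_homogeneous:
  assumes A: "multilinear Es F A" and n: "n = length Es"
    and x: "\<And>j. j < n \<Longrightarrow> x j \<in> carrier (Es ! j)"
  shows "A (map (\<lambda>j. a j \<odot>\<^bsub>Es ! j\<^esub> x j) [0..<n]) = (\<Prod>j<n. a j) \<odot>\<^bsub>F\<^esub> A (map x [0..<n])"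
proof -
  define s where "s k j = (if j < k then a j \<odot>\<^bsub>Es ! j\<^esub> x j else x j)" for k :: nat and j
  have s: "map (s k) [0..<n] \<in> tuples Es" for k
  proof (intro map_in_tuples n)
    fix j assume j: "j < n"
    then interpret E: banach_on "Es ! j" using n by (intro dom_nth) simp
    show "s k j \<in> carrier (Es ! j)" using x j by (simp add: s_def)
  qed
  have xs: "map x [0..<n] \<in> tuples Es" using x n by (intro map_in_tuples)
  have "k \<le> n \<Longrightarrow> A (map (s k) [0..<n]) = (\<Prod>j<k. a j) \<odot>\<^bsub>F\<^esub> A (map x [0..<n])" for k
  proof (induction k)
    case 0
    then show ?case using multilinear_closed[OF A xs] by (simp add: s_def)
  next
    case (Suc k)
    then have k: "k < n" by simp
    have "map (s (Suc k)) [0..<n] = (map (s k) [0..<n])[k := a k \<odot>\<^bsub>Es ! k\<^esub> x k]"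
      using k by (intro nth_equalityI) (auto simp: nth_list_update s_def less_Suc_eq)
    moreover have "(map (s k) [0..<n])[k := x k] = map (s k) [0..<n]"
      using k by (intro nth_equalityI) (auto simp: nth_list_update s_def)
    ultimately have "A (map (s (Suc k)) [0..<n]) = a k \<odot>\<^bsub>F\<^esub> A (map (s k) [0..<n])"
      using multilinear_smult[OF A s, where i = k and x = "x k" and a = "a k"] k n x by simp
    then show ?case
      using Suc multilinear_closed[OF A xs] by (simp add: F.smult_smult mult.commute)
  qed
  moreover have "map (s n) [0..<n] = map (\<lambda>j. a j \<odot>\<^bsub>Es ! j\<^esub> x j) [0..<n]"
    by (rule map_cong) (auto simp: s_def)
  ultimately show ?thesis by (metis order_refl)
qed

lemma multilinear_zero: "multilinear Es F (\<lambda>xs\<in>tuples Es. \<zero>\<^bsub>F\<^esub>)"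
proof (rule multilinearI)
  fix xs i x y a assume xs: "xs \<in> tuples Es" "i < length Es" "x \<in> carrier (Es ! i)"
  then interpret E: banach_on "Es ! i" by (intro dom_nth)
  have "xs[i := a \<odot>\<^bsub>Es ! i\<^esub> x] \<in> tuples Es" "xs[i := x] \<in> tuples Es"
    using xs by (auto intro: tuples_update)
  then show "(\<lambda>xs\<in>tuples Es. \<zero>\<^bsub>F\<^esub>) (xs[i := a \<odot>\<^bsub>Es ! i\<^esub> x]) =
      a \<odot>\<^bsub>F\<^esub> (\<lambda>xs\<in>tuples Es. \<zero>\<^bsub>F\<^esub>) (xs[i := x])" by simp
  assume y: "y \<in> carrier (Es ! i)"
  then have "xs[i := x \<oplus>\<^bsub>Es ! i\<^esub> y] \<in> tuples Es" "xs[i := x] \<in> tuples Es" "xs[i := y] \<in> tuples Es"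
    using xs by (auto intro: tuples_update)
  then show "(\<lambda>xs\<in>tuples Es. \<zero>\<^bsub>F\<^esub>) (xs[i := x \<oplus>\<^bsub>Es ! i\<^esub> y]) =
      (\<lambda>xs\<in>tuples Es. \<zero>\<^bsub>F\<^esub>) (xs[i := x]) \<oplus>\<^bsub>F\<^esub> (\<lambda>xs\<in>tuples Es. \<zero>\<^bsub>F\<^esub>) (xs[i := y])" by simp
qed auto

lemma multilinear_plus:
  assumes A: "multilinear Es F A" and B: "multilinear Es F B"
  shows "multilinear Es F (\<lambda>xs\<in>tuples Es. A xs \<oplus>\<^bsub>F\<^esub> B xs)"
proof (rule multilinearI)
  note cl [simp] = multilinear_closed[OF A] multilinear_closed[OF B]
  fix xs i x y a assume xs: "xs \<in> tuples Es" "i < length Es" "x \<in> carrier (Es ! i)"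
  then interpret E: banach_on "Es ! i" by (intro dom_nth)
  have "xs[i := a \<odot>\<^bsub>Es ! i\<^esub> x] \<in> tuples Es" "xs[i := x] \<in> tuples Es"
    using xs by (auto intro: tuples_update)
  then show "(\<lambda>xs\<in>tuples Es. A xs \<oplus>\<^bsub>F\<^esub> B xs) (xs[i := a \<odot>\<^bsub>Es ! i\<^esub> x]) =
      a \<odot>\<^bsub>F\<^esub> (\<lambda>xs\<in>tuples Es. A xs \<oplus>\<^bsub>F\<^esub> B xs) (xs[i := x])"
    using multilinear_smult[OF A xs] multilinear_smult[OF B xs] by (simp add: F.smult_add_right)
  assume y: "y \<in> carrier (Es ! i)"
  then have "xs[i := x \<oplus>\<^bsub>Es ! i\<^esub> y] \<in> tuples Es" "xs[i := x] \<in> tuples Es" "xs[i := y] \<in> tuples Es"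
    using xs by (auto intro: tuples_update)
  then show "(\<lambda>xs\<in>tuples Es. A xs \<oplus>\<^bsub>F\<^esub> B xs) (xs[i := x \<oplus>\<^bsub>Es ! i\<^esub> y]) =
      (\<lambda>xs\<in>tuples Es. A xs \<oplus>\<^bsub>F\<^esub> B xs) (xs[i := x]) \<oplus>\<^bsub>F\<^esub>
      (\<lambda>xs\<in>tuples Es. A xs \<oplus>\<^bsub>F\<^esub> B xs) (xs[i := y])"
    using multilinear_add[OF A xs y] multilinear_add[OF B xs y] by (simp add: F.a_ac)
qed (auto simp: multilinear_closed[OF A] multilinear_closed[OF B])

lemma multilinear_scale:
  assumes A: "multilinear Es F A"
  shows "multilinear Es F (\<lambda>xs\<in>tuples Es. b \<odot>\<^bsub>F\<^esub> A xs)"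
proof (rule multilinearI)
  note cl [simp] = multilinear_closed[OF A]
  fix xs i x y a assume xs: "xs \<in> tuples Es" "i < length Es" "x \<in> carrier (Es ! i)"
  then interpret E: banach_on "Es ! i" by (intro dom_nth)
  have "xs[i := a \<odot>\<^bsub>Es ! i\<^esub> x] \<in> tuples Es" "xs[i := x] \<in> tuples Es"
    using xs by (auto intro: tuples_update)
  then show "(\<lambda>xs\<in>tuples Es. b \<odot>\<^bsub>F\<^esub> A xs) (xs[i := a \<odot>\<^bsub>Es ! i\<^esub> x]) =
      a \<odot>\<^bsub>F\<^esub> (\<lambda>xs\<in>tuples Es. b \<odot>\<^bsub>F\<^esub> A xs) (xs[i := x])"
    using multilinear_smult[OF A xs] by (simp add: F.smult_smult mult.commute)
  assume y: "y \<in> carrier (Es ! i)"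
  then have "xs[i := x \<oplus>\<^bsub>Es ! i\<^esub> y] \<in> tuples Es" "xs[i := x] \<in> tuples Es" "xs[i := y] \<in> tuples Es"
    using xs by (auto intro: tuples_update)
  then show "(\<lambda>xs\<in>tuples Es. b \<odot>\<^bsub>F\<^esub> A xs) (xs[i := x \<oplus>\<^bsub>Es ! i\<^esub> y]) =
      (\<lambda>xs\<in>tuples Es. b \<odot>\<^bsub>F\<^esub> A xs) (xs[i := x]) \<oplus>\<^bsub>F\<^esub>
      (\<lambda>xs\<in>tuples Es. b \<odot>\<^bsub>F\<^esub> A xs) (xs[i := y])"
    using multilinear_add[OF A xs y] by (simp add: F.smult_add_right)
qed (auto simp: multilinear_closed[OF A])

lemma multilinear_sum:
  assumes "finite I" "\<And>i. i \<in> I \<Longrightarrow> multilinear Es F (A i)"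
  shows "multilinear Es F (\<lambda>xs\<in>tuples Es. \<Oplus>\<^bsub>F\<^esub>i\<in>I. A i xs)"
  using assms
proof (induction I rule: finite_induct)
  case (insert i I)
  then have "multilinear Es F (\<lambda>xs\<in>tuples Es. A i xs \<oplus>\<^bsub>F\<^esub> (\<lambda>xs\<in>tuples Es. \<Oplus>\<^bsub>F\<^esub>i\<in>I. A i xs) xs)"
    by (intro multilinear_plus) auto
  also have "(\<lambda>xs\<in>tuples Es. A i xs \<oplus>\<^bsub>F\<^esub> (\<lambda>xs\<in>tuples Es. \<Oplus>\<^bsub>F\<^esub>i\<in>I. A i xs) xs)
      = (\<lambda>xs\<in>tuples Es. \<Oplus>\<^bsub>F\<^esub>i\<in>insert i I. A i xs)"
    using insert by (auto simp: multilinear_closed[of Es F] Pi_iff intro!: restrict_ext)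
  finally show ?case .
qed (simp add: multilinear_zero)

end

section \<open>Polarization\<close>

text \<open>
  Grouping the second product by the values of \<open>f\<close> gives the factor \<open>e i ^ (1 + k)\<close>
  for each \<open>i\<close>, where \<open>k\<close> is the number of preimages of \<open>i\<close>. The sum over all
  sign vectors then factorizes, and the factor at \<open>i\<close> is \<open>1 + (-1) ^ (1 + k)\<close>. It vanishes
  when \<open>i\<close> is not attained, and is \<open>2\<close> for every \<open>i\<close> when \<open>f\<close> is a bijection.
\<close>

lemma sum_signs:
  fixes f :: "nat \<Rightarrow> nat"
  assumes f: "f \<in> {..<n} \<rightarrow> {..<n}"
  shows "(\<Sum>e\<in>PiE {..<n} (\<lambda>_. {1, -1 :: 'k :: real_normed_field}). (\<Prod>i<n. e i) * (\<Prod>j<n. e (f j)))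
    = (if inj_on f {..<n} then 2 ^ n else 0)"
proof -
  let ?k = "\<lambda>i. card {j \<in> {..<n}. f j = i}"
  have "(\<Prod>i<n. e i) * (\<Prod>j<n. e (f j)) = (\<Prod>i<n. e i ^ Suc (?k i))" for e :: "nat \<Rightarrow> 'k"
  proof -
    have "(\<Prod>j<n. e (f j)) = (\<Prod>i<n. \<Prod>j\<in>{j \<in> {..<n}. f j = i}. e (f j))"
      using f by (subst prod.group) auto
    also have "\<dots> = (\<Prod>i<n. e i ^ ?k i)"
      by (intro prod.cong refl) simp
    finally show ?thesis by (simp add: prod.distrib)
  qed
  then have "(\<Sum>e\<in>PiE {..<n} (\<lambda>_. {1, -1 :: 'k}). (\<Prod>i<n. e i) * (\<Prod>j<n. e (f j)))
    = (\<Sum>e\<in>PiE {..<n} (\<lambda>_. {1, -1 :: 'k}). (\<Prod>i<n. e i ^ Suc (?k i)))"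
    by simp
  also have "\<dots> = (\<Prod>i<n. \<Sum>y\<in>{1, -1 :: 'k}. y ^ Suc (?k i))"
    by (rule prod_sum_PiE[symmetric]) auto
  also have "\<dots> = (if inj_on f {..<n} then 2 ^ n else 0)"
  proof (cases "inj_on f {..<n}")
    case True
    have "f ` {..<n} = {..<n}"
      using f True by (intro endo_inj_surj) auto
    have "?k i = 1" if i: "i < n" for i
    proof -
      obtain j where "j < n" "f j = i" using \<open>f ` {..<n} = {..<n}\<close> i by (metis imageE lessThan_iff)
      then have "{j \<in> {..<n}. f j = i} = {j}" using True by (auto simp: inj_on_def)
      then show ?thesis by simp
    qed
    then show ?thesis using True by simp
  next
    case False
    have "f ` {..<n} \<noteq> {..<n}"
      using False by (metis finite_lessThan finite_surj_inj subset_refl)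
    then obtain i where i: "i < n" "i \<notin> f ` {..<n}" using f by blast
    then have "{j \<in> {..<n}. f j = i} = {}" by auto
    then have "(\<Sum>y\<in>{1, -1 :: 'k}. y ^ Suc (?k i)) = 0" by (simp only: card.empty) simp
    with i False show ?thesis by (auto intro!: prod_zero)
  qed
  finally show ?thesis .
qed

text \<open>
  The expansion sums over extensional functions on \<open>{..<n}\<close>, whereas a permutation is the identity
  outside \<open>{..<n}\<close>; restriction translates between the two conventions.
\<close>

lemma permutes_restrict_image:
  fixes n :: nat
  shows "(\<lambda>\<sigma>. restrict \<sigma> {..<n}) ` {\<sigma>. \<sigma> permutes {..<n}} =
    {f \<in> PiE {..<n} (\<lambda>_. {..<n}). inj_on f {..<n}}"
proof (intro equalityI subsetI)
  fix f assume "f \<in> (\<lambda>\<sigma>. restrict \<sigma> {..<n}) ` {\<sigma>. \<sigma> permutes {..<n}}"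
  then obtain \<sigma> where "\<sigma> permutes {..<n}" "f = restrict \<sigma> {..<n}" by blast
  then show "f \<in> {f \<in> PiE {..<n} (\<lambda>_. {..<n}). inj_on f {..<n}}"
    using permutes_in_image[of \<sigma> "{..<n}"] permutes_inj_on[of \<sigma> "{..<n}" "{..<n}"]
    by (auto simp: inj_on_restrict_eq)
next
  fix f assume "f \<in> {f \<in> PiE {..<n} (\<lambda>_. {..<n}). inj_on f {..<n}}"
  then have f: "f \<in> PiE {..<n} (\<lambda>_. {..<n})" "inj_on f {..<n}" by auto
  let ?\<sigma> = "\<lambda>x. if x \<in> {..<n} then f x else x"
  have "f ` {..<n} = {..<n}"
    using f by (intro endo_inj_surj) auto
  then have "bij_betw f {..<n} {..<n}"
    using f by (simp add: bij_betw_def)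
  then have "?\<sigma> permutes {..<n}"
    by (intro bij_imp_permutes) (auto simp: bij_betw_def image_def inj_on_def)
  moreover have "f = restrict ?\<sigma> {..<n}"
    using f by (auto simp: fun_eq_iff PiE_iff extensional_def)
  ultimately show "f \<in> (\<lambda>\<sigma>. restrict \<sigma> {..<n}) ` {\<sigma>. \<sigma> permutes {..<n}}" by blast
qed

lemma inj_on_restrict_permutes:
  fixes n :: nat
  shows "inj_on (\<lambda>\<sigma>. restrict \<sigma> {..<n}) {\<sigma>. \<sigma> permutes {..<n}}"
proof (rule inj_onI, rule ext)
  fix \<sigma> \<tau> :: "nat \<Rightarrow> nat" and x
  assume "\<sigma> \<in> {\<sigma>. \<sigma> permutes {..<n}}" "\<tau> \<in> {\<sigma>. \<sigma> permutes {..<n}}"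
    "restrict \<sigma> {..<n} = restrict \<tau> {..<n}"
  then show "\<sigma> x = \<tau> x"
    by (cases "x < n") (auto simp: permutes_def dest: fun_cong[where x = x])
qed

definition signs :: "nat \<Rightarrow> (nat \<Rightarrow> 'k::real_normed_field) set" where
  "signs n = PiE {..<n} (\<lambda>_. {1, -1})"

lemma finite_signs [simp]: "finite (signs n)"
  by (simp add: signs_def finite_PiE)

lemma card_signs: "card (signs n :: (nat \<Rightarrow> 'k::real_normed_field) set) = 2 ^ n"
proof -
  have "card {1, -1 :: 'k} = 2" by simp
  then show ?thesis by (simp only: signs_def card_PiE finite_lessThan) simp
qed

lemma norm_prod_signs:
  assumes "e \<in> signs n"
  shows "i < n \<Longrightarrow> norm (e i) = 1" "norm (\<Prod>i<n. e i) = 1"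
proof -
  have *: "norm (e i) = 1" if "i < n" for i
  proof -
    have "e i = 1 \<or> e i = -1" using assms that by (auto simp: signs_def PiE_iff)
    then show ?thesis by (elim disjE) simp_all
  qed
  then show "i < n \<Longrightarrow> norm (e i) = 1" .
  show "norm (\<Prod>i<n. e i) = 1"
    using * by (simp add: prod_norm[symmetric])
qed

text \<open>
  The right-hand side of the polarization formula. It depends on the polynomial only, which makes
  both the uniqueness and the norm of the symmetric operator accessible.
\<close>

definition polar ::
  "nat \<Rightarrow> ('k::{banach,real_normed_field}, 'v) nspace \<Rightarrow> ('k, 'v) nspace \<Rightarrow> ('v \<Rightarrow> 'v) \<Rightarrow> ('v list \<Rightarrow> 'v)"
where
  "polar n E F P = (\<lambda>xs\<in>tuples (replicate n E). inverse (2 ^ n * fact n) \<odot>\<^bsub>F\<^esub>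
     (\<Oplus>\<^bsub>F\<^esub>e\<in>signs n. (\<Prod>i<n. e i) \<odot>\<^bsub>F\<^esub> P (\<Oplus>\<^bsub>E\<^esub>i\<in>{..<n}. e i \<odot>\<^bsub>E\<^esub> xs ! i)))"

locale banach_pair = E: banach_on E + F: banach_on F
  for E :: "('k::{banach,real_normed_field}, 'v) nspace" and F :: "('k, 'v) nspace"
begin

sublocale fam: banach_family "replicate n E" F for n
  by (standard) (auto simp: E.banach F.banach)

lemma permute_list_in_tuples:
  assumes "xs \<in> tuples (replicate n E)" "\<sigma> permutes {..<n}"
  shows "permute_list \<sigma> xs \<in> tuples (replicate n E)"
  using assms permutes_in_image[of \<sigma> "{..<n}"] by (auto simp: tuples_iff permute_list_nth)

lemma multilinear_permuted:
  assumes A: "multilinear (replicate n E) F A" and \<sigma>: "\<sigma> permutes {..<n}"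
  shows "multilinear (replicate n E) F (permuted (replicate n E) \<sigma> A)"
proof (rule multilinearI)
  fix xs i x y a
  assume xs: "xs \<in> tuples (replicate n E)" and "i < length (replicate n E)"
    and x: "x \<in> carrier (replicate n E ! i)"
  then have i: "i < n" by simp
  obtain l where l: "\<sigma> l = i" using permutes_surj[OF \<sigma>] by (metis surjD)
  then have j: "l < n" using i permutes_in_image[OF \<sigma>, of l] by simp
  have upd: "permute_list \<sigma> (xs[i := z]) = (permute_list \<sigma> xs)[l := z]" for z
  proof (rule nth_equalityI)
    fix k assume "k < length (permute_list \<sigma> (xs[i := z]))"
    then have k: "k < n" using xs by (simp add: tuples_iff)
    then have "\<sigma> k < n" using permutes_in_image[OF \<sigma>] by simp
    moreover have "l = k \<longleftrightarrow> i = \<sigma> k" using permutes_inj[OF \<sigma>] l by (auto simp: inj_def)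
    ultimately show "permute_list \<sigma> (xs[i := z]) ! k = (permute_list \<sigma> xs)[l := z] ! k"
      using k xs \<sigma> by (auto simp: tuples_iff permute_list_nth nth_list_update)
  qed simp
  note perm = permute_list_in_tuples[OF xs \<sigma>]
  have tup: "xs[i := z] \<in> tuples (replicate n E)" if "z \<in> carrier E" for z
    using xs that i by (intro tuples_update) auto
  show "permuted (replicate n E) \<sigma> A (xs[i := a \<odot>\<^bsub>replicate n E ! i\<^esub> x]) =
      a \<odot>\<^bsub>F\<^esub> permuted (replicate n E) \<sigma> A (xs[i := x])"
    using multilinear_smult[OF A perm, of "l" x a] x i j
    by (simp add: permuted_def tup upd)
  assume y: "y \<in> carrier (replicate n E ! i)"
  show "permuted (replicate n E) \<sigma> A (xs[i := x \<oplus>\<^bsub>replicate n E ! i\<^esub> y]) =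
      permuted (replicate n E) \<sigma> A (xs[i := x]) \<oplus>\<^bsub>F\<^esub> permuted (replicate n E) \<sigma> A (xs[i := y])"
    using multilinear_add[OF A perm, of "l" x y] x y i j
    by (simp add: permuted_def tup upd)
qed (auto simp: permuted_def multilinear_closed[OF A] permute_list_in_tuples[OF _ \<sigma>])

text \<open>
  The polarization formula. Expanding \<open>A (\<Sum> e i x i, \<dots>, \<Sum> e i x i)\<close> yields a sum over all index
  functions \<open>f\<close>; multiplication by the product of the signs and summation over the signs
  kills every \<open>f\<close> that is not a permutation, by \<open>sum_signs\<close>. Polarizing the diagonal of an operator that
  is not symmetric therefore produces its symmetrization.
\<close>

lemma polar_hat:
  assumes A: "multilinear (replicate n E) F A" and xs: "xs \<in> tuples (replicate n E)"
  shows "polar n E F (hat n E A) xs = inverse (fact n) \<odot>\<^bsub>F\<^esub>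
    (\<Oplus>\<^bsub>F\<^esub>\<sigma>\<in>{\<sigma>. \<sigma> permutes {..<n}}. A (permute_list \<sigma> xs))"
proof -
  let ?S = "signs n :: (nat \<Rightarrow> 'k) set"
  let ?T = "PiE {..<n} (\<lambda>_. {..<n})"
  let ?P = "{\<sigma>. \<sigma> permutes {..<n}}"
  let ?x = "\<lambda>f. map (\<lambda>j. xs ! f j) [0..<n]"
  have x: "xs ! i \<in> carrier E" if "i < n" for i using xs that by (simp add: tuples_iff)
  have Ax: "A (?x f) \<in> carrier F" if "f \<in> ?T" for f
    using that x by (intro multilinear_closed[OF A] map_in_tuples) (auto simp: PiE_iff)
  have "hat n E A (\<Oplus>\<^bsub>E\<^esub>i\<in>{..<n}. e i \<odot>\<^bsub>E\<^esub> xs ! i) =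
      (\<Oplus>\<^bsub>F\<^esub>f\<in>?T. (\<Prod>j<n. e (f j)) \<odot>\<^bsub>F\<^esub> A (?x f))" for e
  proof -
    have "(\<Oplus>\<^bsub>E\<^esub>i\<in>{..<n}. e i \<odot>\<^bsub>E\<^esub> xs ! i) \<in> carrier E"
      using x by (intro E.finsum_closed) auto
    then have "hat n E A (\<Oplus>\<^bsub>E\<^esub>i\<in>{..<n}. e i \<odot>\<^bsub>E\<^esub> xs ! i) =
      A (map (\<lambda>j. \<Oplus>\<^bsub>replicate n E ! j\<^esub>i\<in>{..<n}. e i \<odot>\<^bsub>E\<^esub> xs ! i) [0..<n])"
      by (auto simp: hat_def intro!: arg_cong[where f = A] nth_equalityI)
    also have "\<dots> = (\<Oplus>\<^bsub>F\<^esub>f\<in>?T. A (map (\<lambda>j. e (f j) \<odot>\<^bsub>E\<^esub> xs ! (f j)) [0..<n]))"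
      using x by (subst fam.multilinear_expand[OF A]) auto
    also have "\<dots> = (\<Oplus>\<^bsub>F\<^esub>f\<in>?T. (\<Prod>j<n. e (f j)) \<odot>\<^bsub>F\<^esub> A (?x f))"
    proof (rule F.finsum_cong')
      fix f assume f: "f \<in> ?T"
      have "map (\<lambda>j. e (f j) \<odot>\<^bsub>E\<^esub> xs ! (f j)) [0..<n] =
          map (\<lambda>j. e (f j) \<odot>\<^bsub>replicate n E ! j\<^esub> xs ! (f j)) [0..<n]" by simp
      then show "A (map (\<lambda>j. e (f j) \<odot>\<^bsub>E\<^esub> xs ! (f j)) [0..<n]) = (\<Prod>j<n. e (f j)) \<odot>\<^bsub>F\<^esub> A (?x f)"
        using f x by (simp only:) (subst fam.multilinear_homogeneous[OF A], auto simp: PiE_iff)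
    qed (use Ax in auto)
    finally show ?thesis .
  qed
  then have "(\<Oplus>\<^bsub>F\<^esub>e\<in>?S. (\<Prod>i<n. e i) \<odot>\<^bsub>F\<^esub> hat n E A (\<Oplus>\<^bsub>E\<^esub>i\<in>{..<n}. e i \<odot>\<^bsub>E\<^esub> xs ! i)) =
      (\<Oplus>\<^bsub>F\<^esub>f\<in>?T. (\<Sum>e\<in>?S. (\<Prod>i<n. e i) * (\<Prod>j<n. e (f j))) \<odot>\<^bsub>F\<^esub> A (?x f))"
    using Ax by (simp add: F.finsum_smult_finsum finite_PiE)
  also have "\<dots> = (\<Oplus>\<^bsub>F\<^esub>f\<in>?T. (if inj_on f {..<n} then 2 ^ n else 0) \<odot>\<^bsub>F\<^esub> A (?x f))"
    using Ax by (intro F.finsum_cong') (auto simp: signs_def sum_signs PiE_iff Pi_iff)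
  also have "\<dots> = (\<Oplus>\<^bsub>F\<^esub>f\<in>(\<lambda>\<sigma>. restrict \<sigma> {..<n}) ` ?P. 2 ^ n \<odot>\<^bsub>F\<^esub> A (?x f))"
    unfolding permutes_restrict_image
    using Ax by (intro F.add.finprod_mono_neutral_cong_right) (auto simp: finite_PiE)
  also have "\<dots> = (\<Oplus>\<^bsub>F\<^esub>\<sigma>\<in>?P. 2 ^ n \<odot>\<^bsub>F\<^esub> A (?x (restrict \<sigma> {..<n})))"
    using Ax by (intro F.finsum_reindex inj_on_restrict_permutes)
      (auto simp: permutes_restrict_image)
  also have "\<dots> = (\<Oplus>\<^bsub>F\<^esub>\<sigma>\<in>?P. 2 ^ n \<odot>\<^bsub>F\<^esub> A (permute_list \<sigma> xs))"
  proof (rule F.finsum_cong')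
    fix \<sigma> assume "\<sigma> \<in> ?P"
    then have "?x (restrict \<sigma> {..<n}) = permute_list \<sigma> xs"
      using xs by (intro nth_equalityI) (auto simp: tuples_iff permute_list_nth)
    then show "2 ^ n \<odot>\<^bsub>F\<^esub> A (?x (restrict \<sigma> {..<n})) = 2 ^ n \<odot>\<^bsub>F\<^esub> A (permute_list \<sigma> xs)" by simp
  qed (use multilinear_closed[OF A] permute_list_in_tuples[OF xs] in auto)
  also have "\<dots> = 2 ^ n \<odot>\<^bsub>F\<^esub> (\<Oplus>\<^bsub>F\<^esub>\<sigma>\<in>?P. A (permute_list \<sigma> xs))"
    using multilinear_closed[OF A] permute_list_in_tuples[OF xs]
    by (subst F.smult_finsum) (auto simp: finite_permutations)
  finally have "polar n E F (hat n E A) xs = inverse (2 ^ n * fact n) \<odot>\<^bsub>F\<^esub>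
      (2 ^ n \<odot>\<^bsub>F\<^esub> (\<Oplus>\<^bsub>F\<^esub>\<sigma>\<in>?P. A (permute_list \<sigma> xs)))"
    using xs by (simp add: polar_def)
  also have "\<dots> = (inverse (2 ^ n * fact n) * 2 ^ n) \<odot>\<^bsub>F\<^esub> (\<Oplus>\<^bsub>F\<^esub>\<sigma>\<in>?P. A (permute_list \<sigma> xs))"
    using multilinear_closed[OF A] permute_list_in_tuples[OF xs]
    by (intro F.smult_smult F.finsum_closed) auto
  also have "inverse (2 ^ n * fact n) * 2 ^ n = (inverse (fact n) :: 'k)"
    by (simp add: field_simps)
  finally show ?thesis .
qed

lemma polar_hat_eq:
  assumes A: "multilinear (replicate n E) F A"
  shows "polar n E F (hat n E A) = (\<lambda>xs\<in>tuples (replicate n E). inverse (fact n) \<odot>\<^bsub>F\<^esub>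
    (\<Oplus>\<^bsub>F\<^esub>\<sigma>\<in>{\<sigma>. \<sigma> permutes {..<n}}. permuted (replicate n E) \<sigma> A xs))"
  (is "?L = ?R")
proof
  fix xs
  show "?L xs = ?R xs"
    using polar_hat[OF A, of xs] by (cases "xs \<in> tuples (replicate n E)") (auto simp: polar_def permuted_def)
qed

lemma multilinear_polar:
  assumes A: "multilinear (replicate n E) F A"
  shows "multilinear (replicate n E) F (polar n E F (hat n E A))"
proof -
  let ?S = "\<lambda>xs\<in>tuples (replicate n E).
    \<Oplus>\<^bsub>F\<^esub>\<sigma>\<in>{\<sigma>. \<sigma> permutes {..<n}}. permuted (replicate n E) \<sigma> A xs"
  have "multilinear (replicate n E) F ?S"
    using A by (intro fam.multilinear_sum) (auto simp: finite_permutations multilinear_permuted)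
  then have "multilinear (replicate n E) F (\<lambda>xs\<in>tuples (replicate n E). inverse (fact n) \<odot>\<^bsub>F\<^esub> ?S xs)"
    by (rule fam.multilinear_scale)
  then show ?thesis
    unfolding polar_hat_eq[OF A] by (simp cong: restrict_cong)
qed

lemma permuted_polar:
  assumes A: "multilinear (replicate n E) F A" and \<tau>: "\<tau> permutes {..<n}"
  shows "permuted (replicate n E) \<tau> (polar n E F (hat n E A)) = polar n E F (hat n E A)"
proof
  fix xs
  let ?P = "{\<sigma>. \<sigma> permutes {..<n}}"
  show "permuted (replicate n E) \<tau> (polar n E F (hat n E A)) xs = polar n E F (hat n E A) xs"
  proof (cases "xs \<in> tuples (replicate n E)")
    case xs: True
    have "permute_list \<sigma> (permute_list \<tau> xs) = permute_list (\<tau> \<circ> \<sigma>) xs" if "\<sigma> \<in> ?P" for \<sigma>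
      using that xs by (subst permute_list_compose) (auto simp: tuples_iff)
    moreover have cl: "A (permute_list (\<tau> \<circ> \<sigma>) xs) \<in> carrier F" if "\<sigma> \<in> ?P" for \<sigma>
      using that multilinear_closed[OF A] permute_list_in_tuples[OF xs] permutes_compose[OF _ \<tau>]
      by blast
    ultimately have "(\<Oplus>\<^bsub>F\<^esub>\<sigma>\<in>?P. A (permute_list \<sigma> (permute_list \<tau> xs))) =
        (\<Oplus>\<^bsub>F\<^esub>\<sigma>\<in>?P. A (permute_list (\<tau> \<circ> \<sigma>) xs))"
      by (intro F.finsum_cong') auto
    also have "\<dots> = (\<Oplus>\<^bsub>F\<^esub>\<sigma>\<in>(\<circ>) \<tau> ` ?P. A (permute_list \<sigma> xs))"
      using cl permutes_inj[OF \<tau>]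
      by (intro F.finsum_reindex[symmetric]) (auto intro!: inj_onI simp: fun_eq_iff inj_def o_def)
    also have "(\<circ>) \<tau> ` ?P = ?P"
      using image_compose_permutations_left[OF \<tau>] by (simp only: setcompr_eq_image)
    finally show ?thesis
      using xs permute_list_in_tuples[OF xs \<tau>] by (simp add: permuted_def polar_hat[OF A])
  qed (simp add: permuted_def polar_def)
qed

lemma polar_hat_symmetric:
  assumes A: "multilinear (replicate n E) F A"
    and "\<And>\<sigma>. \<sigma> permutes {..<n} \<Longrightarrow> permuted (replicate n E) \<sigma> A = A"
  shows "polar n E F (hat n E A) = A"
proof
  fix xs
  show "polar n E F (hat n E A) xs = A xs"
  proof (cases "xs \<in> tuples (replicate n E)")
    case True
    note cl = multilinear_closed[OF A True]
    have "(\<Oplus>\<^bsub>F\<^esub>\<sigma>\<in>{\<sigma>. \<sigma> permutes {..<n}}. permuted (replicate n E) \<sigma> A xs) = fact n \<odot>\<^bsub>F\<^esub> A xs"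
      using cl assms(2) by (subst F.finsum_cong'[OF refl, of "\<lambda>_. A xs"])
        (auto simp: F.finsum_constant finite_permutations card_permutations[of _ n])
    then show ?thesis
      using True cl by (simp add: polar_hat_eq[OF A] F.smult_smult)
  next
    case False
    then show ?thesis using multilinear_ext[OF A] by (simp add: polar_def extensional_def)
  qed
qed

lemma hat_polar:
  assumes A: "multilinear (replicate n E) F A"
  shows "hat n E (polar n E F (hat n E A)) = hat n E A"
proof
  fix x
  show "hat n E (polar n E F (hat n E A)) x = hat n E A x"
  proof (cases "x \<in> carrier E")
    case True
    note cl = multilinear_closed[OF A replicate_in_tuples[OF True]]
    have "permute_list \<sigma> (replicate n x) = replicate n x" if "\<sigma> permutes {..<n}" for \<sigma>
      using that permutes_in_image[OF that] by (intro nth_equalityI) (auto simp: permute_list_nth)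
    then have "(\<Oplus>\<^bsub>F\<^esub>\<sigma>\<in>{\<sigma>. \<sigma> permutes {..<n}}. A (permute_list \<sigma> (replicate n x))) =
        fact n \<odot>\<^bsub>F\<^esub> A (replicate n x)"
      using cl by (subst F.finsum_cong'[OF refl, of "\<lambda>_. A (replicate n x)"])
        (auto simp: F.finsum_constant finite_permutations card_permutations[of _ n])
    then show ?thesis
      using True cl by (simp add: hat_def polar_hat[OF A, unfolded hat_def] F.smult_smult)
  qed (simp add: hat_def)
qed

end

section \<open>Continuous operators and polynomials\<close>

lemma multi_ops_iff: "A \<in> multi_ops Es F \<longleftrightarrow> multilinear Es F A \<and> multilinear_continuous Es F A"
  by (simp add: multi_space_def)

lemma polys_iff:
  "P \<in> polys n E F \<longleftrightarrow> homogeneous_poly n E F P \<and> continuous_map (ntopology E) (ntopology F) P"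
  by (simp add: poly_space_def)

lemma multi_space_simps:
  "\<zero>\<^bsub>multi_space Es F\<^esub> = (\<lambda>xs\<in>tuples Es. \<zero>\<^bsub>F\<^esub>)"
  "A \<oplus>\<^bsub>multi_space Es F\<^esub> B = (\<lambda>xs\<in>tuples Es. A xs \<oplus>\<^bsub>F\<^esub> B xs)"
  "a \<odot>\<^bsub>multi_space Es F\<^esub> A = (\<lambda>xs\<in>tuples Es. a \<odot>\<^bsub>F\<^esub> A xs)"
  "vnorm (multi_space Es F) A =
    (SUP xs\<in>{xs \<in> tuples Es. \<forall>i<length Es. vnorm (Es ! i) (xs ! i) \<le> 1}. vnorm F (A xs))"
  by (simp_all add: multi_space_def)

lemma poly_space_simps:
  "\<zero>\<^bsub>poly_space n E F\<^esub> = (\<lambda>x\<in>carrier E. \<zero>\<^bsub>F\<^esub>)"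
  "P \<oplus>\<^bsub>poly_space n E F\<^esub> Q = (\<lambda>x\<in>carrier E. P x \<oplus>\<^bsub>F\<^esub> Q x)"
  "a \<odot>\<^bsub>poly_space n E F\<^esub> P = (\<lambda>x\<in>carrier E. a \<odot>\<^bsub>F\<^esub> P x)"
  "vnorm (poly_space n E F) P = (SUP x\<in>{x \<in> carrier E. vnorm E x \<le> 1}. vnorm F (P x))"
  by (simp_all add: poly_space_def)

context banach_family
begin

abbreviation "domain_topology \<equiv> product_topology (\<lambda>i. ntopology (Es ! i)) {..<length Es}"

lemma topspace_domain: "topspace domain_topology = PiE {..<length Es} (\<lambda>i. carrier (Es ! i))"
  by (auto simp: banach_on.topspace_ntopology[OF dom_nth] intro!: PiE_cong)

lemma domain_tuple: "x \<in> topspace domain_topology \<Longrightarrow> map x [0..<length Es] \<in> tuples Es"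
  unfolding topspace_domain by (intro map_in_tuples) auto

lemma multilinear_continuous_restrict:
  "multilinear_continuous Es F (restrict A (tuples Es)) \<longleftrightarrow> multilinear_continuous Es F A"
proof -
  have "restrict A (tuples Es) (map x [0..<length Es]) = A (map x [0..<length Es])"
    if "x \<in> topspace domain_topology" for x
    using domain_tuple[OF that] by simp
  then show ?thesis
    unfolding multilinear_continuous_def by (metis (no_types, lifting) continuous_map_eq)
qed

lemma multi_ops_zero: "(\<lambda>xs\<in>tuples Es. \<zero>\<^bsub>F\<^esub>) \<in> multi_ops Es F"
  by (simp add: multi_ops_iff multilinear_zero multilinear_continuous_restrict)
    (simp add: multilinear_continuous_def F.continuous_map_zero)

lemma multi_ops_plus:
  "A \<in> multi_ops Es F \<Longrightarrow> B \<in> multi_ops Es F \<Longrightarrow> (\<lambda>xs\<in>tuples Es. A xs \<oplus>\<^bsub>F\<^esub> B xs) \<in> multi_ops Es F"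
  by (simp add: multi_ops_iff multilinear_plus multilinear_continuous_restrict)
    (simp add: multilinear_continuous_def F.continuous_map_add)

lemma multi_ops_scale:
  "A \<in> multi_ops Es F \<Longrightarrow> (\<lambda>xs\<in>tuples Es. a \<odot>\<^bsub>F\<^esub> A xs) \<in> multi_ops Es F"
  by (simp add: multi_ops_iff multilinear_scale multilinear_continuous_restrict)
    (simp add: multilinear_continuous_def F.continuous_map_smult)

lemma multi_ops_funcset: "multi_ops Es F \<subseteq> tuples Es \<rightarrow>\<^sub>E carrier F"
  by (auto simp: multi_ops_iff multilinear_def)

sublocale M: kspace "multi_space Es F"
  using multi_ops_funcset multi_ops_zero multi_ops_plus multi_ops_scale
  by (intro F.kspace_pointwise[where D = "tuples Es"]) (simp_all add: multi_space_simps)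

end

context banach_pair
begin

lemma hat_zero: "hat n E \<zero>\<^bsub>multi_space (replicate n E) F\<^esub> = \<zero>\<^bsub>poly_space n E F\<^esub>"
  and hat_plus: "hat n E (A \<oplus>\<^bsub>multi_space (replicate n E) F\<^esub> B) = hat n E A \<oplus>\<^bsub>poly_space n E F\<^esub> hat n E B"
  and hat_scale: "hat n E (a \<odot>\<^bsub>multi_space (replicate n E) F\<^esub> A) = a \<odot>\<^bsub>poly_space n E F\<^esub> hat n E A"
  by (auto simp: hat_def multi_space_simps poly_space_simps)

lemma continuous_map_hat:
  assumes A: "A \<in> multi_ops (replicate n E) F"
  shows "continuous_map (ntopology E) (ntopology F) (hat n E A)"
proof -
  have "continuous_map (ntopology E) (product_topology (\<lambda>i. ntopology (replicate n E ! i)) {..<n})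
      (\<lambda>x. \<lambda>i\<in>{..<n}. x)"
    unfolding continuous_map_componentwise by (auto simp: )
  moreover have "continuous_map (product_topology (\<lambda>i. ntopology (replicate n E ! i)) {..<n}) (ntopology F)
      (\<lambda>x. A (map x [0..<n]))"
    using A by (simp add: multi_ops_iff multilinear_continuous_def)
  ultimately have "continuous_map (ntopology E) (ntopology F)
      ((\<lambda>x. A (map x [0..<n])) \<circ> (\<lambda>x. \<lambda>i\<in>{..<n}. x))"
    by (rule continuous_map_compose)
  moreover have "map (\<lambda>i\<in>{..<n}. x) [0..<n] = replicate n x" for x :: 'v
    by (intro nth_equalityI) auto
  ultimately show ?thesis
    by (elim continuous_map_eq) (simp add: hat_def)
qed

lemma hat_in_polys: "A \<in> multi_ops (replicate n E) F \<Longrightarrow> hat n E A \<in> polys n E F"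
  using continuous_map_hat[of A n] by (auto simp: polys_iff homogeneous_poly_def multi_ops_iff)

sublocale P: kspace "poly_space n E F" for n
proof (rule F.kspace_pointwise[where D = "carrier E"])
  show "polys n E F \<subseteq> carrier E \<rightarrow>\<^sub>E carrier F"
    by (auto simp: polys_iff homogeneous_poly_def hat_def multilinear_closed)
  have "\<zero>\<^bsub>multi_space (replicate n E) F\<^esub> \<in> multi_ops (replicate n E) F" by simp
  from hat_in_polys[OF this] show "\<zero>\<^bsub>poly_space n E F\<^esub> \<in> polys n E F"
    by (simp only: hat_zero)
next
  fix P Q assume P: "P \<in> polys n E F" and Q: "Q \<in> polys n E F"
  obtain A B where A: "multilinear (replicate n E) F A" "P = hat n E A"
    and B: "multilinear (replicate n E) F B" "Q = hat n E B"
    using P Q by (auto simp: polys_iff homogeneous_poly_def)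
  have "multilinear (replicate n E) F (A \<oplus>\<^bsub>multi_space (replicate n E) F\<^esub> B)"
    using fam.multilinear_plus[OF A(1) B(1)] by (simp add: multi_space_simps)
  moreover have "continuous_map (ntopology E) (ntopology F) (P \<oplus>\<^bsub>poly_space n E F\<^esub> Q)"
    using F.continuous_map_add[of "ntopology E" P Q] P Q
    by (auto simp: polys_iff poly_space_simps elim: continuous_map_eq)
  ultimately show "P \<oplus>\<^bsub>poly_space n E F\<^esub> Q \<in> polys n E F"
    unfolding polys_iff homogeneous_poly_def
    by (intro conjI exI[of _ "A \<oplus>\<^bsub>multi_space (replicate n E) F\<^esub> B"])
      (simp_all only: A(2) B(2) hat_plus)
next
  fix P a assume P: "P \<in> polys n E F"
  obtain A where A: "multilinear (replicate n E) F A" "P = hat n E A"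
    using P by (auto simp: polys_iff homogeneous_poly_def)
  have "multilinear (replicate n E) F (a \<odot>\<^bsub>multi_space (replicate n E) F\<^esub> A)"
    using fam.multilinear_scale[OF A(1)] by (simp add: multi_space_simps)
  moreover have "continuous_map (ntopology E) (ntopology F) (a \<odot>\<^bsub>poly_space n E F\<^esub> P)"
    using F.continuous_map_smult[of "ntopology E" P a] P
    by (auto simp: polys_iff poly_space_simps elim: continuous_map_eq)
  ultimately show "a \<odot>\<^bsub>poly_space n E F\<^esub> P \<in> polys n E F"
    unfolding polys_iff homogeneous_poly_def
    by (intro conjI exI[of _ "a \<odot>\<^bsub>multi_space (replicate n E) F\<^esub> A"])
      (simp_all only: A(2) hat_scale)
qed (simp_all add: poly_space_simps)

lemma poly_closed: "P \<in> polys n E F \<Longrightarrow> x \<in> carrier E \<Longrightarrow> P x \<in> carrier F"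
  by (auto simp: polys_iff homogeneous_poly_def hat_def multilinear_closed)

lemma poly_homogeneous:
  assumes "P \<in> polys n E F" "x \<in> carrier E"
  shows "P (a \<odot>\<^bsub>E\<^esub> x) = a ^ n \<odot>\<^bsub>F\<^esub> P x"
proof -
  obtain A where A: "multilinear (replicate n E) F A" "P = hat n E A"
    using assms by (auto simp: polys_iff homogeneous_poly_def)
  have "A (map (\<lambda>j. a \<odot>\<^bsub>replicate n E ! j\<^esub> x) [0..<n]) = a ^ n \<odot>\<^bsub>F\<^esub> A (map (\<lambda>_. x) [0..<n])"
    using assms by (subst fam.multilinear_homogeneous[OF A(1)]) auto
  moreover have "map (\<lambda>j. a \<odot>\<^bsub>replicate n E ! j\<^esub> x) [0..<n] = replicate n (a \<odot>\<^bsub>E\<^esub> x)"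
    by (intro nth_equalityI) auto
  ultimately show ?thesis
    using assms by (simp add: A hat_def map_replicate_const)
qed

text \<open>
  Continuity at zero bounds the polynomial on a small ball, and homogeneity transports the bound to
  the unit ball. A positive degree makes the value at zero vanish.
\<close>

lemma poly_bounded:
  assumes P: "P \<in> polys n E F" and n: "n \<ge> 1"
  shows "\<exists>M. \<forall>x\<in>carrier E. vnorm E x \<le> 1 \<longrightarrow> vnorm F (P x) \<le> M"
proof -
  have P0: "P \<zero>\<^bsub>E\<^esub> = \<zero>\<^bsub>F\<^esub>"
    using poly_homogeneous[OF P, of "\<zero>\<^bsub>E\<^esub>" 0] poly_closed[OF P] n by (simp add: power_0_left)
  have "continuous_map (ntopology E) (ntopology F) P" using P by (simp add: polys_iff)
  then have "\<exists>\<delta>>0. \<forall>x. x \<in> carrier E \<and> ndist E \<zero>\<^bsub>E\<^esub> x < \<delta> \<longrightarrow> ndist F (P \<zero>\<^bsub>E\<^esub>) (P x) < 1"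
    unfolding ntopology_def Metric_space.metric_continuous_map[OF E.Metric_space F.Metric_space]
    by (meson E.zero_closed zero_less_one)
  then obtain \<delta> where \<delta>: "\<delta> > 0"
    "\<And>x. x \<in> carrier E \<Longrightarrow> ndist E \<zero>\<^bsub>E\<^esub> x < \<delta> \<Longrightarrow> ndist F (P \<zero>\<^bsub>E\<^esub>) (P x) < 1"
    by blast
  have small: "vnorm F (P x) < 1" if "x \<in> carrier E" "vnorm E x < \<delta>" for x
    using \<delta>(2)[of x] that poly_closed[OF P]
    by (simp add: P0 ndist_def a_minus_def E.norm_a_inv F.norm_a_inv)
  have "vnorm F (P x) \<le> 1 / (\<delta> / 2) ^ n" if x: "x \<in> carrier E" "vnorm E x \<le> 1" for x
  proof -
    have "vnorm E (of_real (\<delta> / 2) \<odot>\<^bsub>E\<^esub> x) = \<delta> / 2 * vnorm E x"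
      using x \<delta>(1) by (simp add: E.norm_smult)
    also have "\<dots> \<le> \<delta> / 2 * 1" using x \<delta>(1) by (intro mult_left_mono) auto
    also have "\<dots> < \<delta>" using \<delta>(1) by simp
    finally have "vnorm F (P (of_real (\<delta> / 2) \<odot>\<^bsub>E\<^esub> x)) < 1" using x small by simp
    moreover have "vnorm F (P (of_real (\<delta> / 2) \<odot>\<^bsub>E\<^esub> x)) = (\<delta> / 2) ^ n * vnorm F (P x)"
      using x \<delta>(1) poly_closed[OF P] by (simp add: poly_homogeneous[OF P] F.norm_smult norm_power)
    ultimately show ?thesis
      using \<delta>(1) by (simp add: field_simps del: power_divide)
  qed
  then show ?thesis by blast
qed

lemma poly_bdd_above:
  "P \<in> polys n E F \<Longrightarrow> n \<ge> 1 \<Longrightarrow> bdd_above ((\<lambda>x. vnorm F (P x)) ` {x \<in> carrier E. vnorm E x \<le> 1})"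
  using poly_bounded[of P n] by (auto simp: bdd_above_def)

lemma poly_norm_nonneg:
  assumes "P \<in> polys n E F" "n \<ge> 1"
  shows "0 \<le> vnorm (poly_space n E F) P"
proof -
  have "vnorm F (P \<zero>\<^bsub>E\<^esub>) \<le> vnorm (poly_space n E F) P"
    unfolding poly_space_simps by (rule cSUP_upper[OF _ poly_bdd_above[OF assms]]) simp
  then show ?thesis using F.norm_nonneg[OF poly_closed[OF assms(1)], of "\<zero>\<^bsub>E\<^esub>"] by simp
qed

lemma poly_norm_bound:
  assumes P: "P \<in> polys n E F" and n: "n \<ge> 1" and x: "x \<in> carrier E"
  shows "vnorm F (P x) \<le> vnorm (poly_space n E F) P * vnorm E x ^ n"
proof (cases "x = \<zero>\<^bsub>E\<^esub>")
  case True
  then have "P x = \<zero>\<^bsub>F\<^esub>"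
    using poly_homogeneous[OF P, of "\<zero>\<^bsub>E\<^esub>" 0] poly_closed[OF P] n by (simp add: power_0_left)
  then show ?thesis using True n by (simp add: power_0_left)
next
  case False
  let ?t = "vnorm E x"
  have t: "?t > 0" using False x E.norm_nonneg[of x] E.norm_eq_0[of x] by linarith
  let ?y = "of_real (1 / ?t) \<odot>\<^bsub>E\<^esub> x"
  have y: "?y \<in> carrier E" "vnorm E ?y \<le> 1" using x t by (auto simp: E.norm_smult norm_divide)
  have "x = of_real ?t \<odot>\<^bsub>E\<^esub> ?y" using x t by (simp add: E.smult_smult flip: of_real_mult)
  then have "P x = of_real ?t ^ n \<odot>\<^bsub>F\<^esub> P ?y" using poly_homogeneous[OF P y(1)] by metis
  then have "vnorm F (P x) = ?t ^ n * vnorm F (P ?y)"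
    using t poly_closed[OF P y(1)] by (simp add: F.norm_smult norm_power)
  also have "vnorm F (P ?y) \<le> vnorm (poly_space n E F) P"
    unfolding poly_space_simps by (rule cSUP_upper[OF _ poly_bdd_above[OF P n]]) (use y in simp)
  finally show ?thesis using t by (simp add: mult.commute mult_right_mono)
qed

text \<open>
  The operator that witnesses homogeneity need not be continuous. Its symmetrization is:
  by polarization it is a finite sum of compositions of the continuous polynomial with linear
  combinations of the arguments.
\<close>

lemma polar_in_sym_ops:
  assumes P: "P \<in> polys n E F"
  shows "polar n E F P \<in> sym_ops n E F" "hat n E (polar n E F P) = P"
proof -
  obtain A where A: "multilinear (replicate n E) F A" "P = hat n E A"
    using P by (auto simp: polys_iff homogeneous_poly_def)
  show "hat n E (polar n E F P) = P" using hat_polar A by simp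
  let ?X = "product_topology (\<lambda>i. ntopology (replicate n E ! i)) {..<n}"
  have P_cont: "continuous_map (ntopology E) (ntopology F) P" using P by (simp add: polys_iff)
  have "continuous_map ?X (ntopology E) (\<lambda>x. \<Oplus>\<^bsub>E\<^esub>i\<in>{..<n}. e i \<odot>\<^bsub>E\<^esub> x i)" for e
  proof (intro E.continuous_map_finsum E.continuous_map_smult)
    fix i assume "i \<in> {..<n}"
    then show "continuous_map ?X (ntopology E) (\<lambda>x. x i)"
      using continuous_map_product_projection[of i "{..<n}" "\<lambda>i. ntopology (replicate n E ! i)"] by simp
  qed simp
  then have "continuous_map ?X (ntopology F) (\<lambda>x. inverse (2 ^ n * fact n) \<odot>\<^bsub>F\<^esub>
     (\<Oplus>\<^bsub>F\<^esub>e\<in>signs n. (\<Prod>i<n. e i) \<odot>\<^bsub>F\<^esub> P (\<Oplus>\<^bsub>E\<^esub>i\<in>{..<n}. e i \<odot>\<^bsub>E\<^esub> x i)))"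
    by (intro F.continuous_map_finsum F.continuous_map_smult finite_signs
        continuous_map_compose[OF _ P_cont, unfolded o_def])
  moreover have "polar n E F P (map x [0..<n]) = inverse (2 ^ n * fact n) \<odot>\<^bsub>F\<^esub>
     (\<Oplus>\<^bsub>F\<^esub>e\<in>signs n. (\<Prod>i<n. e i) \<odot>\<^bsub>F\<^esub> P (\<Oplus>\<^bsub>E\<^esub>i\<in>{..<n}. e i \<odot>\<^bsub>E\<^esub> x i))"
    if x: "x \<in> topspace ?X" for x
  proof -
    have x': "x i \<in> carrier E" if "i < n" for i
      using x that by (auto simp: PiE_iff)
    then have "(\<Oplus>\<^bsub>E\<^esub>i\<in>{..<n}. e i \<odot>\<^bsub>E\<^esub> map x [0..<n] ! i) = (\<Oplus>\<^bsub>E\<^esub>i\<in>{..<n}. e i \<odot>\<^bsub>E\<^esub> x i)" for e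
      by (intro E.finsum_cong') auto
    moreover have "map x [0..<n] \<in> tuples (replicate n E)"
      using x' by (intro map_in_tuples) auto
    ultimately show ?thesis by (simp add: polar_def)
  qed
  ultimately have "multilinear_continuous (replicate n E) F (polar n E F P)"
    by (auto simp: multilinear_continuous_def elim!: continuous_map_eq)
  then show "polar n E F P \<in> sym_ops n E F"
    using multilinear_polar[OF A(1)] permuted_polar[OF A(1)] A(2)
    by (simp add: sym_ops_def multi_ops_iff)
qed

lemma polar_unique:
  assumes "A \<in> sym_ops n E F"
  shows "polar n E F (hat n E A) = A"
  using assms by (intro polar_hat_symmetric) (auto simp: sym_ops_def multi_ops_iff)

lemma sym_op_of_eq_polar:
  assumes "P \<in> polys n E F"
  shows "sym_op_of n E F P = polar n E F P"
  unfolding sym_op_of_def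
  using polar_in_sym_ops[OF assms] polar_unique by (intro the_equality) auto

text \<open>
  Each of the \<open>2 ^ n\<close> terms of the polarization formula evaluates the polynomial at a vector
  of norm at most \<open>n\<close>; the denominator \<open>2 ^ n * fact n\<close> leaves the constant \<open>n ^ n / fact n\<close>.
\<close>

lemma polar_bound:
  assumes P: "P \<in> polys n E F" and n: "n \<ge> 1"
    and xs: "xs \<in> tuples (replicate n E)" "\<And>i. i < n \<Longrightarrow> vnorm E (xs ! i) \<le> 1"
  shows "vnorm F (polar n E F P xs) \<le> real n ^ n / fact n * vnorm (poly_space n E F) P"
proof -
  let ?N = "vnorm (poly_space n E F) P"
  let ?y = "\<lambda>e. \<Oplus>\<^bsub>E\<^esub>i\<in>{..<n}. e i \<odot>\<^bsub>E\<^esub> xs ! i"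
  have x: "xs ! i \<in> carrier E" if "i < n" for i using xs that by (simp add: tuples_iff)
  have y: "?y e \<in> carrier E" for e using x by (intro E.finsum_closed) auto
  have term_le: "vnorm F ((\<Prod>i<n. e i) \<odot>\<^bsub>F\<^esub> P (?y e)) \<le> ?N * real n ^ n" if e: "e \<in> signs n" for e
  proof -
    have "vnorm E (?y e) \<le> (\<Sum>i<n. vnorm E (e i \<odot>\<^bsub>E\<^esub> xs ! i))"
      using x by (intro E.norm_finsum) auto
    also have "\<dots> \<le> (\<Sum>i<n. 1)"
      using x xs(2) norm_prod_signs(1)[OF e] by (intro sum_mono) (simp add: E.norm_smult)
    finally have "vnorm E (?y e) \<le> real n" by simp
    then have "?N * vnorm E (?y e) ^ n \<le> ?N * real n ^ n"
      using E.norm_nonneg[OF y] poly_norm_nonneg[OF P n] by (intro mult_left_mono power_mono)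
    moreover have "vnorm F ((\<Prod>i<n. e i) \<odot>\<^bsub>F\<^esub> P (?y e)) = vnorm F (P (?y e))"
      using norm_prod_signs(2)[OF e] poly_closed[OF P y] by (simp add: F.norm_smult)
    ultimately show ?thesis using poly_norm_bound[OF P n y, of e] by linarith
  qed
  have "vnorm F (\<Oplus>\<^bsub>F\<^esub>e\<in>signs n. (\<Prod>i<n. e i) \<odot>\<^bsub>F\<^esub> P (?y e)) \<le>
      (\<Sum>e\<in>(signs n :: (nat \<Rightarrow> 'k) set). vnorm F ((\<Prod>i<n. e i) \<odot>\<^bsub>F\<^esub> P (?y e)))"
    using poly_closed[OF P y] by (intro F.norm_finsum) auto
  also have "\<dots> \<le> (\<Sum>e\<in>(signs n :: (nat \<Rightarrow> 'k) set). ?N * real n ^ n)"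
    using term_le by (intro sum_mono)
  also have "\<dots> = 2 ^ n * (?N * real n ^ n)" by (simp add: card_signs)
  finally have "norm (inverse (2 ^ n * fact n) :: 'k) *
      vnorm F (\<Oplus>\<^bsub>F\<^esub>e\<in>signs n. (\<Prod>i<n. e i) \<odot>\<^bsub>F\<^esub> P (?y e)) \<le>
      norm (inverse (2 ^ n * fact n) :: 'k) * (2 ^ n * (?N * real n ^ n))"
    by (intro mult_left_mono) auto
  also have "norm (inverse (2 ^ n * fact n) :: 'k) = inverse (2 ^ n * fact n)"
    by (simp only: norm_inverse norm_mult norm_power norm_fact norm_numeral)
  also have "inverse (2 ^ n * fact n) * (2 ^ n * (?N * real n ^ n)) = real n ^ n / fact n * ?N"
    by (simp add: field_simps)
  finally show ?thesis
    using xs poly_closed[OF P y]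
    by (simp add: polar_def F.norm_smult F.finsum_closed norm_mult norm_inverse norm_power)
qed

end

lemma zero_tuple:
  assumes "\<And>E. E \<in> set Es \<Longrightarrow> banach_space E"
  shows "map (\<lambda>i. \<zero>\<^bsub>Es ! i\<^esub>) [0..<length Es] \<in>
    {xs \<in> tuples Es. \<forall>i<length Es. vnorm (Es ! i) (xs ! i) \<le> 1}"
proof -
  have "\<zero>\<^bsub>Es ! i\<^esub> \<in> carrier (Es ! i) \<and> vnorm (Es ! i) \<zero>\<^bsub>Es ! i\<^esub> \<le> 1" if "i < length Es" for i
  proof -
    interpret E: banach_on "Es ! i" using assms that by (intro banach_on.intro) auto
    show ?thesis by simp
  qed
  then show ?thesis by (auto intro!: map_in_tuples)
qed

lemma multi_norm_le:
  assumes "\<And>E. E \<in> set Es \<Longrightarrow> banach_space E"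
    and "\<And>xs. xs \<in> tuples Es \<Longrightarrow> (\<And>i. i < length Es \<Longrightarrow> vnorm (Es ! i) (xs ! i) \<le> 1) \<Longrightarrow> vnorm F (A xs) \<le> K"
  shows "vnorm (multi_space Es F) A \<le> K"
  unfolding multi_space_simps
proof (rule cSUP_least)
  show "{xs \<in> tuples Es. \<forall>i<length Es. vnorm (Es ! i) (xs ! i) \<le> 1} \<noteq> {}"
    using zero_tuple[OF assms(1)] by blast
qed (use assms(2) in auto)

text \<open>
  A supremum of real numbers is only meaningful for a bounded set, so an explicit bound on the unit
  ball is a hypothesis.
\<close>

lemma multi_norm_nonneg:
  assumes "\<And>E. E \<in> set Es \<Longrightarrow> banach_space E" "banach_space F" "multilinear Es F A"
    and "\<And>xs. xs \<in> tuples Es \<Longrightarrow> (\<And>i. i < length Es \<Longrightarrow> vnorm (Es ! i) (xs ! i) \<le> 1) \<Longrightarrow> vnorm F (A xs) \<le> K"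
  shows "0 \<le> vnorm (multi_space Es F) A"
proof -
  interpret F: banach_on F using assms(2) by (rule banach_on.intro)
  let ?z = "map (\<lambda>i. \<zero>\<^bsub>Es ! i\<^esub>) [0..<length Es]"
  have z: "?z \<in> tuples Es" "\<forall>i<length Es. vnorm (Es ! i) (?z ! i) \<le> 1"
    using zero_tuple[OF assms(1)] by auto
  have "0 \<le> vnorm F (A ?z)" using z assms(3) by (intro F.norm_nonneg multilinear_closed)
  also have "\<dots> \<le> vnorm (multi_space Es F) A"
    unfolding multi_space_simps
    using z assms(4) by (intro cSUP_upper) (auto simp: bdd_above_def)
  finally show ?thesis .
qed

context banach_pair
begin

lemma sym_op_bound:
  assumes A: "A \<in> sym_ops n E F" and n: "n \<ge> 1"
    and xs: "xs \<in> tuples (replicate n E)" "\<And>i. i < length (replicate n E) \<Longrightarrow> vnorm (replicate n E ! i) (xs ! i) \<le> 1"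
  shows "vnorm F (A xs) \<le> real n ^ n / fact n * vnorm (poly_space n E F) (hat n E A)"
proof -
  have "hat n E A \<in> polys n E F" using A hat_in_polys by (auto simp: sym_ops_def)
  from polar_bound[OF this n xs(1)] xs(2) show ?thesis by (simp add: polar_unique[OF A])
qed

lemma sym_op_norm_nonneg:
  assumes A: "A \<in> sym_ops n E F" and n: "n \<ge> 1"
  shows "0 \<le> vnorm (multi_space (replicate n E) F) A"
  using A by (intro multi_norm_nonneg[OF _ _ _ sym_op_bound[OF A n]])
    (auto simp: E.banach F.banach sym_ops_def multi_ops_iff)

lemma polar_norm_le:
  assumes P: "P \<in> polys n E F" and n: "n \<ge> 1"
  shows "vnorm (multi_space (replicate n E) F) (polar n E F P) \<le> real n ^ n / fact n * vnorm (poly_space n E F) P"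
proof (rule multi_norm_le)
  fix xs assume "xs \<in> tuples (replicate n E)"
    "\<And>i. i < length (replicate n E) \<Longrightarrow> vnorm (replicate n E ! i) (xs ! i) \<le> 1"
  from sym_op_bound[OF polar_in_sym_ops(1)[OF P] n this]
  show "vnorm F (polar n E F P xs) \<le> real n ^ n / fact n * vnorm (poly_space n E F) P"
    by (simp add: polar_in_sym_ops(2)[OF P])
qed (auto simp: E.banach)

end

section \<open>Quotient norms\<close>

text \<open>
  This is how completeness passes to a quotient. In a Cauchy sequence of the image choose a
  subsequence whose steps are shorter than \<open>(1/2) ^ i\<close>. Each step lifts to one below the same
  bound, so the subsequence lifts to a Cauchy sequence; the image of its limit is the limit of the
  subsequence and hence of the whole sequence.
\<close>

lemma mcomplete_image:
  assumes A: "Metric_space A d" and B: "Metric_space B d'" and surj: "f ` A = B"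
    and contr: "\<And>x x'. x \<in> A \<Longrightarrow> x' \<in> A \<Longrightarrow> d' (f x) (f x') \<le> d x x'"
    and lift: "\<And>x y e. x \<in> A \<Longrightarrow> y \<in> B \<Longrightarrow> d' (f x) y < e \<Longrightarrow> \<exists>x'\<in>A. f x' = y \<and> d x x' < e"
    and complete: "Metric_space.mcomplete A d"
  shows "Metric_space.mcomplete B d'"
proof -
  interpret A: Metric_space A d by (rule A)
  interpret B: Metric_space B d' by (rule B)
  show ?thesis
    unfolding B.mcomplete_def
  proof (intro allI impI)
    fix \<sigma> assume \<sigma>: "B.MCauchy \<sigma>"
    then have \<sigma>B: "\<sigma> n \<in> B" for n by (auto simp: B.MCauchy_def)
    have "\<exists>N. \<forall>n n'. N \<le> n \<longrightarrow> N \<le> n' \<longrightarrow> d' (\<sigma> n) (\<sigma> n') < (1/2) ^ i" for i :: nat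
      using \<sigma> unfolding B.MCauchy_def by (meson zero_less_power half_gt_zero zero_less_one)
    then obtain N where N: "d' (\<sigma> n) (\<sigma> n') < (1/2) ^ i" if "N i \<le> n" "N i \<le> n'" for i n n'
      by metis
    \<comment> \<open>the maximum makes \<open>r\<close> increasing and lets \<open>r i\<close> pass the Cauchy index for \<open>(1/2) ^ i\<close>\<close>
    define r where "r = rec_nat (N 0) (\<lambda>i k. max (Suc k) (N (Suc i)))"
    have r_Suc: "r (Suc i) = max (Suc (r i)) (N (Suc i))" for i by (simp add: r_def)
    have r: "strict_mono r" by (rule strict_monoI_Suc) (simp add: r_Suc)
    have rN: "N i \<le> r i" for i by (cases i) (simp_all add: r_def)
    have step: "d' (\<sigma> (r i)) (\<sigma> (r (Suc i))) < (1/2) ^ i" for i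
      using N rN[of i] r by (meson dual_order.trans lessI less_imp_le strict_monoD)
    have "\<exists>b. \<forall>i. (b i \<in> A \<and> f (b i) = \<sigma> (r i)) \<and> d (b i) (b (Suc i)) < (1/2) ^ i"
    proof (rule dependent_nat_choice)
      show "\<exists>x. x \<in> A \<and> f x = \<sigma> (r 0)" using surj \<sigma>B by (metis imageE)
      fix x i assume "x \<in> A \<and> f x = \<sigma> (r i)"
      then show "\<exists>y. (y \<in> A \<and> f y = \<sigma> (r (Suc i))) \<and> d x y < (1/2) ^ i"
        using lift[of x "\<sigma> (r (Suc i))"] step[of i] \<sigma>B by auto
    qed
    then obtain b where b: "b i \<in> A" "f (b i) = \<sigma> (r i)" "d (b i) (b (Suc i)) < (1/2) ^ i" for i
      by blast
    \<comment> \<open>the partial sums of a geometric series, in the closed form that the induction reproduces\<close>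
    have tail: "d (b i) (b (i + k)) \<le> 2 * (1/2) ^ i - 2 * (1/2) ^ (i + k)" for i k
    proof (induction k)
      case (Suc k)
      have "d (b i) (b (i + Suc k)) \<le> d (b i) (b (i + k)) + d (b (i + k)) (b (Suc (i + k)))"
        using A.triangle[OF b(1) b(1) b(1)] by simp
      with Suc b(3)[of "i + k"] show ?case by simp
    qed (simp add: b)
    have "A.MCauchy b"
      unfolding A.MCauchy_def
    proof (intro conjI allI impI)
      fix e :: real assume "e > 0"
      then obtain M where M: "(1/2) ^ M < e / 4"
        using real_arch_pow_inv[of "e / 4" "1/2"] by auto
      have "d (b n) (b n') < e" if "M \<le> n" "M \<le> n'" for n n'
      proof -
        have "d (b M) (b n) \<le> 2 * (1/2) ^ M" if "M \<le> n" for n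
        proof -
          have "d (b M) (b n) \<le> 2 * (1/2) ^ M - 2 * (1/2) ^ n"
            using tail[of M "n - M"] that by simp
          also have "\<dots> \<le> 2 * (1/2) ^ M" by simp
          finally show ?thesis .
        qed
        from this[OF that(1)] this[OF that(2)] show ?thesis
          using A.triangle''[OF b(1) b(1) b(1), of n n' M] M by linarith
      qed
      then show "\<exists>M. \<forall>n n'. M \<le> n \<longrightarrow> M \<le> n' \<longrightarrow> d (b n) (b n') < e" by blast
    qed (use b in auto)
    then obtain l where l: "limitin A.mtopology b l sequentially"
      using complete by (auto simp: A.mcomplete_def)
    then have lX: "l \<in> A" by (rule A.limitin_mspace)
    have "limitin B.mtopology (\<sigma> \<circ> r) (f l) sequentially"
      unfolding B.limit_metric_sequentially
    proof (intro conjI allI impI)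
      show "f l \<in> B" using lX surj by blast
      fix e :: real assume "e > 0"
      then obtain M where M: "\<And>n. n \<ge> M \<Longrightarrow> d (b n) l < e"
        using l unfolding A.limit_metric_sequentially by blast
      have "(\<sigma> \<circ> r) n \<in> B \<and> d' ((\<sigma> \<circ> r) n) (f l) < e" if "n \<ge> M" for n
        using M[OF that] contr[OF b(1) lX, of n] \<sigma>B by (simp add: b)
      then show "\<exists>M. \<forall>n\<ge>M. (\<sigma> \<circ> r) n \<in> B \<and> d' ((\<sigma> \<circ> r) n) (f l) < e" by blast
    qed
    then show "\<exists>x. limitin B.mtopology \<sigma> x sequentially"
      using B.MCauchy_convergent_subsequence[OF \<sigma> r] by blast
  qed
qed

text \<open>
  Lets an estimate that holds for every representative of a polynomial pass to the infimum of
  their norms, also inside a power.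
\<close>

lemma le_at_Inf:
  fixes g :: "real \<Rightarrow> real"
  assumes "continuous_on {0..} g" "A \<noteq> {}" "A \<subseteq> {0..}" "\<And>x. x \<in> A \<Longrightarrow> c \<le> g x"
  shows "c \<le> g (Inf A)"
proof -
  let ?C = "{x \<in> {0..}. g x \<in> {c..}}"
  have "closed ?C"
    using continuous_closed_preimage[OF assms(1), of "{c..}"] by (simp add: vimage_def Int_def)
  moreover have "A \<subseteq> ?C" using assms by auto
  moreover have "bdd_below A" using assms(3) by (auto simp: bdd_below_def)
  ultimately have "Inf A \<in> ?C" using assms(2) by (metis closed_subset_contains_Inf)
  then show ?thesis by simp
qed

text \<open>
  \<open>M\<close> is the quotient norm of the linear map \<open>T\<close> on \<open>S\<close>. The kernel of \<open>T\<close>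
  is closed precisely when \<open>M\<close> separates points, which is what \<open>sep\<close> says.
\<close>

locale quotient_norm = V: kspace V + W: kspace W
  for V :: "('k::real_normed_field, 'v, 'm) module_scheme"
    and W :: "('k, 'w, 'n) module_scheme" +
  fixes p :: real and S :: "'v set" and T :: "'v \<Rightarrow> 'w" and N :: "'v \<Rightarrow> real" and M :: "'w \<Rightarrow> real"
  assumes p: "0 < p"
    and sub: "submodule S (ring_of_type_algebra :: 'k ring) V"
    and T_closed: "\<And>x. x \<in> S \<Longrightarrow> T x \<in> carrier W"
    and T_zero: "T \<zero>\<^bsub>V\<^esub> = \<zero>\<^bsub>W\<^esub>"
    and T_add: "\<And>x y. x \<in> S \<Longrightarrow> y \<in> S \<Longrightarrow> T (x \<oplus>\<^bsub>V\<^esub> y) = T x \<oplus>\<^bsub>W\<^esub> T y"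
    and T_smult: "\<And>a x. x \<in> S \<Longrightarrow> T (a \<odot>\<^bsub>V\<^esub> x) = a \<odot>\<^bsub>W\<^esub> T x"
    and N: "p_norm_on p V S N"
    and M_eq: "\<And>y. M y = Inf (N ` {x \<in> S. T x = y})"
    and sep: "\<And>y. y \<in> T ` S \<Longrightarrow> M y = 0 \<Longrightarrow> y = \<zero>\<^bsub>W\<^esub>"
begin

lemma S: "S \<subseteq> carrier V" "\<zero>\<^bsub>V\<^esub> \<in> S" "\<And>x y. x \<in> S \<Longrightarrow> y \<in> S \<Longrightarrow> x \<oplus>\<^bsub>V\<^esub> y \<in> S"
  "\<And>a x. x \<in> S \<Longrightarrow> a \<odot>\<^bsub>V\<^esub> x \<in> S"
  using sub by (auto simp: V.submodule_iff)

lemma N_simps: "x \<in> S \<Longrightarrow> 0 \<le> N x" "N \<zero>\<^bsub>V\<^esub> = 0" "x \<in> S \<Longrightarrow> N (a \<odot>\<^bsub>V\<^esub> x) = norm a * N x"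
  "x \<in> S \<Longrightarrow> y \<in> S \<Longrightarrow> N (x \<oplus>\<^bsub>V\<^esub> y) powr p \<le> N x powr p + N y powr p"
  using N S(2) by (auto simp: p_norm_on_def)

lemma M_le: "x \<in> S \<Longrightarrow> M (T x) \<le> N x"
  unfolding M_eq by (rule cInf_lower) (auto simp: bdd_below_def intro!: exI[of _ 0] N_simps)

lemma M_nonneg: "x \<in> S \<Longrightarrow> 0 \<le> M (T x)"
  unfolding M_eq by (rule cInf_greatest) (auto simp: N_simps)

lemma le_at_M:
  fixes g :: "real \<Rightarrow> real"
  assumes "y \<in> T ` S" "continuous_on {0..} g" "\<And>x. x \<in> S \<Longrightarrow> T x = y \<Longrightarrow> c \<le> g (N x)"
  shows "c \<le> g (M y)"
  unfolding M_eq
proof (rule le_at_Inf[OF assms(2)])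
  show "N ` {x \<in> S. T x = y} \<noteq> {}" using assms(1) by auto
  show "N ` {x \<in> S. T x = y} \<subseteq> {0..}" by (auto simp: N_simps)
  show "c \<le> g t" if "t \<in> N ` {x \<in> S. T x = y}" for t using that assms(3) by auto
qed

lemma submodule_image: "submodule (T ` S) (ring_of_type_algebra :: 'k ring) W"
  unfolding W.submodule_iff using S
  by (auto simp: T_closed T_zero[symmetric] T_add[symmetric] T_smult[symmetric])

lemma p_norm_image: "p_norm_on p W (T ` S) M"
  unfolding p_norm_on_def
proof (intro conjI ballI allI)
  fix y assume y: "y \<in> T ` S"
  then show "0 \<le> M y" using M_nonneg by auto
  have M0: "M \<zero>\<^bsub>W\<^esub> = 0"
    using M_le[OF S(2)] M_nonneg[OF S(2)] by (simp add: T_zero N_simps)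
  then show "M y = 0 \<longleftrightarrow> y = \<zero>\<^bsub>W\<^esub>" using sep[OF y] by auto
  have le: "M (a \<odot>\<^bsub>W\<^esub> y) \<le> norm a * M y" if y: "y \<in> T ` S" for a y
  proof (rule le_at_M[OF y, where g = "\<lambda>t. norm a * t"])
    fix x assume x: "x \<in> S" "T x = y"
    then show "M (a \<odot>\<^bsub>W\<^esub> y) \<le> norm a * N x"
      using M_le[OF S(4)[OF x(1), of a]] by (simp add: T_smult N_simps)
  qed (intro continuous_intros)
  fix a
  show "M (a \<odot>\<^bsub>W\<^esub> y) = norm a * M y"
  proof (cases "a = 0")
    case True
    then show ?thesis using y M0 T_closed by auto
  next
    case False
    have yc: "y \<in> carrier W" using y T_closed by auto
    have ay: "a \<odot>\<^bsub>W\<^esub> y \<in> T ` S" using submodule_image[unfolded W.submodule_iff] y by blast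
    have "y = inverse a \<odot>\<^bsub>W\<^esub> (a \<odot>\<^bsub>W\<^esub> y)" using False yc by (simp add: W.smult_smult)
    then have "M y \<le> norm (inverse a) * M (a \<odot>\<^bsub>W\<^esub> y)" using le[OF ay, of "inverse a"] by simp
    then have "norm a * M y \<le> M (a \<odot>\<^bsub>W\<^esub> y)" using False by (simp add: norm_divide field_simps)
    then show ?thesis using le[OF y, of a] by simp
  qed
next
  fix y z assume y: "y \<in> T ` S" and z: "z \<in> T ` S"
  have "M (y \<oplus>\<^bsub>W\<^esub> z) powr p \<le> N x powr p + M z powr p" if x: "x \<in> S" "T x = y" for x
  proof (rule le_at_M[OF z, where g = "\<lambda>t. N x powr p + t powr p"])
    fix x' assume x': "x' \<in> S" "T x' = z"
    have "M (y \<oplus>\<^bsub>W\<^esub> z) \<le> N (x \<oplus>\<^bsub>V\<^esub> x')"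
      using M_le[OF S(3)[OF x(1) x'(1)]] x x' by (simp add: T_add)
    moreover have "0 \<le> M (y \<oplus>\<^bsub>W\<^esub> z)"
      using M_nonneg[OF S(3)[OF x(1) x'(1)]] x x' by (simp add: T_add)
    ultimately have "M (y \<oplus>\<^bsub>W\<^esub> z) powr p \<le> N (x \<oplus>\<^bsub>V\<^esub> x') powr p"
      using p by (intro powr_mono2) auto
    also have "\<dots> \<le> N x powr p + N x' powr p" using x x' by (simp add: N_simps)
    finally show "M (y \<oplus>\<^bsub>W\<^esub> z) powr p \<le> N x powr p + N x' powr p" .
  qed (use p in \<open>auto intro!: continuous_intros continuous_on_powr'\<close>)
  then show "M (y \<oplus>\<^bsub>W\<^esub> z) powr p \<le> M y powr p + M z powr p"
    using p by (intro le_at_M[OF y, where g = "\<lambda>t. t powr p + M z powr p"])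
      (auto intro!: continuous_intros continuous_on_powr')
qed

lemma p_complete_image:
  assumes "p_complete_on p V S N"
  shows "p_complete_on p W (T ` S) M"
  unfolding p_complete_on_def
proof (rule mcomplete_image[OF V.Metric_space_p_dist[OF sub N]
      W.Metric_space_p_dist[OF submodule_image p_norm_image] refl])
  have T_minus: "x \<ominus>\<^bsub>V\<^esub> x' \<in> S \<and> T (x \<ominus>\<^bsub>V\<^esub> x') = T x \<ominus>\<^bsub>W\<^esub> T x'" if "x \<in> S" "x' \<in> S" for x x'
    using that S by (auto simp: V.a_minus_eq W.a_minus_eq T_add T_smult T_closed subset_iff)
  fix x assume x: "x \<in> S"
  {
    fix x' assume x': "x' \<in> S"
    have "M (T x \<ominus>\<^bsub>W\<^esub> T x') \<le> N (x \<ominus>\<^bsub>V\<^esub> x')" "0 \<le> M (T x \<ominus>\<^bsub>W\<^esub> T x')"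
      using M_le[of "x \<ominus>\<^bsub>V\<^esub> x'"] M_nonneg[of "x \<ominus>\<^bsub>V\<^esub> x'"] T_minus[OF x x'] by auto
    then show "p_dist p W (T ` S) M (T x) (T x') \<le> p_dist p V S N x x'"
      using x x' p by (auto simp: p_dist_def intro!: powr_mono2)
  next
    fix y e assume y: "y \<in> T ` S" and e: "p_dist p W (T ` S) M (T x) y < e"
    obtain z where z: "z \<in> S" "y = T z" using y by auto
    have diff: "T x \<ominus>\<^bsub>W\<^esub> y \<in> T ` S"
      using T_minus[OF x z(1)] z(2) by (metis imageI)
    \<comment> \<open>if every lift of the difference were at least \<open>e\<close> long, so would be the infimum\<close>
    have "\<exists>a\<in>S. T a = T x \<ominus>\<^bsub>W\<^esub> y \<and> N a powr p < e"
    proof (rule ccontr)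
      assume "\<not> ?thesis"
      then have "e \<le> M (T x \<ominus>\<^bsub>W\<^esub> y) powr p"
        using p by (intro le_at_M[OF diff, where g = "\<lambda>t. t powr p"])
          (auto intro!: continuous_intros continuous_on_powr' simp: not_less)
      then show False using e x y by (simp add: p_dist_def)
    qed
    then obtain a where a: "a \<in> S" "T a = T x \<ominus>\<^bsub>W\<^esub> y" "N a powr p < e" by blast
    have xa: "x \<in> carrier V" "a \<in> carrier V" and W: "T x \<in> carrier W" "y \<in> carrier W"
      using x a S z T_closed by auto
    have "x \<ominus>\<^bsub>V\<^esub> (x \<ominus>\<^bsub>V\<^esub> a) = a"
      using xa by (simp add: a_minus_def V.minus_add V.a_assoc[symmetric] V.r_neg)
    moreover have "T x \<ominus>\<^bsub>W\<^esub> (T x \<ominus>\<^bsub>W\<^esub> y) = y"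
      using W by (simp add: a_minus_def W.minus_add W.a_assoc[symmetric] W.r_neg)
    ultimately show "\<exists>x'\<in>S. T x' = y \<and> p_dist p V S N x x' < e"
      using a x T_minus[OF x a(1)] by (intro bexI[of _ "x \<ominus>\<^bsub>V\<^esub> a"]) (auto simp: p_dist_def)
  }
qed (use assms in \<open>simp add: p_complete_on_def\<close>)

end

section \<open>Composition in blocks of equal length\<close>

lemma block_uniform:
  assumes "length xs = r * m" "j < r"
  shows length_block_uniform: "length (block (\<lambda>i. i * m) j xs) = m"
    and nth_block_uniform: "i < m \<Longrightarrow> block (\<lambda>i. i * m) j xs ! i = xs ! (j * m + i)"
proof -
  have "Suc j * m \<le> r * m" using assms(2) by (intro mult_le_mono1) simp
  then show "length (block (\<lambda>i. i * m) j xs) = m" using assms(1) by (simp add: block_def)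
  from \<open>Suc j * m \<le> r * m\<close>
  show "block (\<lambda>i. i * m) j xs ! i = xs ! (j * m + i)" if "i < m"
    using assms(1) that by (simp add: block_def)
qed

lemma block_replicate_uniform:
  "j < r \<Longrightarrow> block (\<lambda>i. i * m) j (replicate (r * m) x) = replicate m x"
proof (intro nth_equalityI)
  assume j: "j < r"
  show "length (block (\<lambda>i. i * m) j (replicate (r * m) x)) = length (replicate m x)"
    using length_block_uniform[of "replicate (r * m) x" r m j] j by simp
  fix i assume "i < length (block (\<lambda>i. i * m) j (replicate (r * m) x))"
  then have i: "i < m" using length_block_uniform[of "replicate (r * m) x" r m j] j by simp
  have "j * m + i < Suc j * m" using i by simp
  also have "\<dots> \<le> r * m" using j by (intro mult_le_mono1) simp
  finally show "block (\<lambda>i. i * m) j (replicate (r * m) x) ! i = replicate m x ! i"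
    using nth_block_uniform[of "replicate (r * m) x" r m j i] i j by simp
qed

lemma block_in_tuples: "xs \<in> tuples Gs \<Longrightarrow> block m i xs \<in> tuples (block m i Gs)"
  by (simp add: tuples_def block_def list_all2_dropI list_all2_takeI)

lemma set_block_subset: "set (block m i xs) \<subseteq> set xs"
  unfolding block_def by (meson set_drop_subset set_take_subset subset_trans)

lemma block_update_uniform:
  assumes "length xs = r * m" "j < r" "i < r * m" "m \<ge> 1"
  shows "block (\<lambda>i. i * m) j (xs[i := z]) =
    (if j = i div m then (block (\<lambda>i. i * m) j xs)[i mod m := z] else block (\<lambda>i. i * m) j xs)"
proof (rule nth_equalityI)
  have l: "length (block (\<lambda>i. i * m) j (xs[i := z])) = m" "length (block (\<lambda>i. i * m) j xs) = m"
    using assms by (simp_all add: length_block_uniform)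
  then show "length (block (\<lambda>i. i * m) j (xs[i := z])) =
    length (if j = i div m then (block (\<lambda>i. i * m) j xs)[i mod m := z] else block (\<lambda>i. i * m) j xs)"
    by (metis length_list_update)
  fix k assume "k < length (block (\<lambda>i. i * m) j (xs[i := z]))"
  then have k: "k < m" using l by simp
  have "j * m + k = i \<longleftrightarrow> j = i div m \<and> k = i mod m"
    using k by auto
  then show "block (\<lambda>i. i * m) j (xs[i := z]) ! k =
    (if j = i div m then (block (\<lambda>i. i * m) j xs)[i mod m := z] else block (\<lambda>i. i * m) j xs) ! k"
    using k assms l nth_block_uniform[OF assms(1,2) k]
      nth_block_uniform[of "xs[i := z]" r m j k]
    by (cases "j = i div m"; cases "k = i mod m") (simp_all add: nth_list_update)
qed

text \<open>
  Membership of \<open>C \<circ> (B, \<dots>, B)\<close> in \<open>L \<circ> \<H>\<close> presupposes that it is a continuous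
  multilinear operator. The variable at position \<open>i\<close> is variable \<open>i mod m\<close> of the copy
  \<open>i div m\<close> of \<open>B\<close>.
\<close>

lemma block_comp_in_multi_ops:
  fixes G E F :: "('k::{banach,real_normed_field}, 'v) nspace"
  assumes G: "banach_space G" and E: "banach_space E" and F: "banach_space F"
    and A: "A \<in> multi_ops (replicate r E) F" and B: "B \<in> multi_ops (replicate m G) E" and m: "m \<ge> 1"
  shows "block_comp (\<lambda>i. i * m) r (replicate (r * m) G) A (\<lambda>_. B) \<in> multi_ops (replicate (r * m) G) F"
    (is "?D \<in> _")
  unfolding multi_ops_iff
proof
  interpret GE: banach_pair G E using G E by (simp add: banach_pair_def banach_on_def)
  interpret EF: banach_pair E F using E F by (simp add: banach_pair_def banach_on_def)
  interpret GF: banach_pair G F using G F by (simp add: banach_pair_def banach_on_def)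
  let ?Gs = "replicate (r * m) G"
  let ?b = "block (\<lambda>i. i * m)"
  let ?Y = "\<lambda>xs. map (\<lambda>j. B (?b j xs)) [0..<r]"
  have Am: "multilinear (replicate r E) F A" and Bm: "multilinear (replicate m G) E B"
    using A B by (simp_all add: multi_ops_iff)
  have b: "?b j xs \<in> tuples (replicate m G)" if "xs \<in> tuples ?Gs" "j < r" for j xs
    using block_in_tuples[OF that(1), of "\<lambda>i. i * m" j] that(2) by (simp add: block_replicate_uniform)
  have Y: "?Y xs \<in> tuples (replicate r E)" if "xs \<in> tuples ?Gs" for xs
    using multilinear_closed[OF Bm b[OF that]] by (intro map_in_tuples) auto
  have D: "?D xs = A (?Y xs)" if "xs \<in> tuples ?Gs" for xs
    using that by (simp add: block_comp_def)
  show "multilinear ?Gs F ?D"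
  proof (rule multilinearI)
    fix xs assume "xs \<in> tuples ?Gs"
    then show "?D xs \<in> carrier F" using multilinear_closed[OF Am Y] D by simp
  next
    fix xs i x y a
    assume xs: "xs \<in> tuples ?Gs" and i: "i < length ?Gs" and x: "x \<in> carrier (?Gs ! i)"
    let ?j = "i div m" and ?k = "i mod m"
    have len: "length xs = r * m" using xs by (simp add: tuples_iff)
    have i': "i < r * m" using i by simp
    then have j: "?j < r" by (simp add: less_mult_imp_div_less)
    have k: "?k < m" using m by simp
    have upd: "?D (xs[i := z]) = A ((?Y xs)[?j := B ((?b ?j xs)[?k := z])])" if z: "z \<in> carrier G" for z
    proof -
      have "?Y (xs[i := z]) = (?Y xs)[?j := B ((?b ?j xs)[?k := z])]"
        using block_update_uniform[OF len _ i' m] by (intro nth_equalityI) (auto simp: nth_list_update)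
      moreover have "xs[i := z] \<in> tuples ?Gs" using xs z i by (intro tuples_update) auto
      ultimately show ?thesis by (simp add: D)
    qed
    have Bcl: "B ((?b ?j xs)[?k := z]) \<in> carrier E" if "z \<in> carrier G" for z
      using that k by (intro multilinear_closed[OF Bm] tuples_update b[OF xs j]) simp
    show "?D (xs[i := a \<odot>\<^bsub>?Gs ! i\<^esub> x]) = a \<odot>\<^bsub>F\<^esub> ?D (xs[i := x])"
      using x i j k Bcl multilinear_smult[OF Bm b[OF xs j], of ?k x a]
        multilinear_smult[OF Am Y[OF xs], of ?j "B ((?b ?j xs)[?k := x])" a]
      by (simp add: upd)
    assume y: "y \<in> carrier (?Gs ! i)"
    show "?D (xs[i := x \<oplus>\<^bsub>?Gs ! i\<^esub> y]) = ?D (xs[i := x]) \<oplus>\<^bsub>F\<^esub> ?D (xs[i := y])"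
      using x y i j k Bcl multilinear_add[OF Bm b[OF xs j], of ?k x y]
        multilinear_add[OF Am Y[OF xs], of ?j "B ((?b ?j xs)[?k := x])" "B ((?b ?j xs)[?k := y])"]
      by (simp add: upd)
  qed (simp add: block_comp_def)
  have "multilinear_continuous ?Gs F (\<lambda>xs. A (?Y xs))"
  proof -
    let ?X = "product_topology (\<lambda>i. ntopology (?Gs ! i)) {..<r * m}"
    have B_cont: "continuous_map (product_topology (\<lambda>i. ntopology (replicate m G ! i)) {..<m}) (ntopology E)
        (\<lambda>x. B (map x [0..<m]))"
      using B by (simp add: multi_ops_iff multilinear_continuous_def)
    have A_cont: "continuous_map (product_topology (\<lambda>i. ntopology (replicate r E ! i)) {..<r}) (ntopology F)
        (\<lambda>x. A (map x [0..<r]))"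
      using A by (simp add: multi_ops_iff multilinear_continuous_def)
    have "continuous_map ?X (ntopology E) (\<lambda>x. B (?b j (map x [0..<r * m])))" if j: "j < r" for j
    proof -
      have lt: "j * m + i < r * m" if "i < m" for i
      proof -
        have "j * m + i < Suc j * m" using that by simp
        also have "\<dots> \<le> r * m" using j by (intro mult_le_mono1) simp
        finally show ?thesis .
      qed
      have "continuous_map ?X (ntopology (replicate m G ! i)) (\<lambda>x. x (j * m + i))" if "i < m" for i
        using continuous_map_product_projection[of "j * m + i" "{..<r * m}" "\<lambda>i. ntopology (?Gs ! i)"]
          that lt[OF that] by simp
      then have "continuous_map ?X (product_topology (\<lambda>i. ntopology (replicate m G ! i)) {..<m})
          (\<lambda>x. \<lambda>i\<in>{..<m}. x (j * m + i))"
        unfolding continuous_map_componentwise by auto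
      from continuous_map_compose[OF this B_cont]
      have "continuous_map ?X (ntopology E) (\<lambda>x. B (map (\<lambda>i\<in>{..<m}. x (j * m + i)) [0..<m]))"
        by (simp add: o_def)
      moreover have "map (\<lambda>i\<in>{..<m}. x (j * m + i)) [0..<m] = ?b j (map x [0..<r * m])"
        for x :: "nat \<Rightarrow> 'v"
      proof (rule nth_equalityI)
        show len: "length (map (\<lambda>i\<in>{..<m}. x (j * m + i)) [0..<m]) = length (?b j (map x [0..<r * m]))"
          using j by (simp add: length_block_uniform[where r = r])
        fix i assume "i < length (map (\<lambda>i\<in>{..<m}. x (j * m + i)) [0..<m])"
        then show "map (\<lambda>i\<in>{..<m}. x (j * m + i)) [0..<m] ! i = ?b j (map x [0..<r * m]) ! i"
          using j lt by (simp add: nth_block_uniform[where r = r])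
      qed
      ultimately show ?thesis by (simp only:)
    qed
    then have "continuous_map ?X (product_topology (\<lambda>i. ntopology (replicate r E ! i)) {..<r})
        (\<lambda>x. \<lambda>j\<in>{..<r}. B (?b j (map x [0..<r * m])))"
      unfolding continuous_map_componentwise by auto
    from continuous_map_compose[OF this A_cont]
    have "continuous_map ?X (ntopology F) (\<lambda>x. A (map (\<lambda>j\<in>{..<r}. B (?b j (map x [0..<r * m]))) [0..<r]))"
      by (simp add: o_def)
    moreover have "map (\<lambda>j\<in>{..<r}. B (?b j xs)) [0..<r] = ?Y xs" for xs :: "'v list"
      by (rule map_cong) auto
    ultimately show ?thesis by (simp add: multilinear_continuous_def)
  qed
  then show "multilinear_continuous ?Gs F ?D"
    by (simp add: block_comp_def GF.fam.multilinear_continuous_restrict)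
qed

lemma hat_block_comp:
  assumes x: "x \<in> carrier G"
  shows "block_comp (\<lambda>i. i * m) r (replicate (r * m) G) A (\<lambda>_. B) (replicate (r * m) x) =
    A (replicate r (B (replicate m x)))"
proof -
  have "map (\<lambda>i. B (block (\<lambda>i. i * m) i (replicate (r * m) x))) [0..<r] = replicate r (B (replicate m x))"
    by (rule nth_equalityI) (auto simp: block_replicate_uniform)
  then show ?thesis using x by (simp add: block_comp_def)
qed

section \<open>The scalar field as a Banach space\<close>

lemma scalar_space_simps [simp]:
  "carrier scalar_space = range Scalar" "\<zero>\<^bsub>scalar_space\<^esub> = Scalar 0"
  "x \<oplus>\<^bsub>scalar_space\<^esub> y = Scalar (scalar_of x + scalar_of y)"
  "a \<odot>\<^bsub>scalar_space\<^esub> x = Scalar (a * scalar_of x)" "vnorm scalar_space x = norm (scalar_of x)"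
  by (simp_all add: scalar_space_def)

lemma kspace_scalar: "kspace (scalar_space :: ('k::{banach,real_normed_field}, ('k, 'u) point) nspace)"
proof (rule kspace.intro)
  have "abelian_group (scalar_space :: ('k, ('k, 'u) point) nspace)"
  proof (rule abelian_groupI)
    fix x :: "('k, 'u) point" assume "x \<in> carrier scalar_space"
    then show "\<exists>y\<in>carrier scalar_space. y \<oplus>\<^bsub>scalar_space\<^esub> x = \<zero>\<^bsub>scalar_space\<^esub>"
      by (intro bexI[of _ "Scalar (- scalar_of x)"]) auto
  qed (auto simp: algebra_simps)
  then show "Module.module (ring_of_type_algebra :: 'k ring) (scalar_space :: ('k, ('k, 'u) point) nspace)"
    by (intro moduleI cring_from_type_algebra) (auto simp: ring_of_type_algebra_def algebra_simps)
qed

lemma ndist_scalar: "ndist scalar_space (Scalar a) (Scalar b) = dist a b"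
proof -
  interpret kspace scalar_space by (rule kspace_scalar)
  show ?thesis by (simp add: ndist_def a_minus_eq dist_norm)
qed

lemma banach_scalar: "banach_space (scalar_space :: ('k::{banach,real_normed_field}, ('k, 'u) point) nspace)"
proof -
  let ?K = "scalar_space :: ('k, ('k, 'u) point) nspace"
  interpret kspace ?K by (rule kspace_scalar)
  have N: "p_norm_on 1 ?K (carrier ?K) (vnorm ?K)"
    by (auto simp: p_norm_on_def norm_mult norm_triangle_ineq)
  have "Metric_space (carrier ?K) (p_dist 1 ?K (carrier ?K) (vnorm ?K))"
    by (rule Metric_space_p_dist[OF _ N]) (auto simp: submodule_iff)
  moreover have "p_dist 1 ?K (carrier ?K) (vnorm ?K) = ndist ?K"
    by (auto simp: p_dist_def ndist_def fun_eq_iff)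
  ultimately have "Metric_space (carrier ?K) (ndist ?K)" by simp
  then have "Metric_space.mcomplete (carrier ?K) (ndist ?K)"
    by (rule mcomplete_image[where A = UNIV and d = dist and f = Scalar, OF Met_TC.Metric_space_axioms])
      (auto simp: ndist_scalar complete_UNIV)
  then show ?thesis using N kspace by (simp add: banach_space_def)
qed

text \<open>
  Makes the operators \<open>\<lambda> \<mapsto> \<lambda> x\<close> and \<open>(\<lambda>\<^sub>1, \<dots>, \<lambda>\<^sub>n) \<mapsto> \<lambda>\<^sub>1 \<cdots> \<lambda>\<^sub>n\<close> of finite type, so that they belong to
  every hyper-ideal and are in particular continuous.
\<close>

lemma scalar_of_in_dual: "scalar_of \<in> dual (scalar_space :: ('k::{banach,real_normed_field}, ('k, 'u) point) nspace)"
proof -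
  let ?K = "scalar_space :: ('k, ('k, 'u) point) nspace"
  interpret banach_on ?K using banach_scalar by (rule banach_on.intro)
  have "continuous_map (Metric_space.mtopology (carrier ?K) (ndist ?K)) Met_TC.mtopology scalar_of"
    unfolding Metric_space.metric_continuous_map[OF Metric_space Met_TC.Metric_space_axioms]
    by (auto simp: ndist_scalar)
  then show ?thesis by (auto simp: dual_def ntopology_def)
qed

section \<open>The diagonals of a hyper-ideal\<close>

locale hyper_ideal =
  fixes p :: real and \<H> :: "('k::{banach,real_normed_field}, 'u) op_class" and \<nu> :: "('k, 'u) op_norm"
  assumes p_pos: "0 < p" and hyper_ideal: "p_normed_hyper_ideal p \<H> \<nu>"
begin

lemma \<H>_component:
  assumes "admissible Es F"
  shows \<H>_subset: "\<H> Es F \<subseteq> multi_ops Es F"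
    and \<H>_submodule: "submodule (\<H> Es F) (ring_of_type_algebra :: 'k ring) (multi_space Es F)"
    and \<H>_finite_type: "finite_type_op Es F A \<Longrightarrow> A \<in> \<H> Es F"
    and \<H>_norm: "p_norm_on p (multi_space Es F) (\<H> Es F) (\<nu> Es F)"
  using hyper_ideal assms by (auto simp: p_normed_hyper_ideal_def)

lemma \<nu>_nonneg: "admissible Es F \<Longrightarrow> A \<in> \<H> Es F \<Longrightarrow> 0 \<le> \<nu> Es F A"
  using \<H>_norm by (auto simp: p_norm_on_def)

lemma hyper_ideal_property:
  assumes "n \<ge> 1" "m 0 = 0" "\<And>i. i < n \<Longrightarrow> m i < m (Suc i)" "length Gs = m n" "length Es = n"
    "admissible Gs F" "admissible Es H" "\<And>i. i < n \<Longrightarrow> B i \<in> multi_ops (block m i Gs) (Es ! i)"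
    "t \<in> multi_ops [F] H" "A \<in> \<H> Es F"
  shows "post_comp Gs t (block_comp m n Gs A B) \<in> \<H> Gs H"
    and "\<nu> Gs H (post_comp Gs t (block_comp m n Gs A B)) \<le> vnorm (multi_space [F] H) t * \<nu> Es F A *
          (\<Prod>i<n. vnorm (multi_space (block m i Gs) (Es ! i)) (B i))"
  using hyper_ideal[unfolded p_normed_hyper_ideal_def, THEN conjunct2, THEN conjunct2,
      rule_format, of n m Gs Es F H B t A] assms by blast+

text \<open>
  The hyper-ideal inequality for \<open>t\<close> the identity, with upper bounds \<open>K i\<close> in place of the norms
  of the inner operators.
\<close>

lemma block_comp_in_\<H>:
  assumes n: "n \<ge> 1" and m: "m 0 = 0" "\<And>i. i < n \<Longrightarrow> m i < m (Suc i)"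
    and len: "length Gs = m n" "length Es = n"
    and Gs: "admissible Gs F" and Es: "admissible Es F"
    and B: "\<And>i. i < n \<Longrightarrow> B i \<in> multi_ops (block m i Gs) (Es ! i)" and A: "A \<in> \<H> Es F"
    and K: "\<And>i xs. i < n \<Longrightarrow> xs \<in> tuples (block m i Gs) \<Longrightarrow>
      (\<And>j. j < length (block m i Gs) \<Longrightarrow> vnorm (block m i Gs ! j) (xs ! j) \<le> 1) \<Longrightarrow>
      vnorm (Es ! i) (B i xs) \<le> K i"
  shows "block_comp m n Gs A B \<in> \<H> Gs F"
    and "\<nu> Gs F (block_comp m n Gs A B) \<le> \<nu> Es F A * (\<Prod>i<n. K i)"
proof -
  let ?t = "\<lambda>xs\<in>tuples [F]. hd xs"
  have F: "banach_space F" using Gs by (simp add: admissible_def)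
  interpret F: banach_on F using F by (rule banach_on.intro)
  interpret FF: banach_family "[F]" F using F by unfold_locales auto
  have "multilinear [F] F ?t"
    by (rule multilinearI) (auto simp: tuples_singleton)
  moreover have "multilinear_continuous [F] F hd"
    using continuous_map_product_projection[of 0 "{..<1}" "\<lambda>i. ntopology ([F] ! i)"]
    by (simp add: multilinear_continuous_def)
  ultimately have t: "?t \<in> multi_ops [F] F"
    by (simp add: multi_ops_iff FF.multilinear_continuous_restrict)
  have t_norm: "vnorm (multi_space [F] F) ?t \<le> 1"
    using F by (intro multi_norm_le) (auto simp: tuples_singleton)
  have banach_block: "banach_space E" if "E \<in> set (block m i Gs)" for i E
    using that set_block_subset[of m i Gs] Gs by (auto simp: admissible_def)
  have Es_i: "banach_space (Es ! i)" if "i < n" for i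
    using Es that len by (auto simp: admissible_def)
  have Bm: "multilinear (block m i Gs) (Es ! i) (B i)" if "i < n" for i
    using B[OF that] by (simp add: multi_ops_iff)
  have closed: "block_comp m n Gs A B xs \<in> carrier F" if "xs \<in> tuples Gs" for xs
  proof -
    have "map (\<lambda>i. B i (block m i xs)) [0..<n] \<in> tuples Es"
      using multilinear_closed[OF Bm] block_in_tuples[OF that] len by (intro map_in_tuples) auto
    moreover have "multilinear Es F A" using \<H>_subset[OF Es] A by (auto simp: multi_ops_iff)
    ultimately show ?thesis using that by (simp add: block_comp_def multilinear_closed)
  qed
  have "post_comp Gs ?t (block_comp m n Gs A B) = block_comp m n Gs A B"
  proof
    fix xs show "post_comp Gs ?t (block_comp m n Gs A B) xs = block_comp m n Gs A B xs"
      using closed[of xs] by (cases "xs \<in> tuples Gs") (auto simp: post_comp_def tuples_singleton block_comp_def)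
  qed
  note * = hyper_ideal_property[OF n m len Gs Es B t A, unfolded this]
  show "block_comp m n Gs A B \<in> \<H> Gs F" by (rule *)
  let ?v = "\<lambda>i. vnorm (multi_space (block m i Gs) (Es ! i)) (B i)"
  have v: "0 \<le> ?v i" "?v i \<le> K i" if i: "i < n" for i
    by (rule multi_norm_nonneg[OF banach_block Es_i[OF i] Bm[OF i] K[OF i]], assumption+)
      (rule multi_norm_le[OF banach_block K[OF i]], assumption+)
  have prod: "0 \<le> (\<Prod>i<n. ?v i)" "(\<Prod>i<n. ?v i) \<le> (\<Prod>i<n. K i)"
    by (rule prod_nonneg, simp add: v) (rule prod_mono, simp add: v)
  note *(2)
  also have "vnorm (multi_space [F] F) ?t * \<nu> Es F A *
      (\<Prod>i<n. ?v i) \<le> 1 * \<nu> Es F A * (\<Prod>i<n. K i)"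
    using t_norm \<nu>_nonneg[OF Es A] prod by (intro mult_mono mult_nonneg_nonneg) auto
  finally show "\<nu> Gs F (block_comp m n Gs A B) \<le> \<nu> Es F A * (\<Prod>i<n. K i)" by simp
qed

lemma admissible_replicate:
  "n \<ge> 1 \<Longrightarrow> banach_space E \<Longrightarrow> banach_space F \<Longrightarrow> admissible (replicate n E) F"
  by (auto simp: admissible_def)

lemma scalar_product_op_in_\<H>:
  assumes "n \<ge> 1"
  shows "scalar_product_op n \<in> \<H> (replicate n scalar_space) scalar_space"
proof (rule \<H>_finite_type)
  interpret banach_on "scalar_space :: ('k, 'u) space" using banach_scalar by (rule banach_on.intro)
  show "finite_type_op (replicate n scalar_space) scalar_space (scalar_product_op n :: ('k, 'u) mop)"
    unfolding finite_type_op_def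
    using scalar_of_in_dual
    by (intro exI[of _ 1] exI[of _ "\<lambda>_ _. scalar_of"] exI[of _ "\<lambda>_. Scalar 1"])
      (auto simp: scalar_product_op_def lessThan_Suc finsum_insert intro!: restrict_ext)
qed (use assms banach_scalar in \<open>auto simp: admissible_def\<close>)

lemma scalar_line_in_multi_ops:
  fixes E :: "('k, 'u) space"
  assumes E: "banach_space E" and x: "x \<in> carrier E"
  shows "(\<lambda>xs\<in>tuples [scalar_space]. scalar_of (xs ! 0) \<odot>\<^bsub>E\<^esub> x) \<in> multi_ops [scalar_space] E"
proof -
  interpret banach_on E using E by (rule banach_on.intro)
  have adm: "admissible [scalar_space] E" using E banach_scalar by (simp add: admissible_def)
  have "finite_type_op [scalar_space] E (\<lambda>xs\<in>tuples [scalar_space]. scalar_of (xs ! 0) \<odot>\<^bsub>E\<^esub> x)"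
    unfolding finite_type_op_def
    using scalar_of_in_dual x
    by (intro exI[of _ 1] exI[of _ "\<lambda>_ _. scalar_of"] exI[of _ "\<lambda>_. x"])
      (auto simp: lessThan_Suc finsum_insert intro!: restrict_ext)
  then show ?thesis using \<H>_finite_type[OF adm] \<H>_subset[OF adm] by blast
qed

text \<open>
  Restricting all variables of \<open>A\<close> to the line through \<open>x\<close> gives
  \<open>(\<lambda>\<^sub>1, \<dots>, \<lambda>\<^sub>n) \<mapsto> \<lambda>\<^sub>1 \<cdots> \<lambda>\<^sub>n P(x)\<close>, where \<open>P\<close> is the diagonal of \<open>A\<close>. This element of \<open>\<H>\<close> is the
  same for all operators \<open>A\<close> with diagonal \<open>P\<close>, while the hyper-ideal inequality bounds its norm by that of \<open>A\<close>.
\<close>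

lemma restrict_to_line:
  assumes n: "n \<ge> 1" and E: "banach_space E" and F: "banach_space F"
    and A: "A \<in> \<H> (replicate n E) F" and x: "x \<in> carrier E"
  defines "U \<equiv> \<lambda>xs\<in>tuples (replicate n scalar_space). (\<Prod>i<n. scalar_of (xs ! i)) \<odot>\<^bsub>F\<^esub> hat n E A x"
  shows "U \<in> \<H> (replicate n scalar_space) F"
    and "\<nu> (replicate n scalar_space) F U \<le> \<nu> (replicate n E) F A * vnorm E x ^ n"
proof -
  interpret banach_pair E F using E F by (simp add: banach_pair_def banach_on_def)
  let ?K = "scalar_space :: ('k, 'u) space"
  let ?B = "\<lambda>xs\<in>tuples [?K]. scalar_of (xs ! 0) \<odot>\<^bsub>E\<^esub> x"
  have adm: "admissible (replicate n ?K) F" "admissible (replicate n E) F"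
    using n E F banach_scalar by (auto simp: admissible_def)
  have block: "block (\<lambda>i. i) i xs = [xs ! i]" if "i < length xs" for i and xs :: "'z list"
    using that by (simp add: block_def take_Suc_conv_app_nth)
  have Am: "multilinear (replicate n E) F A" using \<H>_subset[OF adm(2)] A by (auto simp: multi_ops_iff)
  have "block_comp (\<lambda>i. i) n (replicate n ?K) A (\<lambda>_. ?B) = U"
    unfolding block_comp_def U_def
  proof (rule restrict_ext)
    fix xs assume xs: "xs \<in> tuples (replicate n ?K)"
    then have "map (\<lambda>i. ?B (block (\<lambda>i. i) i xs)) [0..<n] =
        map (\<lambda>i. scalar_of (xs ! i) \<odot>\<^bsub>replicate n E ! i\<^esub> x) [0..<n]"
      by (intro map_cong refl) (auto simp: block tuples_iff tuples_singleton)
    also have "A \<dots> = (\<Prod>i<n. scalar_of (xs ! i)) \<odot>\<^bsub>F\<^esub> A (map (\<lambda>_. x) [0..<n])"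
      using x by (intro fam.multilinear_homogeneous[OF Am]) auto
    also have "A (map (\<lambda>_. x) [0..<n]) = hat n E A x"
      using x by (simp add: hat_def map_replicate_const)
    finally show "A (map (\<lambda>i. ?B (block (\<lambda>i. i) i xs)) [0..<n]) =
      (\<Prod>i<n. scalar_of (xs ! i)) \<odot>\<^bsub>F\<^esub> hat n E A x" .
  qed
  moreover have "vnorm E (?B xs) \<le> vnorm E x" if "xs \<in> tuples [?K]" "vnorm ?K (xs ! 0) \<le> 1" for xs
    using that x E.norm_nonneg[OF x] by (auto simp: tuples_singleton E.norm_smult mult_left_le_one_le)
  ultimately show "U \<in> \<H> (replicate n ?K) F"
    "\<nu> (replicate n ?K) F U \<le> \<nu> (replicate n E) F A * vnorm E x ^ n"
    using block_comp_in_\<H>[OF n _ _ _ _ adm, of "\<lambda>i. i" "\<lambda>_. ?B" A "\<lambda>_. vnorm E x"]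
      scalar_line_in_multi_ops[OF E x] A by (simp_all add: block)
qed

lemma poly_upper_eq:
  assumes "n \<ge> 1" "banach_space E" "banach_space F"
  shows "poly_upper \<H> n E F = hat n E ` \<H> (replicate n E) F"
proof -
  interpret banach_pair E F using assms by (simp add: banach_pair_def banach_on_def)
  show ?thesis
    using \<H>_subset[OF admissible_replicate[OF assms]] hat_in_polys by (auto simp: poly_upper_def)
qed

text \<open>
  The point is separation. If the representatives \<open>A\<close> of \<open>P\<close> have arbitrarily small norm, then the
  norm of the operator from \<open>restrict_to_line\<close> is zero for every \<open>x\<close>. As \<open>\<nu>\<close> is a
  \<open>p\<close>-norm, the operator is zero, and its value at \<open>(1, \<dots>, 1)\<close> is \<open>P(x)\<close>.
\<close>

lemma quotient_norm_poly_upper: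
  assumes n: "n \<ge> 1" and E: "banach_space E" and F: "banach_space F"
  shows "quotient_norm (multi_space (replicate n E) F) (poly_space n E F) p (\<H> (replicate n E) F)
    (hat n E) (\<nu> (replicate n E) F) (poly_upper_norm \<H> \<nu> n E F)"
proof -
  interpret banach_pair E F using E F by (simp add: banach_pair_def banach_on_def)
  note adm = admissible_replicate[OF n E F]
  let ?H = "\<H> (replicate n E) F"
  have M_eq: "poly_upper_norm \<H> \<nu> n E F P = Inf (\<nu> (replicate n E) F ` {A \<in> ?H. hat n E A = P})" for P
    unfolding poly_upper_norm_def by (rule arg_cong[where f = Inf]) auto
  show ?thesis
  proof (intro quotient_norm.intro quotient_norm_axioms.intro)
    fix P assume P: "P \<in> hat n E ` ?H" and P0: "poly_upper_norm \<H> \<nu> n E F P = 0"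
    show "P = \<zero>\<^bsub>poly_space n E F\<^esub>"
    proof
      fix x
      show "P x = \<zero>\<^bsub>poly_space n E F\<^esub> x"
      proof (cases "x \<in> carrier E")
        case x: True
        let ?U = "\<lambda>xs\<in>tuples (replicate n scalar_space). (\<Prod>i<n. scalar_of (xs ! i)) \<odot>\<^bsub>F\<^esub> P x"
        let ?\<nu> = "\<nu> (replicate n scalar_space) F"
        have adm': "admissible (replicate n scalar_space) F"
          using n F banach_scalar by (auto simp: admissible_def)
        have U: "?U \<in> \<H> (replicate n scalar_space) F"
          using P restrict_to_line(1)[OF n E F _ x] by auto
        have "?\<nu> ?U \<le> poly_upper_norm \<H> \<nu> n E F P * vnorm E x ^ n"
          unfolding M_eq
        proof (rule le_at_Inf[where g = "\<lambda>t. t * vnorm E x ^ n"])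
          show "\<nu> (replicate n E) F ` {A \<in> ?H. hat n E A = P} \<subseteq> {0..}"
            using \<nu>_nonneg[OF adm] by auto
          show "?\<nu> ?U \<le> t * vnorm E x ^ n" if t: "t \<in> \<nu> (replicate n E) F ` {A \<in> ?H. hat n E A = P}" for t
          proof -
            obtain A where "A \<in> ?H" "hat n E A = P" "t = \<nu> (replicate n E) F A" using t by blast
            then show ?thesis using restrict_to_line(2)[OF n E F _ x, of A] by simp
          qed
        qed (use P in \<open>auto intro!: continuous_intros\<close>)
        then have "?\<nu> ?U = 0" using \<nu>_nonneg[OF adm' U] P0 by simp
        then have "?U = \<zero>\<^bsub>multi_space (replicate n scalar_space) F\<^esub>"
          using \<H>_norm[OF adm'] U by (simp add: p_norm_on_def)
        from fun_cong[OF this, of "replicate n (Scalar 1)"]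
        have "1 \<odot>\<^bsub>F\<^esub> P x = \<zero>\<^bsub>F\<^esub>"
          by (simp add: multi_space_simps)
        moreover have "P x \<in> carrier F"
        proof (rule poly_closed[OF _ x])
          show "P \<in> polys n E F" using P \<H>_subset[OF adm] hat_in_polys by auto
        qed
        ultimately show ?thesis using x by (simp add: poly_space_simps)
      next
        case False
        then show ?thesis using P by (auto simp: hat_def poly_space_simps)
      qed
    qed
  next
    fix A assume A: "A \<in> ?H"
    then show "hat n E A \<in> polys n E F" using \<H>_subset[OF adm] hat_in_polys by blast
  qed (rule p_pos M_eq \<H>_norm[OF adm] \<H>_submodule[OF adm] hat_zero hat_plus hat_scale
      fam.M.kspace_axioms P.kspace_axioms)+
qed

text \<open>
  By multilinearity an operator on copies of the scalar field is determined by its value at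
  \<open>(1, \<dots>, 1)\<close>, hence by its diagonal: the infimum runs over one operator only.
\<close>

lemma poly_upper_norm_scalar_product:
  assumes n: "n \<ge> 1"
  shows "poly_upper_norm \<H> \<nu> n scalar_space scalar_space (hat n scalar_space (scalar_product_op n)) = 1"
proof -
  let ?K = "scalar_space :: ('k, 'u) space"
  let ?I = "scalar_product_op n :: ('k, 'u) mop"
  let ?H = "\<H> (replicate n ?K) ?K"
  interpret banach_pair ?K ?K using banach_scalar by (simp add: banach_pair_def banach_on_def)
  note adm = admissible_replicate[OF n banach_scalar banach_scalar]
  have unique: "A = ?I" if A: "A \<in> ?H" and hat: "hat n ?K ?I = hat n ?K A" for A
  proof
    fix xs
    have Am: "multilinear (replicate n ?K) ?K A" using \<H>_subset[OF adm] A by (auto simp: multi_ops_iff)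
    show "A xs = ?I xs"
    proof (cases "xs \<in> tuples (replicate n ?K)")
      case True
      then have "xs = map (\<lambda>j. scalar_of (xs ! j) \<odot>\<^bsub>replicate n ?K ! j\<^esub> Scalar 1) [0..<n]"
        by (intro nth_equalityI) (auto simp: tuples_iff)
      then have "A xs = A (map (\<lambda>j. scalar_of (xs ! j) \<odot>\<^bsub>replicate n ?K ! j\<^esub> Scalar 1) [0..<n])"
        by simp
      also have "\<dots> = (\<Prod>j<n. scalar_of (xs ! j)) \<odot>\<^bsub>?K\<^esub> A (map (\<lambda>_. Scalar 1) [0..<n])"
        by (intro fam.multilinear_homogeneous[OF Am]) auto
      also have "A (map (\<lambda>_. Scalar 1) [0..<n]) = hat n ?K A (Scalar 1)"
        by (simp add: hat_def map_replicate_const)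
      also have "\<dots> = Scalar 1"
        unfolding hat[symmetric] by (simp add: hat_def scalar_product_op_def)
      finally show ?thesis using True by (simp add: scalar_product_op_def)
    next
      case False
      then show ?thesis using multilinear_ext[OF Am] by (simp add: scalar_product_op_def extensional_def)
    qed
  qed
  have "{\<nu> (replicate n ?K) ?K A | A. A \<in> ?H \<and> hat n ?K ?I = hat n ?K A} = {\<nu> (replicate n ?K) ?K ?I}"
    using unique scalar_product_op_in_\<H>[OF n] by (intro equalityI subsetI) (clarsimp, blast)+
  then show ?thesis
    using hyper_ideal n by (simp add: poly_upper_norm_def p_normed_hyper_ideal_def)
qed

text \<open>
  \<open>x \<mapsto> \<phi>(x)^n y\<close> is the diagonal of \<open>(x\<^sub>1, \<dots>, x\<^sub>n) \<mapsto> \<phi>(x\<^sub>1) \<cdots> \<phi>(x\<^sub>n) y\<close>.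
\<close>

lemma finite_type_poly_upper:
  assumes n: "n \<ge> 1" and E: "banach_space E" and F: "banach_space F" and P: "finite_type_poly n E F P"
  shows "P \<in> poly_upper \<H> n E F"
proof -
  obtain N :: nat and \<phi> y where \<phi>: "\<And>j. j < N \<Longrightarrow> \<phi> j \<in> dual E \<and> y j \<in> carrier F"
    and P_eq: "P = (\<lambda>x\<in>carrier E. \<Oplus>\<^bsub>F\<^esub>j\<in>{..<N}. (\<phi> j x ^ n) \<odot>\<^bsub>F\<^esub> y j)"
    using P by (auto simp: finite_type_poly_def)
  interpret banach_pair E F using E F by (simp add: banach_pair_def banach_on_def)
  let ?A = "\<lambda>xs\<in>tuples (replicate n E). \<Oplus>\<^bsub>F\<^esub>j\<in>{..<N}. (\<Prod>i<n. \<phi> j (xs ! i)) \<odot>\<^bsub>F\<^esub> y j"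
  have "finite_type_op (replicate n E) F ?A"
    unfolding finite_type_op_def
    using \<phi> by (intro exI[of _ N] exI[of _ "\<lambda>j i. \<phi> j"] exI[of _ y]) auto
  then have "?A \<in> \<H> (replicate n E) F" by (rule \<H>_finite_type[OF admissible_replicate[OF n E F]])
  moreover have "P = hat n E ?A"
  proof -
    have "(\<Prod>i<n. \<phi> j (replicate n x ! i)) = \<phi> j x ^ n" for j x
      by (simp add: prod.cong[of _ _ _ "\<lambda>_. \<phi> j x"])
    then show ?thesis by (simp add: P_eq hat_def cong: restrict_cong)
  qed
  ultimately show ?thesis by (simp add: poly_upper_eq[OF n E F])
qed

end

section \<open>Composition with polynomials\<close>

locale L_hyper_ideal = hyper_ideal +
  assumes L_sub: "\<And>Es F. admissible Es F \<Longrightarrow> L_comp \<H> Es F \<subseteq> \<H> Es F"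
    and L_norm: "\<And>Es F A. admissible Es F \<Longrightarrow> A \<in> L_comp \<H> Es F \<Longrightarrow> \<nu> Es F A \<le> L_comp_norm \<H> \<nu> Es F A"
begin

text \<open>
  An infimum of reals is a lower bound only for sets that are bounded below, so the work lies in the
  nonnegativity of the contribution of every factorization. Since the list of domains is nonempty,
  blocks have positive length and there is at least one block.
\<close>

lemma L_comp_norm_le:
  assumes adm: "admissible Es F" and fac: "L_factorization \<H> Es F A m r G B C"
  shows "L_comp_norm \<H> \<nu> Es F A \<le>
    vnorm (multi_space (replicate r G) F) C * (\<Prod>j<r. \<nu> (block (\<lambda>i. i * m) j Es) G (B j))"
  unfolding L_comp_norm_def
proof (rule cInf_lower)
  show "bdd_below {vnorm (multi_space (replicate r G) F) C * (\<Prod>j<r. \<nu> (block (\<lambda>i. i * m) j Es) G (B j)) |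
      m r G B C. L_factorization \<H> Es F A m r G B C}"
  proof (rule bdd_belowI[of _ 0], clarify)
    fix m r G B C assume f: "L_factorization \<H> Es F A m r G B C"
    have "Es \<noteq> []" using adm by (simp add: admissible_def)
    with f have "m * r \<noteq> 0" by (simp add: L_factorization_def)
    then have len: "length Es = r * m" "r \<ge> 1" "m \<ge> 1"
      using f by (simp_all add: L_factorization_def mult.commute Suc_le_eq)
    from f have G: "banach_space G"
      and C: "C \<in> sym_ops r G F" and B: "\<And>j. j < r \<Longrightarrow> B j \<in> \<H> (block (\<lambda>i. i * m) j Es) G"
      by (simp_all add: L_factorization_def)
    interpret banach_pair G F using G adm by (simp add: banach_pair_def banach_on_def admissible_def)
    have "admissible (block (\<lambda>i. i * m) j Es) G" if "j < r" for j
      using length_block_uniform[OF len(1) that] len(3) set_block_subset[of "\<lambda>i. i * m" j Es] adm G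
      by (auto simp: admissible_def)
    then show "0 \<le> vnorm (multi_space (replicate r G) F) C * (\<Prod>j<r. \<nu> (block (\<lambda>i. i * m) j Es) G (B j))"
      using sym_op_norm_nonneg[OF C len(2)] \<nu>_nonneg B by (intro mult_nonneg_nonneg prod_nonneg) auto
  qed
qed (use fac in blast)

text \<open>
  With \<open>q\<close> and \<open>R'\<close> the symmetric operators of \<open>Q\<close> and \<open>R\<close>, the composition is the
  diagonal of \<open>D = R' \<circ> (B, \<dots>, B)\<close> for \<open>B = A \<circ> (q, \<dots>, q)\<close>. The hyper-ideal inequality
  bounds the norm of \<open>B\<close>, the hypothesis on \<open>L \<circ> \<H>\<close> that of \<open>D\<close>, and
  polarization contributes the constants for \<open>q\<close> and \<open>R'\<close>.
\<close>

lemma composition_estimate: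
  assumes n: "n \<ge> 1" and m: "m \<ge> 1" and r: "r \<ge> 1"
    and G: "banach_space G" and E: "banach_space E" and F: "banach_space F" and H: "banach_space H"
    and A: "A \<in> \<H> (replicate n E) F" and Q: "Q \<in> polys m G E" and R: "R \<in> polys r F H"
  shows "\<exists>D\<in>\<H> (replicate (r * m * n) G) H.
    hat (r * m * n) G D = (\<lambda>x\<in>carrier G. R (hat n E A (Q x))) \<and>
    \<nu> (replicate (r * m * n) G) H D \<le> real r ^ r / fact r * vnorm (poly_space r F H) R *
      (\<nu> (replicate n E) F A * (real m ^ m / fact m * vnorm (poly_space m G E) Q) ^ n) ^ r"
proof -
  interpret GE: banach_pair G E using G E by (simp add: banach_pair_def banach_on_def)
  interpret FH: banach_pair F H using F H by (simp add: banach_pair_def banach_on_def)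
  interpret EF: banach_pair E F using E F by (simp add: banach_pair_def banach_on_def)
  let ?q = "polar m G E Q" and ?R = "polar r F H R"
  let ?Q = "real m ^ m / fact m * vnorm (poly_space m G E) Q"
  let ?B = "block_comp (\<lambda>i. i * m) n (replicate (n * m) G) A (\<lambda>_. ?q)"
  let ?D = "block_comp (\<lambda>i. i * (n * m)) r (replicate (r * (n * m)) G) ?R (\<lambda>_. ?B)"
  have nm: "n * m \<ge> 1" "r * (n * m) \<ge> 1" using n m r by simp_all
  note q = GE.polar_in_sym_ops[OF Q] and R' = FH.polar_in_sym_ops[OF R]
  note admB = admissible_replicate[OF nm(1) G F] and admD = admissible_replicate[OF nm(2) G H]
  have q_multi: "?q \<in> multi_ops (replicate m G) E" using q(1) by (simp add: sym_ops_def)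
  have B: "?B \<in> \<H> (replicate (n * m) G) F"
    "\<nu> (replicate (n * m) G) F ?B \<le> \<nu> (replicate n E) F A * ?Q ^ n"
    using block_comp_in_\<H>[OF n _ _ _ _ admB admissible_replicate[OF n E F] _ A,
        of "\<lambda>i. i * m" "\<lambda>_. ?q" "\<lambda>_. ?Q"] GE.sym_op_bound[OF q(1) m] q_multi m
    by (simp_all add: q(2) block_replicate_uniform)
  have "?D \<in> multi_ops (replicate (r * (n * m)) G) H"
    using R' B \<H>_subset[OF admB]
    by (intro block_comp_in_multi_ops[OF G F H _ _ nm(1)]) (auto simp: sym_ops_def)
  moreover have fac: "L_factorization \<H> (replicate (r * (n * m)) G) H ?D (n * m) r F (\<lambda>_. ?B) ?R"
    unfolding L_factorization_def
    using F B(1) R'(1) by (simp add: block_replicate_uniform)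
  ultimately have D: "?D \<in> L_comp \<H> (replicate (r * (n * m)) G) H"
    unfolding L_comp_def mem_Collect_eq by (intro conjI exI)
  have "\<nu> (replicate (r * (n * m)) G) H ?D \<le> vnorm (multi_space (replicate r F) H) ?R *
      (\<Prod>j<r. \<nu> (block (\<lambda>i. i * (n * m)) j (replicate (r * (n * m)) G)) F ?B)"
    using L_norm[OF admD D] L_comp_norm_le[OF admD fac] by linarith
  also have "\<dots> = vnorm (multi_space (replicate r F) H) ?R * \<nu> (replicate (n * m) G) F ?B ^ r"
    by (simp add: block_replicate_uniform)
  also have "\<dots> \<le> (real r ^ r / fact r * vnorm (poly_space r F H) R) *
      (\<nu> (replicate n E) F A * ?Q ^ n) ^ r"
    using FH.polar_norm_le[OF R r] FH.poly_norm_nonneg[OF R r] B(2) \<nu>_nonneg[OF admB B(1)]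
    by (intro mult_mono power_mono) auto
  finally have \<nu>D: "\<nu> (replicate (r * (n * m)) G) H ?D \<le> real r ^ r / fact r * vnorm (poly_space r F H) R *
      (\<nu> (replicate n E) F A * ?Q ^ n) ^ r" .
  have hatD: "hat (r * (n * m)) G ?D = (\<lambda>x\<in>carrier G. R (hat n E A (Q x)))"
    unfolding hat_def
  proof (rule restrict_ext)
    fix x assume x: "x \<in> carrier G"
    have "?q (replicate m x) = Q x"
      using x q(2) by (auto simp: hat_def dest: fun_cong[where x = x])
    then have "?B (replicate (n * m) x) = hat n E A (Q x)"
      using x GE.poly_closed[OF Q x] by (simp add: hat_block_comp hat_def)
    moreover have "hat n E A (Q x) \<in> carrier F"
      using A \<H>_subset[OF admissible_replicate[OF n E F]]
      by (intro EF.poly_closed[OF EF.hat_in_polys] GE.poly_closed[OF Q x]) blast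
    moreover from this have "?R (replicate r (hat n E A (Q x))) = R (hat n E A (Q x))"
      using R'(2) by (auto simp: hat_def[of r] dest: fun_cong[where x = "hat n E A (Q x)"])
    ultimately show "?D (replicate (r * (n * m)) x) = R ((\<lambda>x\<in>carrier E. A (replicate n x)) (Q x))"
      using x by (simp add: hat_block_comp) (simp add: hat_def)
  qed
  have eq: "r * m * n = r * (n * m)" by simp
  show ?thesis
    unfolding eq by (intro bexI[of _ ?D] conjI hatD \<nu>D subsetD[OF L_sub[OF admD] D])
qed

text \<open>
  For the composition inequality, \<open>composition_estimate\<close> is applied to every representative \<open>A\<close> of
  \<open>P\<close>; its right-hand side is a continuous function of the norm of \<open>A\<close>, so the
  infimum over \<open>A\<close> may be taken.
\<close>

lemma poly_upper_two_sided_ideal: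
  fixes c defines "c \<equiv> \<lambda>n. real n ^ n / fact n"
  shows "p_normed_two_sided_ideal p c c (poly_upper \<H>) (poly_upper_norm \<H> \<nu>)"
  unfolding p_normed_two_sided_ideal_def
proof (intro conjI allI impI)
  show "two_sided_ideal_constants c" "two_sided_ideal_constants c"
  proof -
    have "fact n \<le> real n ^ n" for n
      using fact_le_power[of n, where ?'a = real] by simp
    then show "two_sided_ideal_constants c" by (auto simp: two_sided_ideal_constants_def c_def)
    then show "two_sided_ideal_constants c" .
  qed
next
  fix n :: nat and E F :: "('a, 'b) space"
  assume n: "1 \<le> n" and EF: "banach_space E \<and> banach_space F"
  then have E: "banach_space E" and F: "banach_space F" by auto
  interpret quotient_norm "multi_space (replicate n E) F" "poly_space n E F" p
    "\<H> (replicate n E) F" "hat n E" "\<nu> (replicate n E) F" "poly_upper_norm \<H> \<nu> n E F"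
    by (rule quotient_norm_poly_upper[OF n E F])
  show "poly_upper \<H> n E F \<subseteq> polys n E F" by (auto simp: poly_upper_def)
  show "submodule (poly_upper \<H> n E F) (ring_of_type_algebra :: 'a ring) (poly_space n E F)"
    using submodule_image by (simp add: poly_upper_eq[OF n E F])
  show "{P. finite_type_poly n E F P} \<subseteq> poly_upper \<H> n E F"
    using finite_type_poly_upper[OF n E F] by blast
  show "p_norm_on p (poly_space n E F) (poly_upper \<H> n E F) (poly_upper_norm \<H> \<nu> n E F)"
    using p_norm_image by (simp add: poly_upper_eq[OF n E F])
next
  fix n :: nat assume "1 \<le> n"
  then show "poly_upper_norm \<H> \<nu> n scalar_space scalar_space (hat n scalar_space (scalar_product_op n)) = 1"
    by (rule poly_upper_norm_scalar_product)
next
  fix m n r :: nat and G E F H :: "('a, 'b) space" and P Q R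
  assume "m \<ge> 1 \<and> n \<ge> 1 \<and> r \<ge> 1 \<and>
    banach_space G \<and> banach_space E \<and> banach_space F \<and> banach_space H \<and>
    P \<in> poly_upper \<H> n E F \<and> Q \<in> polys m G E \<and> R \<in> polys r F H"
  then have n: "n \<ge> 1" and m: "m \<ge> 1" and r: "r \<ge> 1"
    and G: "banach_space G" and E: "banach_space E" and F: "banach_space F" and H: "banach_space H"
    and P: "P \<in> hat n E ` \<H> (replicate n E) F" and Q: "Q \<in> polys m G E" and R: "R \<in> polys r F H"
    using poly_upper_eq by auto
  have rmn: "r * m * n \<ge> 1" using n m r by simp
  interpret P: quotient_norm "multi_space (replicate n E) F" "poly_space n E F" p
    "\<H> (replicate n E) F" "hat n E" "\<nu> (replicate n E) F" "poly_upper_norm \<H> \<nu> n E F"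
    by (rule quotient_norm_poly_upper[OF n E F])
  interpret RPQ: quotient_norm "multi_space (replicate (r * m * n) G) H" "poly_space (r * m * n) G H" p
    "\<H> (replicate (r * m * n) G) H" "hat (r * m * n) G" "\<nu> (replicate (r * m * n) G) H"
    "poly_upper_norm \<H> \<nu> (r * m * n) G H"
    by (rule quotient_norm_poly_upper[OF rmn G H])
  let ?S = "\<lambda>x\<in>carrier G. R (P (Q x))"
  let ?Q = "c m * vnorm (poly_space m G E) Q"
  note est = composition_estimate[OF n m r G E F H _ Q R]
  show "?S \<in> poly_upper \<H> (r * m * n) G H"
  proof -
    obtain A where A: "A \<in> \<H> (replicate n E) F" "P = hat n E A" using P by blast
    with est[OF A(1)] obtain D where "D \<in> \<H> (replicate (r * m * n) G) H" "hat (r * m * n) G D = ?S"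
      by blast
    then show ?thesis unfolding poly_upper_eq[OF rmn G H] by (metis imageI)
  qed
  have "poly_upper_norm \<H> \<nu> (r * m * n) G H ?S \<le>
      c r * vnorm (poly_space r F H) R * (poly_upper_norm \<H> \<nu> n E F P * ?Q ^ n) ^ r"
  proof (rule P.le_at_M[OF P, where g = "\<lambda>t. c r * vnorm (poly_space r F H) R * (t * ?Q ^ n) ^ r"])
    fix A assume A: "A \<in> \<H> (replicate n E) F" "hat n E A = P"
    from est[OF A(1)] obtain D where D: "D \<in> \<H> (replicate (r * m * n) G) H" "hat (r * m * n) G D = ?S"
      "\<nu> (replicate (r * m * n) G) H D \<le>
        c r * vnorm (poly_space r F H) R * (\<nu> (replicate n E) F A * ?Q ^ n) ^ r"
      unfolding A(2) c_def by blast
    then show "poly_upper_norm \<H> \<nu> (r * m * n) G H ?S \<le>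
        c r * vnorm (poly_space r F H) R * (\<nu> (replicate n E) F A * ?Q ^ n) ^ r"
      using RPQ.M_le[OF D(1)] by simp
  qed (intro continuous_intros)
  also have "\<dots> = c r * c m ^ (r * n) * vnorm (poly_space r F H) R * poly_upper_norm \<H> \<nu> n E F P ^ r *
      vnorm (poly_space m G E) Q ^ (r * n)"
  proof -
    have "(M * (C * q) ^ n) ^ r = M ^ r * (C ^ (r * n) * q ^ (r * n))" for M C q :: real
      by (simp only: power_mult_distrib power_mult[symmetric] mult.commute[of r n])
    then show ?thesis by (simp only: mult_ac)
  qed
  finally show "poly_upper_norm \<H> \<nu> (r * m * n) G H ?S \<le>
      c r * c m ^ (r * n) * vnorm (poly_space r F H) R * poly_upper_norm \<H> \<nu> n E F P ^ r *
      vnorm (poly_space m G E) Q ^ (r * n)" .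
qed

lemma poly_upper_complete:
  assumes B: "p_Banach_hyper_ideal p \<H> \<nu>" and n: "n \<ge> 1" and E: "banach_space E" and F: "banach_space F"
  shows "p_complete_on p (poly_space n E F) (poly_upper \<H> n E F) (poly_upper_norm \<H> \<nu> n E F)"
proof -
  interpret quotient_norm "multi_space (replicate n E) F" "poly_space n E F" p
    "\<H> (replicate n E) F" "hat n E" "\<nu> (replicate n E) F" "poly_upper_norm \<H> \<nu> n E F"
    by (rule quotient_norm_poly_upper[OF n E F])
  show ?thesis
    using p_complete_image B admissible_replicate[OF n E F]
    by (simp add: poly_upper_eq[OF n E F] p_Banach_hyper_ideal_def)
qed

end

section \<open>Strongly symmetric hyper-ideals\<close>

lemma strongly_symmetricD:
  assumes "strongly_symmetric \<H> \<nu>" "n \<ge> 1" "banach_space E" "banach_space F" "\<sigma> permutes {..<n}"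
    "A \<in> \<H> (replicate n E) F"
  shows "permuted (replicate n E) \<sigma> A \<in> \<H> (replicate n E) F"
    "\<nu> (replicate n E) F (permuted (replicate n E) \<sigma> A) = \<nu> (replicate n E) F A"
  using assms unfolding strongly_symmetric_def by blast+

text \<open>
  The symmetrization is the average of \<open>fact n\<close> permuted copies of \<open>A\<close>, each of the same norm as
  \<open>A\<close>. The triangle inequality, hence \<open>p = 1\<close>, gives the bound.
\<close>

lemma symmetrization_estimate:
  assumes hyper: "hyper_ideal 1 \<H> \<nu>" and sym: "strongly_symmetric \<H> \<nu>"
    and n: "n \<ge> 1" and E: "banach_space E" and F: "banach_space F" and A: "A \<in> \<H> (replicate n E) F"
  shows "polar n E F (hat n E A) \<in> \<H> (replicate n E) F"
    and "\<nu> (replicate n E) F (polar n E F (hat n E A)) \<le> \<nu> (replicate n E) F A"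
proof -
  interpret hyper_ideal 1 \<H> \<nu> by (rule hyper)
  interpret banach_pair E F using E F by (simp add: banach_pair_def banach_on_def)
  note adm = admissible_replicate[OF n E F]
  let ?H = "\<H> (replicate n E) F" and ?\<nu> = "\<nu> (replicate n E) F"
  let ?M = "multi_space (replicate n E) F"
  define S where "S J = (\<lambda>xs\<in>tuples (replicate n E). \<Oplus>\<^bsub>F\<^esub>\<sigma>\<in>J. permuted (replicate n E) \<sigma> A xs)" for J
  note H_sub = \<H>_submodule[OF adm, unfolded fam.M.submodule_iff]
  have \<nu>_add: "?\<nu> (B \<oplus>\<^bsub>?M\<^esub> C) \<le> ?\<nu> B + ?\<nu> C" if "B \<in> ?H" "C \<in> ?H" for B C
  proof -
    have "B \<oplus>\<^bsub>?M\<^esub> C \<in> ?H" using that H_sub by blast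
    then have "?\<nu> (B \<oplus>\<^bsub>?M\<^esub> C) = ?\<nu> (B \<oplus>\<^bsub>?M\<^esub> C) powr 1" using \<nu>_nonneg[OF adm] by simp
    also have "\<dots> \<le> ?\<nu> B powr 1 + ?\<nu> C powr 1" using \<H>_norm[OF adm] that by (simp only: p_norm_on_def)
    finally show ?thesis using \<nu>_nonneg[OF adm] that by simp
  qed
  have A_perm: "permuted (replicate n E) \<sigma> A xs \<in> carrier F"
    if "\<sigma> permutes {..<n}" "xs \<in> tuples (replicate n E)" for \<sigma> xs
  proof (rule multilinear_closed[OF _ that(2)])
    show "multilinear (replicate n E) F (permuted (replicate n E) \<sigma> A)"
      using strongly_symmetricD(1)[OF sym n E F that(1) A] \<H>_subset[OF adm]
      by (auto simp: multi_ops_iff)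
  qed
  have "S J \<in> ?H \<and> ?\<nu> (S J) \<le> card J * ?\<nu> A" if "finite J" "J \<subseteq> {\<sigma>. \<sigma> permutes {..<n}}" for J
    using that
  proof (induction J rule: finite_induct)
    case empty
    have "S {} = \<zero>\<^bsub>?M\<^esub>" by (simp add: S_def multi_space_simps)
    moreover have "\<zero>\<^bsub>?M\<^esub> \<in> ?H" using H_sub by blast
    moreover from this have "?\<nu> \<zero>\<^bsub>?M\<^esub> = 0" using \<H>_norm[OF adm] unfolding p_norm_on_def by blast
    ultimately show ?case by simp
  next
    case (insert \<sigma> J)
    then have \<sigma>: "\<sigma> permutes {..<n}" and J: "J \<subseteq> {\<sigma>. \<sigma> permutes {..<n}}" by auto
    note perm = strongly_symmetricD[OF sym n E F \<sigma> A]
    have eq: "S (insert \<sigma> J) = permuted (replicate n E) \<sigma> A \<oplus>\<^bsub>?M\<^esub> S J"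
      unfolding S_def multi_space_simps
      using insert A_perm J by (intro restrict_ext) (auto intro!: F.finsum_insert)
    moreover have "?\<nu> (permuted (replicate n E) \<sigma> A \<oplus>\<^bsub>?M\<^esub> S J) \<le> ?\<nu> A + card J * ?\<nu> A"
      using \<nu>_add[OF perm(1), of "S J"] insert.IH[OF J] perm(2) by linarith
    moreover have "permuted (replicate n E) \<sigma> A \<oplus>\<^bsub>?M\<^esub> S J \<in> ?H"
      using perm(1) insert.IH[OF J] H_sub by blast
    ultimately show ?case using insert by (simp add: algebra_simps)
  qed
  from this[of "{\<sigma>. \<sigma> permutes {..<n}}"]
  have S: "S {\<sigma>. \<sigma> permutes {..<n}} \<in> ?H" "?\<nu> (S {\<sigma>. \<sigma> permutes {..<n}}) \<le> fact n * ?\<nu> A"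
    using card_permutations[of "{..<n}" n] by (auto simp: finite_permutations)
  have Am: "multilinear (replicate n E) F A" using \<H>_subset[OF adm] A by (auto simp: multi_ops_iff)
  have eq: "polar n E F (hat n E A) = inverse (fact n) \<odot>\<^bsub>?M\<^esub> S {\<sigma>. \<sigma> permutes {..<n}}"
    unfolding polar_hat_eq[OF Am] multi_space_simps by (rule restrict_ext) (simp add: S_def)
  show "polar n E F (hat n E A) \<in> ?H" using S(1) H_sub by (simp add: eq)
  have "?\<nu> (polar n E F (hat n E A)) = norm (inverse (fact n) :: 'a) * ?\<nu> (S {\<sigma>. \<sigma> permutes {..<n}})"
    using \<H>_norm[OF adm] S(1) unfolding eq p_norm_on_def by blast
  also have "norm (inverse (fact n) :: 'a) = inverse (fact n)"
    by (simp only: norm_inverse norm_fact)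
  also have "inverse (fact n) * ?\<nu> (S {\<sigma>. \<sigma> permutes {..<n}}) \<le> inverse (fact n) * (fact n * ?\<nu> A)"
    using S(2) by (intro mult_left_mono) auto
  also have "\<dots> = ?\<nu> A" by (simp add: mult.assoc[symmetric])
  finally show "?\<nu> (polar n E F (hat n E A)) \<le> ?\<nu> A" .
qed

text \<open>
  The symmetric operator of \<open>P\<close> is the symmetrization of every representative of
  \<open>P\<close>. By \<open>symmetrization_estimate\<close> it lies in \<open>\<H>\<close> as soon as some representative does, and it
  attains the infimum of the norms.
\<close>

lemma poly_lower_eq_poly_upper:
  assumes hyper: "hyper_ideal 1 \<H> \<nu>" and sym: "strongly_symmetric \<H> \<nu>"
    and n: "n \<ge> 1" and E: "banach_space E" and F: "banach_space F"
  shows "poly_lower \<H> n E F = poly_upper \<H> n E F"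
    and "P \<in> poly_upper \<H> n E F \<Longrightarrow> poly_lower_norm \<nu> n E F P = poly_upper_norm \<H> \<nu> n E F P"
proof -
  interpret hyper_ideal 1 \<H> \<nu> by (rule hyper)
  interpret banach_pair E F using E F by (simp add: banach_pair_def banach_on_def)
  interpret quotient_norm "multi_space (replicate n E) F" "poly_space n E F" 1
    "\<H> (replicate n E) F" "hat n E" "\<nu> (replicate n E) F" "poly_upper_norm \<H> \<nu> n E F"
    by (rule quotient_norm_poly_upper[OF n E F])
  note est = symmetrization_estimate[OF hyper sym n E F]
  show "poly_lower \<H> n E F = poly_upper \<H> n E F"
  proof (intro equalityI subsetI)
    fix P assume P: "P \<in> poly_lower \<H> n E F"
    then have "polar n E F P \<in> \<H> (replicate n E) F" "hat n E (polar n E F P) = P"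
      using polar_in_sym_ops(2) by (auto simp: poly_lower_def sym_op_of_eq_polar)
    then show "P \<in> poly_upper \<H> n E F" unfolding poly_upper_eq[OF n E F] by (metis imageI)
  next
    fix P assume "P \<in> poly_upper \<H> n E F"
    then show "P \<in> poly_lower \<H> n E F"
      using est(1) by (auto simp: poly_lower_def poly_upper_def sym_op_of_eq_polar)
  qed
  assume P: "P \<in> poly_upper \<H> n E F"
  then have polys: "P \<in> polys n E F" by (simp add: poly_upper_def)
  have P': "P \<in> hat n E ` \<H> (replicate n E) F" using P by (simp add: poly_upper_eq[OF n E F])
  then have polar: "polar n E F P \<in> \<H> (replicate n E) F" using est(1) by blast
  have "poly_upper_norm \<H> \<nu> n E F P \<le> \<nu> (replicate n E) F (polar n E F P)"
    using M_le[OF polar] polar_in_sym_ops(2)[OF polys] by simp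
  moreover have "\<nu> (replicate n E) F (polar n E F P) \<le> poly_upper_norm \<H> \<nu> n E F P"
    using est(2) by (intro le_at_M[OF P', where g = "\<lambda>t. t"]) auto
  ultimately show "poly_lower_norm \<nu> n E F P = poly_upper_norm \<H> \<nu> n E F P"
    by (simp add: poly_lower_norm_def sym_op_of_eq_polar[OF polys])
qed

text \<open>
  The equality of the two classes concerns Banach spaces and positive degrees, so it does not rewrite
  the classes as functions; the ideal properties are transferred one at a time.
\<close>

lemma poly_lower_two_sided_ideal:
  assumes hyper: "hyper_ideal 1 \<H> \<nu>" and sym: "strongly_symmetric \<H> \<nu>"
    and upper: "p_normed_two_sided_ideal 1 C K (poly_upper \<H>) (poly_upper_norm \<H> \<nu>)"
  shows "p_normed_two_sided_ideal 1 C K (poly_lower \<H>) (poly_lower_norm \<nu>)"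
proof -
  interpret hyper_ideal 1 \<H> \<nu> by (rule hyper)
  note eq = poly_lower_eq_poly_upper[OF hyper sym]
  note U = upper[unfolded p_normed_two_sided_ideal_def]
  show ?thesis
    unfolding p_normed_two_sided_ideal_def
  proof (intro conjI allI impI)
    show "two_sided_ideal_constants C" "two_sided_ideal_constants K" using U by blast+
  next
    fix n :: nat and E F :: "('a, 'b) space"
    assume n: "1 \<le> n" and EF: "banach_space E \<and> banach_space F"
    then have E: "banach_space E" and F: "banach_space F" by auto
    interpret banach_pair E F using E F by (simp add: banach_pair_def banach_on_def)
    have Un: "poly_upper \<H> n E F \<subseteq> polys n E F"
      "submodule (poly_upper \<H> n E F) (ring_of_type_algebra :: 'a ring) (poly_space n E F)"
      "{P. finite_type_poly n E F P} \<subseteq> poly_upper \<H> n E F"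
      "p_norm_on 1 (poly_space n E F) (poly_upper \<H> n E F) (poly_upper_norm \<H> \<nu> n E F)"
      using U n EF by blast+
    show "poly_lower \<H> n E F \<subseteq> polys n E F"
      "submodule (poly_lower \<H> n E F) (ring_of_type_algebra :: 'a ring) (poly_space n E F)"
      "{P. finite_type_poly n E F P} \<subseteq> poly_lower \<H> n E F"
      unfolding eq(1)[OF n E F] by (fact Un)+
    show "p_norm_on 1 (poly_space n E F) (poly_lower \<H> n E F) (poly_lower_norm \<nu> n E F)"
      unfolding eq(1)[OF n E F]
      using P.p_norm_on_cong(1)[OF Un(2), of "poly_lower_norm \<nu> n E F"] eq(2)[OF n E F] Un(4) by blast
  next
    fix n :: nat assume n: "1 \<le> n"
    let ?K = "scalar_space :: ('a, 'b) space"
    have "hat n ?K (scalar_product_op n) \<in> poly_upper \<H> n ?K ?K"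
      using scalar_product_op_in_\<H>[OF n] by (auto simp: poly_upper_eq[OF n banach_scalar banach_scalar])
    then show "poly_lower_norm \<nu> n ?K ?K (hat n ?K (scalar_product_op n)) = 1"
      using eq(2)[OF n banach_scalar banach_scalar] poly_upper_norm_scalar_product[OF n] by simp
  next
    fix m n r :: nat and G E F H :: "('a, 'b) space" and P Q R
    assume as: "m \<ge> 1 \<and> n \<ge> 1 \<and> r \<ge> 1 \<and>
      banach_space G \<and> banach_space E \<and> banach_space F \<and> banach_space H \<and>
      P \<in> poly_lower \<H> n E F \<and> Q \<in> polys m G E \<and> R \<in> polys r F H"
    then have rmn: "r * m * n \<ge> 1" by simp
    have P: "P \<in> poly_upper \<H> n E F" "poly_lower_norm \<nu> n E F P = poly_upper_norm \<H> \<nu> n E F P"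
      using as eq by auto
    let ?S = "\<lambda>x\<in>carrier G. R (P (Q x))"
    have S: "?S \<in> poly_upper \<H> (r * m * n) G H"
      "poly_upper_norm \<H> \<nu> (r * m * n) G H ?S \<le>
        K r * C m ^ (r * n) * vnorm (poly_space r F H) R * poly_upper_norm \<H> \<nu> n E F P ^ r *
        vnorm (poly_space m G E) Q ^ (r * n)"
      using U[THEN conjunct2, THEN conjunct2, THEN conjunct2, THEN conjunct2,
          rule_format, of m n r G E F H P Q R] as P(1) by blast+
    show "?S \<in> poly_lower \<H> (r * m * n) G H" using S(1) eq(1)[OF rmn] as by simp
    show "poly_lower_norm \<nu> (r * m * n) G H ?S \<le>
        K r * C m ^ (r * n) * vnorm (poly_space r F H) R * poly_lower_norm \<nu> n E F P ^ r *
        vnorm (poly_space m G E) Q ^ (r * n)"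
      using S eq(2)[OF rmn _ _ S(1)] as P(2) by simp
  qed
qed

lemma poly_lower_complete:
  assumes hyper: "hyper_ideal 1 \<H> \<nu>" and sym: "strongly_symmetric \<H> \<nu>"
    and n: "n \<ge> 1" and E: "banach_space E" and F: "banach_space F"
    and upper: "p_complete_on 1 (poly_space n E F) (poly_upper \<H> n E F) (poly_upper_norm \<H> \<nu> n E F)"
  shows "p_complete_on 1 (poly_space n E F) (poly_lower \<H> n E F) (poly_lower_norm \<nu> n E F)"
proof -
  interpret hyper_ideal 1 \<H> \<nu> by (rule hyper)
  interpret quotient_norm "multi_space (replicate n E) F" "poly_space n E F" 1
    "\<H> (replicate n E) F" "hat n E" "\<nu> (replicate n E) F" "poly_upper_norm \<H> \<nu> n E F"
    by (rule quotient_norm_poly_upper[OF n E F])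
  note eq = poly_lower_eq_poly_upper[OF hyper sym n E F]
  have "submodule (poly_upper \<H> n E F) (ring_of_type_algebra :: 'a ring) (poly_space n E F)"
    using submodule_image by (simp add: poly_upper_eq[OF n E F])
  from W.p_norm_on_cong(2)[OF this, of "poly_lower_norm \<nu> n E F"] eq(2) show ?thesis
    using upper by (simp add: eq(1))
qed

theorem proposition4p8:
  fixes \<H> :: "('k::{banach,real_normed_field}, 'u) op_class"
    and \<nu> :: "('k, 'u) op_norm"
    and c :: "nat \<Rightarrow> real"
  defines "c \<equiv> \<lambda>n. real n ^ n / fact n"
  assumes L_sub: "\<And>Es F. admissible Es F \<Longrightarrow> L_comp \<H> Es F \<subseteq> \<H> Es F"
    and L_norm: "\<And>Es F A. admissible Es F \<Longrightarrow> A \<in> L_comp \<H> Es F \<Longrightarrow>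
                   \<nu> Es F A \<le> L_comp_norm \<H> \<nu> Es F A"
  shows
    "(\<forall>p. 0 < p \<and> p \<le> 1 \<longrightarrow>
       (p_normed_hyper_ideal p \<H> \<nu> \<longrightarrow>
          p_normed_two_sided_ideal p c c (poly_upper \<H>) (poly_upper_norm \<H> \<nu>)) \<and>
       (p_Banach_hyper_ideal p \<H> \<nu> \<longrightarrow>
          p_Banach_two_sided_ideal p c c (poly_upper \<H>) (poly_upper_norm \<H> \<nu>))) \<and>
     (strongly_symmetric \<H> \<nu> \<longrightarrow>
       (p_normed_hyper_ideal 1 \<H> \<nu> \<longrightarrow>
          p_normed_two_sided_ideal 1 c c (poly_lower \<H>) (poly_lower_norm \<nu>)) \<and>
       (p_Banach_hyper_ideal 1 \<H> \<nu> \<longrightarrow>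
          p_Banach_two_sided_ideal 1 c c (poly_lower \<H>) (poly_lower_norm \<nu>)))"
proof -
  have hyper: "hyper_ideal p \<H> \<nu>" if "0 < p" "p_normed_hyper_ideal p \<H> \<nu>" for p
    using that by unfold_locales
  have L_hyper: "L_hyper_ideal p \<H> \<nu>" if "0 < p" "p_normed_hyper_ideal p \<H> \<nu>" for p
    using hyper[OF that] L_sub L_norm by (intro L_hyper_ideal.intro L_hyper_ideal_axioms.intro)
  have normed: "p_normed_two_sided_ideal p c c (poly_upper \<H>) (poly_upper_norm \<H> \<nu>)"
    if "0 < p" "p_normed_hyper_ideal p \<H> \<nu>" for p
    unfolding c_def by (rule L_hyper_ideal.poly_upper_two_sided_ideal[OF L_hyper[OF that]])
  have complete: "p_complete_on p (poly_space n E F) (poly_upper \<H> n E F) (poly_upper_norm \<H> \<nu> n E F)"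
    if "0 < p" "p_Banach_hyper_ideal p \<H> \<nu>" "n \<ge> 1" "banach_space E" "banach_space F" for p n E F
    using that by (intro L_hyper_ideal.poly_upper_complete[OF L_hyper]) (auto simp: p_Banach_hyper_ideal_def)
  have lower: "p_normed_two_sided_ideal 1 c c (poly_lower \<H>) (poly_lower_norm \<nu>)"
    if "strongly_symmetric \<H> \<nu>" "p_normed_hyper_ideal 1 \<H> \<nu>"
    using that by (intro poly_lower_two_sided_ideal hyper normed) auto
  have lower_complete: "p_complete_on 1 (poly_space n E F) (poly_lower \<H> n E F) (poly_lower_norm \<nu> n E F)"
    if "strongly_symmetric \<H> \<nu>" "p_Banach_hyper_ideal 1 \<H> \<nu>" "n \<ge> 1" "banach_space E" "banach_space F" for n E F
    using that complete by (intro poly_lower_complete hyper) (auto simp: p_Banach_hyper_ideal_def)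
  show ?thesis
    using normed complete lower lower_complete
    by (auto simp: p_Banach_hyper_ideal_def p_Banach_two_sided_ideal_def)
qed

end
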